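(* Let $0\le h\le n$, $0\le k\le n/2$, $0\le i\le h/2$, $0\le j\le (n-h)/2$ be integers, let $A=\{1,\dots,h\}$, $B=\{h+1,\dots,n\}$, and let $S_{n-h}\times S_h\le S_n$ be the stabilizer of $A$ (with $S_h$ acting on $A$ and $S_{n-h}$ acting on $B$). The multiplicity of $S^{h-i,i}(A)\otimes S^{n-h-j,j}(B)$ in $\mathrm{Res}^{S_n}_{S_{n-h}\times S_h}S^{n-k,k}$ is equal to $1$ if $k-h\le j-i\le n-h-k$ and $i+j\le k$; otherwise it is equal to $0$. In particular, $$\mathrm{Res}^{S_n}_{S_{n-h}\times S_h}S^{n-k,k}\cong\bigoplus S^{h-i,i}(A)\otimes S^{n-h-j,j}(B),$$ where the sum is over all $(i,j)$ with $0\le i\le h/2$, $0\le j\le (n-h)/2$ satisfying the conditions above (and the decomposition is multiplicity free). Moreover, for such $(i,j)$, the map $$\phi\otimes\psi\longmapsto\sum_{l=j}^{k-i}E_{k-i-j}(n-h-2j,\,h-2i,\,k-i-j,\,l-j)\,(R_{k-l-i}\phi)\otimes(R_{l-j}\psi)$$ is an injective $S_{n-h}\times S_h$-equivariant linear map of $S^{h-i,i}(A)\otimes S^{n-h-j,j}(B)$ into $\mathrm{Res}^{S_n}_{S_{n-h}\times S_h}S^{n-k,k}$.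
   Context: For a finite set $X$ with $|X|=t$ and $0\le j\le t$, $M^{t-j,j}(X)$ is the space of complex functions on the set of $j$-subsets of $X$ (a permutation module of $\mathrm{Sym}(X)$), with Dirac functions $\delta_C$; spaces with $j<0$ or $j>t$ are $0$. Define linear maps $d\delta_C=\sum_{x\in C}\delta_{C\setminus\{x\}}$ and, for $q\ge0$, $R_q\delta_C=\sum_{D\supseteq C,\ |D|=|C|+q}\delta_D$ (where $D$ ranges over subsets of $X$). For $0\le j\le t/2$, $S^{t-j,j}(X)=M^{t-j,j}(X)\cap\mathrm{Ker}\,d$, an irreducible representation of $\mathrm{Sym}(X)$. When $X=\{1,\dots,n\}$ write $M^{n-m,m}$, $S^{n-k,k}$. If $F$ is a function on $p$-subsets of $A$ and $G$ a function on $q$-subsets of $B$ ($A,B$ disjoint), $F\otimes G$ is the function on $(p+q)$-subsets $Z$ of $A\cup B$ equal to $F(Z\cap A)G(Z\cap B)$ if $|Z\cap A|=p$ and $0$ otherwise. Hahn polynomials: for integers with $0\le c\le a+b$, $0\le m\le\min\{a,b,c,a+b-c\}$, $\max\{c-b,0\}\le x\le\min\{a,c\}$, $$E_m(a,b,c,x)=\sum_{r=\max\{0,x-c+m\}}^{\min\{m,x\}}(-1)^r\binom{m}{r}(b-m+1)_r(-x)_r(a-m+1)_{m-r}(x-c)_{m-r},$$ where $(x)_s=x(x+1)\cdots(x+s-1)$. *)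

theory Defs
  imports
    Complex_Main
    "HOL-Library.Function_Algebras"
    "HOL-Algebra.Sym_Groups"
    "HOL-Algebra.Group_Action"
begin

section \<open>Complex function spaces and group representations on them\<close>

text \<open>Every representation space below is a subspace of the vector space of all functions
  \<open>'x \<Rightarrow> complex\<close> on some type, with the pointwise operations.\<close>

definition fscale :: "complex \<Rightarrow> ('x \<Rightarrow> complex) \<Rightarrow> ('x \<Rightarrow> complex)"
  where "fscale c f = (\<lambda>x. c * f x)"

global_interpretation cfun: vector_space fscale
  by unfold_locales (auto simp: fscale_def fun_eq_iff algebra_simps)

definition linear_on :: "('x \<Rightarrow> complex) set \<Rightarrow> (('x \<Rightarrow> complex) \<Rightarrow> ('y \<Rightarrow> complex)) \<Rightarrow> bool"
  where "linear_on V T \<longleftrightarrow>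
    (\<forall>u\<in>V. \<forall>v\<in>V. T (u + v) = T u + T v) \<and> (\<forall>c. \<forall>v\<in>V. T (fscale c v) = fscale c (T v))"

text \<open>In the following, \<open>G\<close> is the set of group elements, and \<open>\<rho>\<close>, \<open>\<sigma>\<close> are the actions of
  the group on the spaces \<open>V\<close>, \<open>W\<close>.\<close>

definition equivariant_on ::
  "'g set \<Rightarrow> ('g \<Rightarrow> ('x \<Rightarrow> complex) \<Rightarrow> ('x \<Rightarrow> complex)) \<Rightarrow> ('x \<Rightarrow> complex) set
   \<Rightarrow> ('g \<Rightarrow> ('y \<Rightarrow> complex) \<Rightarrow> ('y \<Rightarrow> complex)) \<Rightarrow> (('x \<Rightarrow> complex) \<Rightarrow> ('y \<Rightarrow> complex)) \<Rightarrow> bool"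
  where "equivariant_on G \<rho> V \<sigma> T \<longleftrightarrow> (\<forall>g\<in>G. \<forall>v\<in>V. T (\<rho> g v) = \<sigma> g (T v))"

definition rep_iso ::
  "'g set \<Rightarrow> ('g \<Rightarrow> ('x \<Rightarrow> complex) \<Rightarrow> ('x \<Rightarrow> complex)) \<Rightarrow> ('x \<Rightarrow> complex) set
   \<Rightarrow> ('g \<Rightarrow> ('y \<Rightarrow> complex) \<Rightarrow> ('y \<Rightarrow> complex)) \<Rightarrow> ('y \<Rightarrow> complex) set \<Rightarrow> bool"
  where "rep_iso G \<rho> V \<sigma> W \<longleftrightarrow>
    (\<exists>T. linear_on V T \<and> equivariant_on G \<rho> V \<sigma> T \<and> bij_betw T V W)"

definition subrep ::
  "'g set \<Rightarrow> ('g \<Rightarrow> ('x \<Rightarrow> complex) \<Rightarrow> ('x \<Rightarrow> complex)) \<Rightarrow> ('x \<Rightarrow> complex) set \<Rightarrow> bool"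
  where "subrep G \<rho> V \<longleftrightarrow> cfun.subspace V \<and> (\<forall>g\<in>G. \<forall>v\<in>V. \<rho> g v \<in> V)"

definition irreducible_rep ::
  "'g set \<Rightarrow> ('g \<Rightarrow> ('x \<Rightarrow> complex) \<Rightarrow> ('x \<Rightarrow> complex)) \<Rightarrow> ('x \<Rightarrow> complex) set \<Rightarrow> bool"
  where "irreducible_rep G \<rho> V \<longleftrightarrow>
    subrep G \<rho> V \<and> V \<noteq> {0} \<and> (\<forall>U. subrep G \<rho> U \<and> U \<subseteq> V \<longrightarrow> U = {0} \<or> U = V)"

text \<open>\<open>V\<close> is the internal direct sum of the irreducible subrepresentations
  \<open>U 0, \<dots>, U (r - 1)\<close>.\<close>

definition irreducible_decomposition ::
  "'g set \<Rightarrow> ('g \<Rightarrow> ('x \<Rightarrow> complex) \<Rightarrow> ('x \<Rightarrow> complex)) \<Rightarrow> ('x \<Rightarrow> complex) set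
   \<Rightarrow> nat \<Rightarrow> (nat \<Rightarrow> ('x \<Rightarrow> complex) set) \<Rightarrow> bool"
  where "irreducible_decomposition G \<rho> V r U \<longleftrightarrow>
    (\<forall>s<r. irreducible_rep G \<rho> (U s) \<and> U s \<subseteq> V) \<and>
    (\<forall>v\<in>V. \<exists>!u. (\<forall>s<r. u s \<in> U s) \<and> (\<forall>s\<ge>r. u s = 0) \<and> v = (\<Sum>s<r. u s))"

text \<open>Multiplicity of the irreducible representation \<open>W\<close> in \<open>V\<close>: the number of summands
  isomorphic to \<open>W\<close> in a decomposition of \<open>V\<close> into irreducibles. For finite groups and
  finite-dimensional \<open>V\<close> this number exists and does not depend on the decomposition.\<close>

definition rep_multiplicity ::
  "'g set \<Rightarrow> ('g \<Rightarrow> ('y \<Rightarrow> complex) \<Rightarrow> ('y \<Rightarrow> complex)) \<Rightarrow> ('y \<Rightarrow> complex) set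
   \<Rightarrow> ('g \<Rightarrow> ('x \<Rightarrow> complex) \<Rightarrow> ('x \<Rightarrow> complex)) \<Rightarrow> ('x \<Rightarrow> complex) set \<Rightarrow> nat"
  where "rep_multiplicity G \<sigma> W \<rho> V =
    (THE m. \<exists>r U. irreducible_decomposition G \<rho> V r U \<and>
                  m = card {s. s < r \<and> rep_iso G \<rho> (U s) \<sigma> W})"

text \<open>External direct sum of a family \<open>W\<close> of representations indexed by \<open>I\<close>: the tuple
  \<open>(w p)\<close> is encoded as the function \<open>(p, x) \<mapsto> w p x\<close>.\<close>

definition dsum :: "'i set \<Rightarrow> ('i \<Rightarrow> ('x \<Rightarrow> complex) set) \<Rightarrow> ('i \<times> 'x \<Rightarrow> complex) set"
  where "dsum I W =
    {F. (\<forall>p\<in>I. (\<lambda>x. F (p, x)) \<in> W p) \<and> (\<forall>p x. p \<notin> I \<longrightarrow> F (p, x) = 0)}"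

definition dsum_act ::
  "('g \<Rightarrow> ('x \<Rightarrow> complex) \<Rightarrow> ('x \<Rightarrow> complex)) \<Rightarrow> 'g \<Rightarrow> ('i \<times> 'x \<Rightarrow> complex) \<Rightarrow> ('i \<times> 'x \<Rightarrow> complex)"
  where "dsum_act \<rho> g F = (\<lambda>(p, x). \<rho> g (\<lambda>y. F (p, y)) x)"

text \<open>The direct sum of the family \<open>W\<close> is multiplicity free: its summands are irreducible and
  pairwise non-isomorphic.\<close>

definition multiplicity_free_family ::
  "'g set \<Rightarrow> ('g \<Rightarrow> ('x \<Rightarrow> complex) \<Rightarrow> ('x \<Rightarrow> complex)) \<Rightarrow> 'i set
   \<Rightarrow> ('i \<Rightarrow> ('x \<Rightarrow> complex) set) \<Rightarrow> bool"
  where "multiplicity_free_family G \<rho> I W \<longleftrightarrow>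
    (\<forall>p\<in>I. irreducible_rep G \<rho> (W p)) \<and>
    (\<forall>p\<in>I. \<forall>q\<in>I. p \<noteq> q \<longrightarrow> \<not> rep_iso G \<rho> (W p) \<rho> (W q))"


section \<open>Functions on subsets\<close>

text \<open>A function on the \<open>j\<close>-subsets of \<open>X\<close> is extended by \<open>0\<close> to all sets.\<close>

definition Mspace :: "nat set \<Rightarrow> nat \<Rightarrow> (nat set \<Rightarrow> complex) set"
  where "Mspace X j = {f. \<forall>C. f C \<noteq> 0 \<longrightarrow> C \<subseteq> X \<and> card C = j}"

definition dirac :: "nat set \<Rightarrow> nat set \<Rightarrow> complex"
  where "dirac C = (\<lambda>D. if D = C then 1 else 0)"

text \<open>Both maps are the linear extensions of their values on Dirac functions.\<close>

definition d_map :: "nat set \<Rightarrow> (nat set \<Rightarrow> complex) \<Rightarrow> (nat set \<Rightarrow> complex)"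
  where "d_map X f = (\<Sum>C\<in>Pow X. fscale (f C) (\<Sum>x\<in>C. dirac (C - {x})))"

definition R_map :: "nat set \<Rightarrow> nat \<Rightarrow> (nat set \<Rightarrow> complex) \<Rightarrow> (nat set \<Rightarrow> complex)"
  where "R_map X q f =
    (\<Sum>C\<in>Pow X. fscale (f C) (\<Sum>D\<in>{D. C \<subseteq> D \<and> D \<subseteq> X \<and> card D = card C + q}. dirac D))"

text \<open>\<open>Sspace X j\<close> is $S^{t-j,j}(X)$ with \<open>t = card X\<close>; it is meant for finite \<open>X\<close> and
  \<open>2 * j \<le> card X\<close>.\<close>

definition Sspace :: "nat set \<Rightarrow> nat \<Rightarrow> (nat set \<Rightarrow> complex) set"
  where "Sspace X j = {f \<in> Mspace X j. d_map X f = 0}"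

text \<open>For disjoint \<open>A\<close>, \<open>B\<close>: the product of a function on \<open>p\<close>-subsets of \<open>A\<close> and a function on
  \<open>q\<close>-subsets of \<open>B\<close>, as a function on \<open>(p + q)\<close>-subsets of \<open>A \<union> B\<close>.\<close>

definition tensor ::
  "nat set \<Rightarrow> nat \<Rightarrow> nat set \<Rightarrow> nat
   \<Rightarrow> (nat set \<Rightarrow> complex) \<Rightarrow> (nat set \<Rightarrow> complex) \<Rightarrow> (nat set \<Rightarrow> complex)"
  where "tensor A p B q F G =
    (\<lambda>Z. if Z \<subseteq> A \<union> B \<and> card Z = p + q \<and> card (Z \<inter> A) = p then F (Z \<inter> A) * G (Z \<inter> B) else 0)"

text \<open>The tensor product of the spaces, realised by these products: as \<open>A\<close> and \<open>B\<close> are disjoint,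
  the sets \<open>Z\<close> above correspond to the pairs \<open>(Z \<inter> A, Z \<inter> B)\<close>.\<close>

definition S_tensor :: "nat set \<Rightarrow> nat \<Rightarrow> nat set \<Rightarrow> nat \<Rightarrow> (nat set \<Rightarrow> complex) set"
  where "S_tensor A i B j =
    cfun.span {tensor A i B j \<phi> \<psi> | \<phi> \<psi>. \<phi> \<in> Sspace A i \<and> \<psi> \<in> Sspace B j}"

text \<open>The action $(\pi f)(C) = f(\pi^{-1}(C))$; the preimage \<open>\<pi> -` C\<close> is $\pi^{-1}(C)$.\<close>

definition perm_act :: "(nat \<Rightarrow> nat) \<Rightarrow> (nat set \<Rightarrow> complex) \<Rightarrow> (nat set \<Rightarrow> complex)"
  where "perm_act \<pi> f = (\<lambda>C. f (\<pi> -` C))"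

text \<open>On tensor products, \<open>perm_act\<close> is the product action: \<open>\<pi>\<close> acts on the first factor through
  its restriction to \<open>A\<close>, on the second one through its restriction to \<open>B\<close>.\<close>

lemma perm_act_tensor:
  assumes "bij \<pi>" "\<pi> ` A = A" "\<pi> ` B = B"
  shows "perm_act \<pi> (tensor A p B q F G) = tensor A p B q (perm_act \<pi> F) (perm_act \<pi> G)"
proof
  fix Z
  have A: "\<pi> -` A = A" and B: "\<pi> -` B = B"
    using assms by (metis bij_is_inj inj_vimage_image_eq)+
  have card: "card (\<pi> -` Y) = card Y" for Y
    using assms(1) by (simp add: bij_is_inj bij_is_surj card_vimage_inj)
  have sub: "\<pi> -` Z \<subseteq> A \<union> B \<longleftrightarrow> Z \<subseteq> A \<union> B"
    using assms(1) A B by (metis bij_is_surj surj_image_vimage_eq image_mono vimage_Un vimage_mono)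
  have int: "\<pi> -` Z \<inter> A = \<pi> -` (Z \<inter> A)" "\<pi> -` Z \<inter> B = \<pi> -` (Z \<inter> B)"
    using A B by auto
  show "perm_act \<pi> (tensor A p B q F G) Z = tensor A p B q (perm_act \<pi> F) (perm_act \<pi> G) Z"
    using card[of "Z \<inter> A"] by (simp only: perm_act_def tensor_def sub int card)
qed

text \<open>$S_{n-h} \times S_h$, the stabilizer of $\{1,\dots,h\}$ in $S_n$.\<close>

definition stab_group :: "nat \<Rightarrow> nat \<Rightarrow> (nat \<Rightarrow> nat) set"
  where "stab_group n h = stabilizer (sym_group n) (\<lambda>\<pi> C. \<pi> ` C) {1..h}"


section \<open>Hahn polynomials\<close>

text \<open>All parameters are integers, so that no subtraction is truncated; the arguments of \<open>nat\<close>
  are nonnegative on the intended domain.\<close>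

definition hahn_E :: "int \<Rightarrow> int \<Rightarrow> int \<Rightarrow> int \<Rightarrow> int \<Rightarrow> int"
  where "hahn_E m a b c x =
    (\<Sum>r = max 0 (x - c + m)..min m x.
       (-1) ^ nat r * int (nat m choose nat r)
       * pochhammer (b - m + 1) (nat r) * pochhammer (- x) (nat r)
       * pochhammer (a - m + 1) (nat (m - r)) * pochhammer (x - c) (nat (m - r)))"


section \<open>The pairs occurring in the branching rule\<close>

definition branching_pairs :: "nat \<Rightarrow> nat \<Rightarrow> nat \<Rightarrow> (nat \<times> nat) set"
  where "branching_pairs n h k =
    {(i, j). 2 * i \<le> h \<and> 2 * j \<le> n - h \<and>
       int k - int h \<le> int j - int i \<and> int j - int i \<le> int n - int h - int k \<and> i + j \<le> k}"

end

theory Submission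
  imports Defs
begin

text \<open>Write \<open>A\<close> and \<open>B\<close> for the two parts. The proof runs on two operators on functions of sets,
  defined for any set \<open>X\<close> of points: \<open>lower X\<close> sums over the ways to add a point of \<open>X\<close> to the argument,
  and its transpose \<open>raise X\<close> over the ways to remove one. For functions on the subsets of \<open>X\<close> these are
  \<open>d\<close> and \<open>R\<^sub>1\<close>, and \<open>R\<^sub>q\<close> is \<open>raise X ^^ q\<close> divided by \<open>q!\<close>. The two operators satisfy the
  relation of \<open>sl\<^sub>2\<close> (\<open>lower_raise\<close>), those of \<open>A\<close> commute with those of \<open>B\<close>, and
  \<open>lower (A \<union> B) = lower A + lower B\<close>. In these terms the restricted module is the kernel of
  \<open>lower A + lower B\<close> on \<open>k\<close>-sets, and the product of Specht modules with indices \<open>i\<close>, \<open>j\<close> is the space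
  \<open>bispecht A B i j\<close> of the functions on sets with \<open>i\<close> points in \<open>A\<close> and \<open>j\<close> points in \<open>B\<close> that
  are killed by both \<open>lower A\<close> and \<open>lower B\<close>.

  Irreducibility and inequivalence of the products come from one computation
  (\<open>lower_fixed_vanish\<close>): a function in \<open>bispecht A B i j\<close> that is fixed by the stabilizer of a set \<open>Z\<close>
  is determined by its value at \<open>Z\<close> if \<open>Z\<close> has the sizes \<open>i\<close>, \<open>j\<close>, and is zero if \<open>Z\<close> has fewer than
  \<open>i\<close> points in \<open>A\<close> or fewer than \<open>j\<close> points in \<open>B\<close>. The translates of the unique fixed vector form a
  reproducing kernel, which makes the space irreducible; the vanishing excludes isomorphisms.

  For the map of the statement put \<open>m = k - i - j\<close>. Since the third parameter of the Hahn polynomial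
  equals its degree \<open>m\<close>, only one term of its defining sum survives, and the coefficients satisfy the
  two-term recurrence that makes the contributions of \<open>lower A\<close> and \<open>lower B\<close> cancel. Applying
  \<open>lower A\<close> \<open>m\<close> times to the image of \<open>w\<close> leaves only the summand with all \<open>m\<close> points added in \<open>A\<close>, and
  returns a nonzero multiple of \<open>w\<close>; hence the map is injective.

  The kernels of \<open>lower A ^^ m\<close> filter the restricted module. If \<open>f\<close> is killed by \<open>lower A ^^ (m + 1)\<close>,
  then \<open>lower A ^^ m\<close> sends it to a function that is killed by \<open>lower A\<close> and, because
  \<open>lower B f = - lower A f\<close>, by \<open>lower B\<close>: a sum of members of the spaces \<open>bispecht A B i j\<close> with
  \<open>i + j = k - m\<close>. A component with \<open>(i, j)\<close> outside the branching range vanishes, because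
  \<open>raise A ^^ m\<close> or \<open>raise B ^^ m\<close> kills \<open>bispecht A B i j\<close> and is adjoint to the lowering that
  produced the component. The other components are removed by subtracting images of the Hahn maps,
  which lowers \<open>m\<close>. So the Hahn maps together give an isomorphism from the direct sum. The
  multiplicities follow from Schur's lemma (\<open>rep_multiplicity_multiplicity_free\<close>).\<close>

section \<open>Linear equivariant maps between function representations\<close>

lemma sum_cfun_apply: "(\<Sum>s\<in>S. f s) x = (\<Sum>s\<in>S. f s x)"
  for f :: "'a \<Rightarrow> 'x \<Rightarrow> complex"
  by (induction S rule: infinite_finite_induct) auto

lemma fscale_apply [simp]: "fscale c f x = c * f x"
  by (simp add: fscale_def)

lemma linear_on_zero:
  assumes "cfun.subspace V" "linear_on V T"
  shows "T 0 = 0"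
proof -
  have "T (fscale 0 0) = fscale 0 (T 0)"
    using assms unfolding linear_on_def by (metis cfun.subspace_0)
  then show ?thesis by simp
qed

lemma linear_on_sum:
  assumes "cfun.subspace V" "linear_on V T" "\<And>s. s \<in> S \<Longrightarrow> v s \<in> V"
  shows "T (\<Sum>s\<in>S. v s) = (\<Sum>s\<in>S. T (v s))"
  using assms(3)
proof (induction S rule: infinite_finite_induct)
  case (insert s S)
  have "(\<Sum>s\<in>S. v s) \<in> V" "v s \<in> V"
    using insert by (auto intro!: cfun.subspace_sum[OF assms(1)])
  then have "T (v s + (\<Sum>s\<in>S. v s)) = T (v s) + T (\<Sum>s\<in>S. v s)"
    using assms(2) unfolding linear_on_def by blast
  moreover have "T (\<Sum>s\<in>S. v s) = (\<Sum>s\<in>S. T (v s))" using insert by blast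
  ultimately show ?case using sum.insert[OF insert(1,2)] by metis
qed (use linear_on_zero[OF assms(1,2)] in simp_all)

lemma linear_on_subset: "linear_on V T \<Longrightarrow> U \<subseteq> V \<Longrightarrow> linear_on U T"
  unfolding linear_on_def by blast

lemma equivariant_on_subset:
  "equivariant_on G \<rho> V \<sigma> T \<Longrightarrow> U \<subseteq> V \<Longrightarrow> equivariant_on G \<rho> U \<sigma> T"
  unfolding equivariant_on_def by blast

lemma linear_on_diff:
  assumes "cfun.subspace V" "linear_on V T" "u \<in> V" "v \<in> V"
  shows "T (u - v) = T u - T v"
proof -
  have *: "u - v = u + fscale (-1) v" by (simp add: fun_eq_iff)
  have "T (u - v) = T u + fscale (-1) (T v)"
    unfolding * using assms cfun.subspace_scale[OF assms(1)] unfolding linear_on_def by metis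
  also have "\<dots> = T u - T v" by (simp add: fun_eq_iff)
  finally show ?thesis .
qed

lemma subspace_linear_image:
  assumes "cfun.subspace V" "linear_on V T"
  shows "cfun.subspace (T ` V)"
  unfolding cfun.subspace_def
proof (intro conjI ballI allI)
  show "0 \<in> T ` V" using linear_on_zero[OF assms] cfun.subspace_0[OF assms(1)] by (metis imageI)
next
  fix x y assume "x \<in> T ` V" "y \<in> T ` V"
  then show "x + y \<in> T ` V"
    using assms cfun.subspace_add[OF assms(1)] unfolding linear_on_def by (auto, metis imageI)
next
  fix c x assume "x \<in> T ` V"
  then show "fscale c x \<in> T ` V"
    using assms cfun.subspace_scale[OF assms(1)] unfolding linear_on_def by (auto, metis imageI)
qed

lemma subrep_image:
  assumes "subrep G \<rho> V" "linear_on V T" "equivariant_on G \<rho> V \<sigma> T"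
  shows "subrep G \<sigma> (T ` V)"
  using assms subspace_linear_image[of V T] unfolding subrep_def equivariant_on_def
  by (auto, metis imageI)

lemma subrep_kernel:
  assumes "subrep G \<rho> V" "linear_on V T" "equivariant_on G \<rho> V \<sigma> T"
    and "\<And>g. g \<in> G \<Longrightarrow> linear_on UNIV (\<sigma> g)"
  shows "subrep G \<rho> {v \<in> V. T v = 0}"
proof -
  have V: "cfun.subspace V" using assms(1) by (simp add: subrep_def)
  have "T 0 = 0" using linear_on_zero[OF V assms(2)] .
  then have "cfun.subspace {v \<in> V. T v = 0}"
    using V assms(2) unfolding linear_on_def cfun.subspace_def by auto
  moreover have "\<sigma> g 0 = 0" if "g \<in> G" for g
    using linear_on_zero[OF cfun.subspace_UNIV assms(4)[OF that]] .
  ultimately show ?thesis using assms(1,3) unfolding subrep_def equivariant_on_def by auto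
qed

lemma inj_on_linear_iff:
  assumes "cfun.subspace V" "linear_on V T"
  shows "inj_on T V \<longleftrightarrow> (\<forall>v\<in>V. T v = 0 \<longrightarrow> v = 0)"
proof
  assume "inj_on T V"
  then show "\<forall>v\<in>V. T v = 0 \<longrightarrow> v = 0"
    using linear_on_zero[OF assms] cfun.subspace_0[OF assms(1)] by (metis inj_onD)
next
  assume *: "\<forall>v\<in>V. T v = 0 \<longrightarrow> v = 0"
  show "inj_on T V"
  proof (rule inj_onI)
    fix u v assume uv: "u \<in> V" "v \<in> V" "T u = T v"
    then have "T (u - v) = 0" using linear_on_diff[OF assms uv(1,2)] by simp
    then have "u - v = 0" using * cfun.subspace_diff[OF assms(1) uv(1,2)] by blast
    then show "u = v" by simp
  qed
qed

text \<open>The kernel and the image of \<open>T\<close> are subrepresentations of \<open>V\<close> and \<open>W\<close>, so each of them is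
  zero or everything.\<close>

lemma Schur:
  assumes "irreducible_rep G \<rho> V" "irreducible_rep G \<sigma> W"
    and "linear_on V T" "equivariant_on G \<rho> V \<sigma> T" "T ` V \<subseteq> W"
    and "\<And>g. g \<in> G \<Longrightarrow> linear_on UNIV (\<sigma> g)"
  shows "(\<forall>v\<in>V. T v = 0) \<or> bij_betw T V W"
proof (rule disjCI)
  assume nonzero: "\<not> bij_betw T V W"
  show "\<forall>v\<in>V. T v = 0"
  proof (rule ccontr)
    assume "\<not> (\<forall>v\<in>V. T v = 0)"
    then obtain v where v: "v \<in> V" "T v \<noteq> 0" by blast
    have V: "subrep G \<rho> V" "cfun.subspace V" using assms(1)
      by (simp_all add: irreducible_rep_def subrep_def)
    have "{v \<in> V. T v = 0} = {0}"
      using subrep_kernel[OF V(1) assms(3,4,6)] assms(1) v unfolding irreducible_rep_def by blast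
    then have "inj_on T V" using inj_on_linear_iff[OF V(2) assms(3)] by blast
    moreover have "T ` V = W"
      using subrep_image[OF V(1) assms(3,4)] assms(2,5) v unfolding irreducible_rep_def by blast
    ultimately show False using nonzero by (simp add: bij_betw_def)
  qed
qed

lemma rep_iso_sym:
  assumes "rep_iso G \<rho> V \<sigma> W" "subrep G \<rho> V"
  shows "rep_iso G \<sigma> W \<rho> V"
proof -
  obtain T where T: "linear_on V T" "equivariant_on G \<rho> V \<sigma> T" "bij_betw T V W"
    using assms(1) unfolding rep_iso_def by blast
  define S where "S = the_inv_into V T"
  have inj: "inj_on T V" and W: "W = T ` V" using T(3) by (auto simp: bij_betw_def)
  have S: "S (T v) = v" if "v \<in> V" for v using the_inv_into_f_f[OF inj that] by (simp add: S_def)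
  have V: "cfun.subspace V" "\<And>g v. g \<in> G \<Longrightarrow> v \<in> V \<Longrightarrow> \<rho> g v \<in> V"
    using assms(2) by (auto simp: subrep_def)
  have "linear_on W S"
    unfolding linear_on_def
  proof (intro conjI ballI allI)
    fix u v assume "u \<in> W" "v \<in> W"
    then obtain u' v' where uv: "u = T u'" "v = T v'" "u' \<in> V" "v' \<in> V" unfolding W by blast
    then have "u + v = T (u' + v')" using T(1) unfolding linear_on_def by simp
    then show "S (u + v) = S u + S v" using S uv cfun.subspace_add[OF V(1)] by simp
  next
    fix c v assume "v \<in> W"
    then obtain v' where v: "v = T v'" "v' \<in> V" unfolding W by blast
    then have "fscale c v = T (fscale c v')" using T(1) unfolding linear_on_def by simp
    then show "S (fscale c v) = fscale c (S v)" using S v cfun.subspace_scale[OF V(1)] by simp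
  qed
  moreover have "equivariant_on G \<sigma> W \<rho> S"
    unfolding equivariant_on_def
  proof (intro ballI)
    fix g v assume g: "g \<in> G" and "v \<in> W"
    then obtain v' where v: "v = T v'" "v' \<in> V" unfolding W by blast
    then have "\<sigma> g v = T (\<rho> g v')" using T(2) g unfolding equivariant_on_def by simp
    then show "S (\<sigma> g v) = \<rho> g (S v)" using S v V(2)[OF g] by simp
  qed
  moreover have "bij_betw S W V" unfolding S_def by (rule bij_betw_the_inv_into[OF T(3)])
  ultimately show ?thesis unfolding rep_iso_def by blast
qed

lemma rep_iso_trans:
  assumes "rep_iso G \<rho> U \<sigma> V" "rep_iso G \<sigma> V \<tau> W"
  shows "rep_iso G \<rho> U \<tau> W"
proof -
  obtain S T where S: "linear_on U S" "equivariant_on G \<rho> U \<sigma> S" "bij_betw S U V"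
    and T: "linear_on V T" "equivariant_on G \<sigma> V \<tau> T" "bij_betw T V W"
    using assms unfolding rep_iso_def by blast
  have SV: "S u \<in> V" if "u \<in> U" for u using S(3) that by (auto simp: bij_betw_def)
  have "linear_on U (T \<circ> S)" "equivariant_on G \<rho> U \<tau> (T \<circ> S)"
    using S(1,2) T(1,2) SV unfolding linear_on_def equivariant_on_def by simp_all
  then show ?thesis using bij_betw_trans[OF S(3) T(3)] unfolding rep_iso_def by blast
qed

lemma rep_iso_irreducible:
  assumes iso: "rep_iso G \<rho> V \<sigma> W" and W: "irreducible_rep G \<sigma> W" and V: "subrep G \<rho> V"
  shows "irreducible_rep G \<rho> V"
proof -
  obtain T where T: "linear_on V T" "equivariant_on G \<rho> V \<sigma> T" "bij_betw T V W"
    using iso unfolding rep_iso_def by blast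
  have TV: "T ` V = W" and inj: "inj_on T V" using T(3) by (auto simp: bij_betw_def)
  have V0: "cfun.subspace V" using V by (simp add: subrep_def)
  have T0: "T 0 = 0" using linear_on_zero[OF V0 T(1)] .
  have "V \<noteq> {0}" using TV T0 W unfolding irreducible_rep_def by auto
  moreover have "U = {0} \<or> U = V" if U: "subrep G \<rho> U" "U \<subseteq> V" for U
  proof -
    have "subrep G \<sigma> (T ` U)" "T ` U \<subseteq> W"
      using subrep_image[OF U(1)] T(1,2) U(2) linear_on_subset equivariant_on_subset TV by blast+
    then consider "T ` U = {0}" | "T ` U = W" using W unfolding irreducible_rep_def by blast
    then show ?thesis
    proof cases
      case 1
      have "U \<subseteq> {0}"
      proof
        fix u assume u: "u \<in> U"
        then have "T u = T 0" using 1 T0 by auto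
        then show "u \<in> {0}" using inj_onD[OF inj] u U(2) cfun.subspace_0[OF V0] by blast
      qed
      moreover have "0 \<in> U" using U(1) by (simp add: subrep_def cfun.subspace_0)
      ultimately show ?thesis by blast
    next
      case 2
      then show ?thesis using inj_on_image_eq_iff[OF inj U(2) subset_refl] TV by simp
    qed
  qed
  ultimately show ?thesis using V unfolding irreducible_rep_def by blast
qed

section \<open>Multiplicities in multiplicity-free representations\<close>

text \<open>An irreducible summand \<open>U\<close> of an arbitrary decomposition of \<open>V\<close> has a nonzero projection
  to exactly one of the \<open>W p\<close>: by Schur nonzero projections to \<open>W p\<close> and \<open>W q\<close> would make these
  isomorphic. Hence \<open>U\<close> is the subspace \<open>Vp p\<close> of \<open>V\<close> that corresponds to \<open>W p\<close>. All
  decompositions therefore consist of the same subspaces \<open>Vp p\<close>, each occurring once, and the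
  multiplicity is the number of \<open>p\<close> with \<open>W p\<close> isomorphic to \<open>X\<close>.\<close>

lemma rep_multiplicity_multiplicity_free:
  fixes \<rho> :: "'g \<Rightarrow> ('x \<Rightarrow> complex) \<Rightarrow> ('x \<Rightarrow> complex)"
    and \<sigma> :: "'g \<Rightarrow> ('y \<Rightarrow> complex) \<Rightarrow> ('y \<Rightarrow> complex)"
    and W :: "'i \<Rightarrow> ('y \<Rightarrow> complex) set"
  assumes V: "subrep G \<rho> V" and I: "finite I"
    and lin: "\<And>g. g \<in> G \<Longrightarrow> linear_on UNIV (\<rho> g)" "\<And>g. g \<in> G \<Longrightarrow> linear_on UNIV (\<sigma> g)"
    and mf: "multiplicity_free_family G \<sigma> I W"
    and iso: "rep_iso G \<rho> V (dsum_act \<sigma>) (dsum I W)"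
  shows "rep_multiplicity G \<tau> X \<rho> V = card {p \<in> I. rep_iso G \<sigma> (W p) \<tau> X}"
proof -
  obtain \<Theta> where \<Theta>: "linear_on V \<Theta>" "equivariant_on G \<rho> V (dsum_act \<sigma>) \<Theta>" "bij_betw \<Theta> V (dsum I W)"
    using iso unfolding rep_iso_def by blast
  define pr where "pr p v = (\<lambda>x. \<Theta> v (p, x))" for p v
  define Vp where "Vp p = {v \<in> V. \<forall>q\<in>I. q \<noteq> p \<longrightarrow> pr q v = 0}" for p
  have V0: "cfun.subspace V" using V by (simp add: subrep_def)
  have Wirr: "irreducible_rep G \<sigma> (W p)" if "p \<in> I" for p
    using mf that by (simp add: multiplicity_free_family_def)
  have W0: "cfun.subspace (W p)" if "p \<in> I" for p
    using Wirr[OF that] by (simp add: irreducible_rep_def subrep_def)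
  have pr_lin: "linear_on V (pr p)" for p
    using \<Theta>(1) unfolding linear_on_def pr_def by (auto simp: fun_eq_iff)
  have pr_eq: "equivariant_on G \<rho> V \<sigma> (pr p)" for p
    using \<Theta>(2) unfolding equivariant_on_def pr_def dsum_act_def by (auto simp: fun_eq_iff)
  have pr_in: "pr p v \<in> W p" if "p \<in> I" "v \<in> V" for p v
    using \<Theta>(3) that unfolding bij_betw_def dsum_def pr_def by blast
  have pr_inj: "u = v" if uv: "u \<in> V" "v \<in> V" and eq: "\<And>p. p \<in> I \<Longrightarrow> pr p u = pr p v" for u v
  proof -
    have mem: "\<Theta> u \<in> dsum I W" "\<Theta> v \<in> dsum I W" using \<Theta>(3) uv by (auto simp: bij_betw_def)
    have "\<Theta> u (p, x) = \<Theta> v (p, x)" for p x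
    proof (cases "p \<in> I")
      case True then show ?thesis using fun_cong[OF eq[OF True], of x] by (simp add: pr_def)
    next
      case False then show ?thesis using mem by (simp add: dsum_def)
    qed
    then have "\<Theta> u = \<Theta> v" by auto
    then show ?thesis using \<Theta>(3) uv by (auto simp: bij_betw_def inj_on_def)
  qed
  have pr_surj: "\<exists>v\<in>V. \<forall>p\<in>I. pr p v = w p" if "\<And>p. p \<in> I \<Longrightarrow> w p \<in> W p" for w
  proof -
    have "(\<lambda>(p, x). if p \<in> I then w p x else 0) \<in> dsum I W"
      using that by (auto simp: dsum_def)
    then obtain v where v: "v \<in> V" "\<Theta> v = (\<lambda>(p, x). if p \<in> I then w p x else 0)"
      using \<Theta>(3) unfolding bij_betw_def by (metis (no_types, lifting) imageE)
    have "pr p v = w p" if "p \<in> I" for p using v(2) that by (simp add: pr_def)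
    then show ?thesis using v(1) by blast
  qed
  have pr0: "pr p 0 = 0" for p using linear_on_zero[OF V0 pr_lin] .
  have Vp_sub: "Vp p \<subseteq> V" for p by (auto simp: Vp_def)
  have Vp_rep: "subrep G \<rho> (Vp p)" for p
  proof -
    have "Vp p = V \<inter> (\<Inter>q\<in>I - {p}. {v \<in> V. pr q v = 0})" by (auto simp: Vp_def)
    moreover have "subrep G \<rho> {v \<in> V. pr q v = 0}" for q
      by (rule subrep_kernel[OF V pr_lin pr_eq lin(2)])
    ultimately show ?thesis using V unfolding subrep_def cfun.subspace_def by auto
  qed
  have Vp_bij: "bij_betw (pr p) (Vp p) (W p)" if p: "p \<in> I" for p
    unfolding bij_betw_def
  proof
    show "inj_on (pr p) (Vp p)"
    proof (rule inj_onI)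
      fix u v assume uv: "u \<in> Vp p" "v \<in> Vp p" and eq: "pr p u = pr p v"
      show "u = v"
        by (rule pr_inj) (use uv eq in \<open>auto simp: Vp_def, metis\<close>)
    qed
    show "pr p ` Vp p = W p"
    proof
      show "pr p ` Vp p \<subseteq> W p" using pr_in[OF p] by (auto simp: Vp_def)
      show "W p \<subseteq> pr p ` Vp p"
      proof
        fix w assume w: "w \<in> W p"
        obtain v where v: "v \<in> V" "\<forall>q\<in>I. pr q v = (if q = p then w else 0)"
          using pr_surj[of "\<lambda>q. if q = p then w else 0"] w cfun.subspace_0[OF W0]
          by (metis (no_types, lifting))
        then have "v \<in> Vp p" "pr p v = w" using p by (auto simp: Vp_def)
        then show "w \<in> pr p ` Vp p" by blast
      qed
    qed
  qed
  have Vp_iso: "rep_iso G \<rho> (Vp p) \<sigma> (W p)" if "p \<in> I" for p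
    unfolding rep_iso_def
    using linear_on_subset[OF pr_lin Vp_sub] equivariant_on_subset[OF pr_eq Vp_sub] Vp_bij[OF that]
    by blast
  have Vp_irr: "irreducible_rep G \<rho> (Vp p)" if "p \<in> I" for p
    using rep_iso_irreducible[OF Vp_iso[OF that] Wirr[OF that] Vp_rep] .
  have iso_iff: "rep_iso G \<rho> (Vp p) \<tau> X \<longleftrightarrow> rep_iso G \<sigma> (W p) \<tau> X" if "p \<in> I" for p
    using rep_iso_trans Vp_iso[OF that] rep_iso_sym[OF Vp_iso[OF that] Vp_rep] by metis

  have unique: "\<exists>p\<in>I. U = Vp p" if U: "irreducible_rep G \<rho> U" "U \<subseteq> V" for U
  proof -
    have Urep: "subrep G \<rho> U" and U0: "0 \<in> U" and Une: "U \<noteq> {0}"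
      using U(1) by (auto simp: irreducible_rep_def subrep_def cfun.subspace_0)
    then obtain u where u: "u \<in> U" "u \<noteq> 0" by blast
    have dich: "(\<forall>v\<in>U. pr p v = 0) \<or> bij_betw (pr p) U (W p)" if "p \<in> I" for p
      using Schur[OF U(1) Wirr[OF that] linear_on_subset[OF pr_lin U(2)]
          equivariant_on_subset[OF pr_eq U(2)] _ lin(2)] pr_in[OF that] U(2) by blast
    obtain p where p: "p \<in> I" "pr p u \<noteq> 0"
      using pr_inj[of u 0] u U(2) cfun.subspace_0[OF V0] pr0 by auto
    have isoU: "rep_iso G \<rho> U \<sigma> (W q)" if "q \<in> I" "bij_betw (pr q) U (W q)" for q
      unfolding rep_iso_def using linear_on_subset[OF pr_lin U(2)]
        equivariant_on_subset[OF pr_eq U(2)] that by blast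
    have "\<forall>v\<in>U. pr q v = 0" if q: "q \<in> I" "q \<noteq> p" for q
    proof (rule ccontr)
      assume "\<not> ?thesis"
      then have "rep_iso G \<rho> U \<sigma> (W q)" using dich[OF q(1)] isoU[OF q(1)] by blast
      moreover have "rep_iso G \<rho> U \<sigma> (W p)" using dich[OF p(1)] isoU[OF p(1)] p u by blast
      ultimately have "rep_iso G \<sigma> (W p) \<sigma> (W q)"
        using rep_iso_trans rep_iso_sym[OF _ Urep] by blast
      then show False using mf p(1) q unfolding multiplicity_free_family_def by metis
    qed
    then have "U \<subseteq> Vp p" using U(2) by (auto simp: Vp_def)
    then show ?thesis using Vp_irr[OF p(1)] Urep Une p(1) unfolding irreducible_rep_def by blast
  qed

  have count: "card {s. s < r \<and> rep_iso G \<rho> (U s) \<tau> X} = card {p \<in> I. rep_iso G \<sigma> (W p) \<tau> X}"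
    if dec: "irreducible_decomposition G \<rho> V r U" for r U
  proof -
    have U: "irreducible_rep G \<rho> (U s)" "U s \<subseteq> V" if "s < r" for s
      using dec that unfolding irreducible_decomposition_def by auto
    then have "\<forall>s\<in>{..<r}. \<exists>p. p \<in> I \<and> U s = Vp p" using unique by blast
    then obtain e where e: "\<forall>s\<in>{..<r}. e s \<in> I \<and> U s = Vp (e s)" by (metis (lifting))
    have "inj_on e {..<r}"
    proof (rule inj_onI, rule ccontr)
      fix s t assume st: "s \<in> {..<r}" "t \<in> {..<r}" "e s = e t" "s \<noteq> t"
      then have eq: "U s = U t" using e by metis
      have U0: "0 \<in> U s'" if "s' < r" for s'
        using U(1)[OF that] by (simp add: irreducible_rep_def subrep_def cfun.subspace_0)
      obtain u where u: "u \<in> U s" "u \<noteq> 0"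
        using U(1)[of s] U0[of s] st by (auto simp: irreducible_rep_def)
      define dec_of where "dec_of w \<longleftrightarrow> (\<forall>s'<r. w s' \<in> U s') \<and> (\<forall>s'\<ge>r. w s' = 0) \<and>
          u = (\<Sum>s'<r. w s')" for w
      have "dec_of (\<lambda>s'. if s' = a then u else 0)" if "a \<in> {s, t}" for a
        using st u eq U0 that unfolding dec_of_def by auto
      moreover have "u \<in> V" using U(2)[of s] u st by auto
      then have "\<exists>!w. dec_of w"
        using dec unfolding irreducible_decomposition_def dec_of_def by simp
      ultimately have "(\<lambda>s'. if s' = s then u else 0) = (\<lambda>s'. if s' = t then u else 0)"
        by (metis (no_types, lifting) insertI1 insertI2)
      from fun_cong[OF this, of s] show False using u(2) st(4) by simp
    qed
    moreover have "e ` {..<r} = I"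
    proof
      show "I \<subseteq> e ` {..<r}"
      proof (rule subsetI, rule ccontr)
        fix p assume p: "p \<in> I" "p \<notin> e ` {..<r}"
        have "v = 0" if v: "v \<in> Vp p" for v
        proof -
          have vV: "v \<in> V" using v Vp_sub by blast
          then obtain u where u: "\<forall>s<r. u s \<in> U s" "v = (\<Sum>s<r. u s)"
            using dec unfolding irreducible_decomposition_def by blast
          have "pr p v = (\<Sum>s<r. pr p (u s))"
            unfolding u(2) by (rule linear_on_sum[OF V0 pr_lin]) (use u(1) U(2) in blast)
          also have "\<dots> = 0"
          proof (rule sum.neutral, rule ballI)
            fix s assume s: "s \<in> {..<r}"
            then have "u s \<in> Vp (e s)" "p \<noteq> e s" using u(1) e p by auto
            then show "pr p (u s) = 0" using p(1) by (simp add: Vp_def)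
          qed
          finally have prv: "pr p v = 0" .
          have "pr q v = pr q 0" if "q \<in> I" for q
            using prv v that pr0 by (cases "q = p") (auto simp: Vp_def)
          then show "v = 0" using pr_inj[OF vV cfun.subspace_0[OF V0]] by blast
        qed
        moreover have "0 \<in> Vp p" using Vp_rep[of p] by (simp add: subrep_def cfun.subspace_0)
        ultimately have "Vp p = {0}" by blast
        then show False using Vp_irr[OF p(1)] by (simp add: irreducible_rep_def)
      qed
    qed (use e in auto)
    ultimately have "bij_betw e {..<r} I" by (simp add: bij_betw_def)
    then have inj: "inj_on e {..<r}" and img: "e ` {..<r} = I" by (simp_all add: bij_betw_def)
    have iff: "rep_iso G \<rho> (U s) \<tau> X \<longleftrightarrow> rep_iso G \<sigma> (W (e s)) \<tau> X" if "s < r" for s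
      using e iso_iff that by (metis lessThan_iff)
    have im: "e ` {s. s < r \<and> rep_iso G \<rho> (U s) \<tau> X} = {p \<in> I. rep_iso G \<sigma> (W p) \<tau> X}"
    proof -
      have "{s. s < r \<and> rep_iso G \<rho> (U s) \<tau> X} = {s \<in> {..<r}. rep_iso G \<sigma> (W (e s)) \<tau> X}"
        using iff by auto
      then show ?thesis unfolding img[symmetric] Compr_image_eq by simp
    qed
    have "inj_on e {s. s < r \<and> rep_iso G \<rho> (U s) \<tau> X}"
      by (rule inj_on_subset[OF inj]) auto
    from card_image[OF this] show ?thesis unfolding im by (rule sym)
  qed

  obtain e where e: "bij_betw e {..<card I} I"
    using ex_bij_betw_nat_finite[OF I] by (auto simp: atLeast0LessThan)
  have eI: "e s \<in> I" if "s < card I" for s using e that by (auto simp: bij_betw_def)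
  have "irreducible_decomposition G \<rho> V (card I) (\<lambda>s. Vp (e s))"
    unfolding irreducible_decomposition_def
  proof (intro conjI allI impI ballI)
    fix v assume v: "v \<in> V"
    define c where "c p = the_inv_into (Vp p) (pr p) (pr p v)" for p
    have c: "c p \<in> Vp p \<and> pr p (c p) = pr p v" if "p \<in> I" for p
    proof -
      have inj: "inj_on (pr p) (Vp p)" and mem: "pr p v \<in> pr p ` Vp p"
        using Vp_bij[OF that] pr_in[OF that v] by (simp_all add: bij_betw_def)
      show ?thesis unfolding c_def
        using the_inv_into_into[OF inj mem subset_refl] f_the_inv_into_f[OF inj mem] by blast
    qed
    have comp: "pr (e t) (\<Sum>s<card I. u s) = pr (e t) (u t)"
      if t: "t < card I" and u: "\<forall>s<card I. u s \<in> Vp (e s)" for t u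
    proof -
      have "pr (e t) (\<Sum>s<card I. u s) = (\<Sum>s<card I. pr (e t) (u s))"
        by (rule linear_on_sum[OF V0 pr_lin]) (use u Vp_sub in blast)
      also have "\<dots> = (\<Sum>s<card I. if s = t then pr (e t) (u t) else 0)"
      proof (rule sum.cong)
        fix s assume s: "s \<in> {..<card I}"
        have "e t \<noteq> e s" if "s \<noteq> t" using e s t that by (auto simp: bij_betw_def inj_on_def)
        then show "pr (e t) (u s) = (if s = t then pr (e t) (u t) else 0)"
          using u s eI[OF t] by (auto simp: Vp_def)
      qed simp
      also have "\<dots> = pr (e t) (u t)" using t by (simp add: sum.delta)
      finally show ?thesis .
    qed
    define u where "u s = (if s < card I then c (e s) else 0)" for s
    have u: "\<forall>s<card I. u s \<in> Vp (e s)" using c eI by (simp add: u_def)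
    have "v = (\<Sum>s<card I. u s)"
    proof (rule pr_inj[OF v])
      show "(\<Sum>s<card I. u s) \<in> V"
        by (rule cfun.subspace_sum[OF V0]) (use u Vp_sub in blast)
      fix p assume "p \<in> I"
      then obtain t where "t < card I" "p = e t" using e by (auto simp: bij_betw_def)
      then show "pr p v = pr p (\<Sum>s<card I. u s)" using comp[OF _ u] c eI by (simp add: u_def)
    qed
    then have ex: "(\<forall>s<card I. u s \<in> Vp (e s)) \<and> (\<forall>s\<ge>card I. u s = 0) \<and> v = (\<Sum>s<card I. u s)"
      using u by (simp add: u_def)
    show "\<exists>!u. (\<forall>s<card I. u s \<in> Vp (e s)) \<and> (\<forall>s\<ge>card I. u s = 0) \<and> v = (\<Sum>s<card I. u s)"
    proof (rule ex1I, rule ex)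
      fix u' assume u': "(\<forall>s<card I. u' s \<in> Vp (e s)) \<and> (\<forall>s\<ge>card I. u' s = 0) \<and> v = (\<Sum>s<card I. u' s)"
      show "u' = u"
      proof
        fix s
        show "u' s = u s"
        proof (cases "s < card I")
          case True
          then have "pr (e s) (u' s) = pr (e s) (u s)"
            using comp[OF True, of u'] comp[OF True u] u' ex by simp
          then show ?thesis
            using True u' u Vp_bij[OF eI[OF True]] by (auto simp: bij_betw_def inj_on_def)
        qed (use u' ex in auto)
      qed
    qed
  qed (use Vp_irr eI Vp_sub in auto)
  note dec = this
  show ?thesis unfolding rep_multiplicity_def
  proof (rule the_equality)
    show "\<exists>r U. irreducible_decomposition G \<rho> V r U \<and>
        card {p \<in> I. rep_iso G \<sigma> (W p) \<tau> X} = card {s. s < r \<and> rep_iso G \<rho> (U s) \<tau> X}"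
      by (intro exI conjI) (rule dec, rule count[OF dec, symmetric])
  next
    fix m
    assume "\<exists>r U. irreducible_decomposition G \<rho> V r U \<and> m = card {s. s < r \<and> rep_iso G \<rho> (U s) \<tau> X}"
    then show "m = card {p \<in> I. rep_iso G \<sigma> (W p) \<tau> X}" by (elim exE conjE) (simp only: count)
  qed
qed

section \<open>Lowering and raising operators\<close>

text \<open>Functions on all sets of naturals are the domain, whatever \<open>X\<close> is, so that the operators
  for different \<open>X\<close> can be composed and compared.\<close>

definition lower :: "nat set \<Rightarrow> (nat set \<Rightarrow> complex) \<Rightarrow> (nat set \<Rightarrow> complex)"
  where "lower X f = (\<lambda>E. \<Sum>y\<in>X - E. f (insert y E))"

definition raise :: "nat set \<Rightarrow> (nat set \<Rightarrow> complex) \<Rightarrow> (nat set \<Rightarrow> complex)"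
  where "raise X f = (\<lambda>D. \<Sum>y\<in>D \<inter> X. f (D - {y}))"

text \<open>Only the number of points in \<open>X\<close> is prescribed, so a function can lie in levels of
  several sets at once.\<close>

definition level :: "nat set \<Rightarrow> nat \<Rightarrow> (nat set \<Rightarrow> complex) set"
  where "level X i = {f. \<forall>Z. f Z \<noteq> 0 \<longrightarrow> card (Z \<inter> X) = i}"

definition subsets_of :: "nat set \<Rightarrow> (nat set \<Rightarrow> complex) set"
  where "subsets_of Y = {f. \<forall>Z. f Z \<noteq> 0 \<longrightarrow> Z \<subseteq> Y}"

lemma linear_lower: "linear_on V (lower X)"
  unfolding linear_on_def lower_def by (auto simp: fun_eq_iff sum.distrib sum_distrib_left)

lemma linear_raise: "linear_on V (raise X)"
  unfolding linear_on_def raise_def by (auto simp: fun_eq_iff sum.distrib sum_distrib_left)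

lemma linear_on_fscale: "linear_on UNIV T \<Longrightarrow> T (fscale c f) = fscale c (T f)"
  unfolding linear_on_def by blast

lemma linear_on_add: "linear_on UNIV T \<Longrightarrow> T (f + g) = T f + T g"
  unfolding linear_on_def by blast

lemma linear_on_comp:
  assumes "linear_on UNIV S" "linear_on UNIV T"
  shows "linear_on UNIV (\<lambda>f. S (T f))"
  unfolding linear_on_def
  by (simp only: linear_on_add[OF assms(2)] linear_on_add[OF assms(1)]
      linear_on_fscale[OF assms(2)] linear_on_fscale[OF assms(1)]) simp

lemma linear_on_pow:
  fixes T :: "('x \<Rightarrow> complex) \<Rightarrow> ('x \<Rightarrow> complex)"
  assumes "linear_on UNIV T"
  shows "linear_on UNIV (T ^^ m)"
proof (induction m)
  case 0 show ?case by (simp add: linear_on_def)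
next
  case (Suc m) then show ?case using linear_on_comp[OF assms Suc] by (simp add: comp_def)
qed

lemmas linear_on_UNIV_sum = linear_on_sum[OF cfun.subspace_UNIV _ UNIV_I]
lemmas linear_on_UNIV_zero = linear_on_zero[OF cfun.subspace_UNIV]
lemmas linear_on_UNIV_diff = linear_on_diff[OF cfun.subspace_UNIV _ UNIV_I UNIV_I]

lemma funpow_commute:
  assumes "\<And>f. S (T f) = T (S f)"
  shows "(S ^^ m) ((T ^^ q) f) = (T ^^ q) ((S ^^ m) f)"
proof -
  have *: "S ((T ^^ q) f) = (T ^^ q) (S f)" for f
    by (induction q) (simp_all add: assms)
  show ?thesis by (induction m) (simp_all add: *)
qed

lemma lower_lower_disjoint:
  assumes "A \<inter> B = {}"
  shows "lower A (lower B f) = lower B (lower A f)"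
proof
  fix E
  have "B - insert y E = B - E" if "y \<in> A" for y using assms that by auto
  then have "lower A (lower B f) E = (\<Sum>y\<in>A - E. \<Sum>z\<in>B - E. f (insert z (insert y E)))"
    unfolding lower_def by simp
  also have "\<dots> = (\<Sum>z\<in>B - E. \<Sum>y\<in>A - E. f (insert y (insert z E)))"
    by (subst sum.swap) (simp add: insert_commute)
  also have "A - insert z E = A - E" if "z \<in> B" for z using assms that by auto
  then have "(\<Sum>z\<in>B - E. \<Sum>y\<in>A - E. f (insert y (insert z E))) = lower B (lower A f) E"
    unfolding lower_def by simp
  finally show "lower A (lower B f) E = lower B (lower A f) E" .
qed

lemma lower_raise_disjoint:
  assumes "A \<inter> B = {}"
  shows "lower A (raise B f) = raise B (lower A f)"
proof
  fix E
  have "insert y E \<inter> B = E \<inter> B" if "y \<in> A" for y using assms that by auto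
  then have "lower A (raise B f) E = (\<Sum>y\<in>A - E. \<Sum>z\<in>E \<inter> B. f (insert y E - {z}))"
    unfolding lower_def raise_def by simp
  also have "\<dots> = (\<Sum>z\<in>E \<inter> B. \<Sum>y\<in>A - E. f (insert y E - {z}))" by (rule sum.swap)
  also have "\<dots> = raise B (lower A f) E"
    unfolding lower_def raise_def
  proof (intro sum.cong refl)
    fix z assume z: "z \<in> E \<inter> B"
    show "A - E = A - (E - {z})" using z assms by auto
    fix y assume "y \<in> A - (E - {z})"
    then have "insert y E - {z} = insert y (E - {z})" using z assms by auto
    then show "f (insert y E - {z}) = f (insert y (E - {z}))" by simp
  qed
  finally show "lower A (raise B f) E = raise B (lower A f) E" .
qed

lemma lower_Un:
  assumes "finite A" "finite B" "A \<inter> B = {}"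
  shows "lower (A \<union> B) f = lower A f + lower B f"
proof
  fix E
  have "A \<union> B - E = (A - E) \<union> (B - E)" by auto
  then show "lower (A \<union> B) f E = (lower A f + lower B f) E"
    unfolding lower_def using assms by (simp add: sum.union_disjoint Diff_Int_distrib2 disjoint_iff)
qed

text \<open>The relation of \<open>sl\<^sub>2\<close>: adding a point \<open>y\<close> commutes with removing a point \<open>z \<noteq> y\<close>, and
  adding and then removing the same point counts the points of \<open>X\<close> outside \<open>E\<close>, in the other
  order those inside \<open>E\<close>.\<close>

lemma lower_raise:
  assumes "finite X"
  shows "lower X (raise X f) E
    = raise X (lower X f) E + (of_nat (card X) - 2 * of_nat (card (E \<inter> X))) * f E"
proof -
  let ?s = "\<Sum>y\<in>X - E. \<Sum>z\<in>E \<inter> X. f (insert y (E - {z}))"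
  have fin: "finite (E \<inter> X)" "finite (X - E)" using assms by auto
  have "lower X (raise X f) E = (\<Sum>y\<in>X - E. f E + (\<Sum>z\<in>E \<inter> X. f (insert y (E - {z}))))"
    unfolding lower_def raise_def
  proof (rule sum.cong)
    fix y assume y: "y \<in> X - E"
    have "insert y E \<inter> X = insert y (E \<inter> X)" using y by auto
    moreover have "(\<Sum>z\<in>E \<inter> X. f (insert y E - {z})) = (\<Sum>z\<in>E \<inter> X. f (insert y (E - {z})))"
    proof (rule sum.cong)
      fix z assume "z \<in> E \<inter> X"
      then have "insert y E - {z} = insert y (E - {z})" using y by auto
      then show "f (insert y E - {z}) = f (insert y (E - {z}))" by simp
    qed simp
    ultimately show "(\<Sum>z\<in>insert y E \<inter> X. f (insert y E - {z}))
        = f E + (\<Sum>z\<in>E \<inter> X. f (insert y (E - {z})))"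
      using y fin by simp
  qed simp
  also have "\<dots> = of_nat (card (X - E)) * f E + ?s" by (simp add: sum.distrib)
  finally have 1: "lower X (raise X f) E = of_nat (card (X - E)) * f E + ?s" .
  have "raise X (lower X f) E = (\<Sum>z\<in>E \<inter> X. f E + (\<Sum>y\<in>X - E. f (insert y (E - {z}))))"
    unfolding lower_def raise_def
  proof (rule sum.cong)
    fix z assume z: "z \<in> E \<inter> X"
    then have "X - (E - {z}) = insert z (X - E)" "insert z (E - {z}) = E" by auto
    then show "(\<Sum>y\<in>X - (E - {z}). f (insert y (E - {z})))
        = f E + (\<Sum>y\<in>X - E. f (insert y (E - {z})))"
      using z fin by simp
  qed simp
  also have "\<dots> = of_nat (card (E \<inter> X)) * f E + ?s"
    by (simp add: sum.distrib) (rule sum.swap)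
  finally have 2: "raise X (lower X f) E = of_nat (card (E \<inter> X)) * f E + ?s" .
  have "card (E \<inter> X) + card (X - E) = card X"
    using assms card_Int_Diff[OF assms, of E] by (simp add: Int_commute)
  then have "(of_nat (card X) :: complex) = of_nat (card (E \<inter> X)) + of_nat (card (X - E))"
    by (metis of_nat_add)
  then show ?thesis unfolding 1 2 by (simp add: algebra_simps)
qed

lemma lower_raise_level:
  assumes "finite X" "f \<in> level X i"
  shows "lower X (raise X f)
    = raise X (lower X f) + fscale (of_nat (card X) - 2 * of_nat i) f"
proof
  fix E
  have "(of_nat (card X) - 2 * of_nat (card (E \<inter> X))) * f E = (of_nat (card X) - 2 * of_nat i) * f E"
    using assms(2) by (cases "f E = 0") (auto simp: level_def)
  then show "lower X (raise X f) E
      = (raise X (lower X f) + fscale (of_nat (card X) - 2 * of_nat i) f) E"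
    using lower_raise[OF assms(1)] by simp
qed

lemma subspace_level: "cfun.subspace (level X i)"
  unfolding cfun.subspace_def level_def by (auto, metis add_0_left)

lemma subspace_subsets_of: "cfun.subspace (subsets_of Y)"
  unfolding cfun.subspace_def subsets_of_def by (auto, metis add_0_left subsetD)

lemma lower_nonzeroE:
  assumes "lower X f E \<noteq> 0"
  obtains y where "y \<in> X - E" "f (insert y E) \<noteq> 0"
  using assms unfolding lower_def by (meson sum.not_neutral_contains_not_neutral)

lemma raise_nonzeroE:
  assumes "raise X f D \<noteq> 0"
  obtains y where "y \<in> D \<inter> X" "f (D - {y}) \<noteq> 0"
  using assms unfolding raise_def by (meson sum.not_neutral_contains_not_neutral)

lemma raise_level:
  assumes "finite X" "f \<in> level X i"
  shows "raise X f \<in> level X (Suc i)"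
  unfolding level_def
proof (intro CollectI allI impI)
  fix D assume "raise X f D \<noteq> 0"
  then obtain y where y: "y \<in> D \<inter> X" "f (D - {y}) \<noteq> 0" by (rule raise_nonzeroE)
  then have "card ((D \<inter> X) - {y}) = i"
    using assms(2) by (simp add: level_def Diff_Int_distrib2 Int_Diff) (metis Int_Diff Int_commute)
  then show "card (D \<inter> X) = Suc i" using y assms(1) by (metis card_Suc_Diff1 finite_Int)
qed

lemma raise_level_disjoint:
  assumes "A \<inter> B = {}" "f \<in> level B i"
  shows "raise A f \<in> level B i"
  unfolding level_def
proof (intro CollectI allI impI)
  fix D assume "raise A f D \<noteq> 0"
  then obtain y where y: "y \<in> D \<inter> A" "f (D - {y}) \<noteq> 0" by (rule raise_nonzeroE)
  then have "(D - {y}) \<inter> B = D \<inter> B" using assms(1) by auto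
  then show "card (D \<inter> B) = i" using y assms(2) by (auto simp: level_def)
qed

lemma raise_subsets_of:
  assumes "X \<subseteq> Y" "f \<in> subsets_of Y"
  shows "raise X f \<in> subsets_of Y"
  unfolding subsets_of_def
proof (intro CollectI allI impI)
  fix D assume "raise X f D \<noteq> 0"
  then obtain y where "y \<in> D \<inter> X" "f (D - {y}) \<noteq> 0" by (rule raise_nonzeroE)
  then have "y \<in> Y" "D - {y} \<subseteq> Y" using assms by (auto simp: subsets_of_def)
  then show "D \<subseteq> Y" by auto
qed

lemma lower_subsets_of:
  assumes "f \<in> subsets_of Y"
  shows "lower X f \<in> subsets_of Y"
  unfolding subsets_of_def
proof (intro CollectI allI impI)
  fix E assume "lower X f E \<noteq> 0"
  then obtain y where "f (insert y E) \<noteq> 0" by (rule lower_nonzeroE)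
  then show "E \<subseteq> Y" using assms by (auto simp: subsets_of_def)
qed

lemma raise_pow_level:
  assumes "finite X" "f \<in> level X i"
  shows "(raise X ^^ q) f \<in> level X (i + q)"
  by (induction q) (use assms raise_level in auto)

lemma raise_pow_level_disjoint:
  assumes "A \<inter> B = {}" "f \<in> level B i"
  shows "(raise A ^^ q) f \<in> level B i"
  by (induction q) (use assms raise_level_disjoint in auto)

lemma raise_pow_subsets_of: "X \<subseteq> Y \<Longrightarrow> f \<in> subsets_of Y \<Longrightarrow> (raise X ^^ q) f \<in> subsets_of Y"
  by (induction q) (simp_all add: raise_subsets_of)

lemma lower_pow_subsets_of: "f \<in> subsets_of Y \<Longrightarrow> (lower X ^^ q) f \<in> subsets_of Y"
  by (induction q) (simp_all add: lower_subsets_of)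

text \<open>A function at level \<open>i\<close> killed by \<open>lower X\<close> is an extremal vector of weight
  \<open>card X - 2 * i\<close> for \<open>sl\<^sub>2\<close>; this is the usual action on the string that it generates,
  obtained by adding up the relation along the string.\<close>

lemma lower_raise_pow:
  assumes X: "finite X" and f: "f \<in> level X i" "lower X f = 0"
  shows "lower X ((raise X ^^ Suc q) f)
    = fscale (of_nat (Suc q) * (of_nat (card X) - 2 * of_nat i - of_nat q)) ((raise X ^^ q) f)"
proof (induction q)
  case 0
  show ?case using lower_raise_level[OF X f(1)] f(2) linear_on_UNIV_zero[OF linear_raise] by simp
next
  case (Suc q)
  have "lower X ((raise X ^^ Suc (Suc q)) f) = lower X (raise X ((raise X ^^ Suc q) f))" by simp
  also have "\<dots> = raise X (lower X ((raise X ^^ Suc q) f))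
      + fscale (of_nat (card X) - 2 * of_nat (i + Suc q)) ((raise X ^^ Suc q) f)"
    by (rule lower_raise_level[OF X raise_pow_level[OF X f(1)]])
  also have "raise X (lower X ((raise X ^^ Suc q) f))
      = fscale (of_nat (Suc q) * (of_nat (card X) - 2 * of_nat i - of_nat q)) ((raise X ^^ Suc q) f)"
    unfolding Suc by (simp add: linear_on_fscale[OF linear_raise])
  finally show ?case by (auto simp: fun_eq_iff algebra_simps)
qed

lemma lower_pow_raise_pow:
  assumes X: "finite X" and f: "f \<in> level X i" "lower X f = 0"
  shows "(lower X ^^ q) ((raise X ^^ q) f)
    = fscale (\<Prod>r<q. of_nat (Suc r) * (of_nat (card X) - 2 * of_nat i - of_nat r)) f"
proof (induction q)
  case (Suc q)
  have "(lower X ^^ Suc q) ((raise X ^^ Suc q) f) = (lower X ^^ q) (lower X ((raise X ^^ Suc q) f))"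
    by (simp add: funpow_swap1)
  also have "\<dots> = fscale (of_nat (Suc q) * (of_nat (card X) - 2 * of_nat i - of_nat q))
      ((lower X ^^ q) ((raise X ^^ q) f))"
    unfolding lower_raise_pow[OF assms] by (rule linear_on_fscale[OF linear_on_pow[OF linear_lower]])
  also have "\<dots> = fscale (\<Prod>r<Suc q. of_nat (Suc r) * (of_nat (card X) - 2 * of_nat i - of_nat r)) f"
    unfolding Suc by (simp add: fun_eq_iff algebra_simps)
  finally show ?case .
qed (simp add: fun_eq_iff)

lemma lower_pow_raise_pow_zero:
  assumes X: "finite X" and f: "f \<in> level X i" "lower X f = 0" and "q < m"
  shows "(lower X ^^ m) ((raise X ^^ q) f) = 0"
proof -
  obtain d where m: "m = (d + 1) + q" using \<open>q < m\<close> by (metis add.commute add.left_commute less_imp_Suc_add Suc_eq_plus1 add_Suc_right)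
  have "(lower X ^^ m) ((raise X ^^ q) f) = (lower X ^^ d) (lower X ((lower X ^^ q) ((raise X ^^ q) f)))"
    unfolding m by (simp add: funpow_add funpow_swap1)
  also have "\<dots> = 0"
    unfolding lower_pow_raise_pow[OF X f] linear_on_fscale[OF linear_lower] f(2)
    using linear_on_UNIV_zero[OF linear_on_pow[OF linear_lower]] by simp
  finally show ?thesis .
qed

text \<open>Both sides are the sum of \<open>f (insert y Z) * g Z\<close> over the pairs of a set \<open>Z\<close> and a point
  \<open>y\<close> of \<open>X\<close> outside it.\<close>

lemma lower_raise_adjoint:
  assumes "X \<subseteq> Y" "finite Y"
  shows "(\<Sum>Z\<in>Pow Y. lower X f Z * g Z) = (\<Sum>Z\<in>Pow Y. f Z * raise X g Z)"
proof -
  have fin: "finite X" using assms finite_subset by blast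
  have "(\<Sum>Z\<in>Pow Y. lower X f Z * g Z) = (\<Sum>(Z, y)\<in>Sigma (Pow Y) (\<lambda>Z. X - Z). f (insert y Z) * g Z)"
    unfolding lower_def sum_distrib_right by (rule sum.Sigma) (use assms fin in auto)
  also have "\<dots> = (\<Sum>(D, y)\<in>Sigma (Pow Y) (\<lambda>D. D \<inter> X). f D * g (D - {y}))"
    by (rule sum.reindex_bij_witness[of _ "\<lambda>(D, y). (D - {y}, y)" "\<lambda>(Z, y). (insert y Z, y)"])
      (use assms(1) in \<open>auto simp: insert_absorb\<close>)
  also have "\<dots> = (\<Sum>Z\<in>Pow Y. f Z * raise X g Z)"
    unfolding raise_def sum_distrib_left by (rule sum.Sigma[symmetric]) (use assms fin in auto)
  finally show ?thesis .
qed

lemma lower_raise_pow_adjoint: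
  assumes "X \<subseteq> Y" "finite Y"
  shows "(\<Sum>Z\<in>Pow Y. (lower X ^^ m) f Z * g Z) = (\<Sum>Z\<in>Pow Y. f Z * (raise X ^^ m) g Z)"
proof (induction m arbitrary: g)
  case (Suc m)
  then show ?case using lower_raise_adjoint[OF assms, of "(lower X ^^ m) f" g] by (simp add: funpow_swap1)
qed simp

lemma sum_norm_zero:
  assumes "finite Y" "f \<in> subsets_of Y" "(\<Sum>Z\<in>Pow Y. f Z * cnj (f Z)) = 0"
  shows "f = 0"
proof -
  have "of_real (\<Sum>Z\<in>Pow Y. (cmod (f Z))\<^sup>2) = (0 :: complex)"
    using assms(3) by (simp add: complex_norm_square[symmetric])
  then have "\<forall>Z\<in>Pow Y. (cmod (f Z))\<^sup>2 = 0"
    using assms(1) by (simp only: of_real_eq_0_iff) (simp add: sum_nonneg_eq_0_iff)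
  then have "f Z = 0" for Z using assms(2) by (cases "Z \<subseteq> Y") (auto simp: subsets_of_def)
  then show ?thesis by (simp add: fun_eq_iff)
qed

text \<open>Adjointness and the \<open>sl\<^sub>2\<close> relation give \<open>\<parallel>raise X f\<parallel>\<^sup>2 = (card X - 2 * p) * \<parallel>f\<parallel>\<^sup>2\<close> for
  \<open>f\<close> in the kernel, where the factor on the right is negative.\<close>

lemma lower_kernel_above_middle:
  assumes Y: "X \<subseteq> Y" "finite Y" and f: "f \<in> subsets_of Y" "f \<in> level X p" "lower X f = 0"
    and p: "card X < 2 * p"
  shows "f = 0"
proof -
  have fin: "finite X" using Y finite_subset by blast
  define S where "S = (\<Sum>Z\<in>Pow Y. (cmod (f Z))\<^sup>2)"
  define R where "R = (\<Sum>Z\<in>Pow Y. (cmod (raise X f Z))\<^sup>2)"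
  have cnj: "raise X (\<lambda>Z. cnj (f Z)) D = cnj (raise X f D)" for D by (simp add: raise_def)
  have "(\<Sum>Z\<in>Pow Y. lower X (raise X f) Z * cnj (f Z)) = (\<Sum>Z\<in>Pow Y. raise X f Z * cnj (raise X f Z))"
    using lower_raise_adjoint[OF Y, of "raise X f" "\<lambda>Z. cnj (f Z)"] by (simp add: cnj)
  also have "\<dots> = of_real R" by (simp add: R_def complex_norm_square[symmetric])
  also have "lower X (raise X f) = fscale (of_nat (card X) - 2 * of_nat p) f"
    using lower_raise_level[OF fin f(2)] f(3) linear_on_UNIV_zero[OF linear_raise] by simp
  also have "(\<Sum>Z\<in>Pow Y. fscale (of_nat (card X) - 2 * of_nat p) f Z * cnj (f Z))
      = of_real ((of_nat (card X) - 2 * of_nat p) * S)"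
    by (simp add: S_def sum_distrib_left mult.assoc complex_norm_square[symmetric])
  finally have "(of_nat (card X) - 2 * of_nat p) * S = R" by (simp only: of_real_eq_iff)
  moreover have "R \<ge> 0" "S \<ge> 0" by (simp_all add: R_def S_def sum_nonneg)
  moreover have "(of_nat (card X) - 2 * of_nat p :: real) < 0" using p by linarith
  ultimately have "S = 0" by (metis less_eq_real_def mult_neg_pos not_less)
  then have "(\<Sum>Z\<in>Pow Y. f Z * cnj (f Z)) = 0" unfolding S_def complex_norm_square[symmetric] of_real_sum[symmetric] by simp
  then show ?thesis by (rule sum_norm_zero[OF Y(2) f(1)])
qed

text \<open>With \<open>b = card X - 2 * i\<close> the factor in \<open>lower_raise_pow\<close> vanishes at \<open>q = b\<close>. So
  \<open>raise X ^^ Suc b\<close> maps \<open>f\<close> into the kernel of \<open>lower X\<close> at level \<open>card X - i + 1\<close>, above the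
  middle.\<close>

lemma raise_pow_top:
  assumes Y: "X \<subseteq> Y" "finite Y" and f: "f \<in> subsets_of Y" "f \<in> level X i" "lower X f = 0"
    and i: "2 * i \<le> card X" and q: "card X - 2 * i < q"
  shows "(raise X ^^ q) f = 0"
proof -
  have fin: "finite X" using Y finite_subset by blast
  define b where "b = card X - 2 * i"
  have "of_nat (card X) - 2 * of_nat i - of_nat b = (0 :: complex)"
    using i by (simp add: b_def of_nat_diff)
  then have "lower X ((raise X ^^ Suc b) f) = 0"
    using lower_raise_pow[OF fin f(2,3), of b] by (simp add: fun_eq_iff)
  then have top: "(raise X ^^ Suc b) f = 0"
    by (intro lower_kernel_above_middle[OF Y raise_pow_subsets_of[OF Y(1) f(1)]
          raise_pow_level[OF fin f(2)]]) (use i in \<open>auto simp: b_def\<close>)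
  have "q = (q - Suc b) + Suc b" using q unfolding b_def[symmetric] by simp
  then obtain d where "q = d + Suc b" ..
  then have "(raise X ^^ q) f = (raise X ^^ d) ((raise X ^^ Suc b) f)" by (simp only: funpow_add comp_apply)
  then show ?thesis unfolding top using linear_on_UNIV_zero[OF linear_on_pow[OF linear_raise]] by simp
qed

text \<open>If the string of \<open>g\<close> is shorter than \<open>m\<close>, then \<open>raise X ^^ m\<close> kills \<open>g\<close>, and adjointness
  gives \<open>\<parallel>g\<parallel>\<^sup>2 = \<langle>f, (raise X ^^ m) g\<rangle> = 0\<close>. Above the middle \<open>g\<close> is zero by
  \<open>lower_kernel_above_middle\<close>.\<close>

lemma lower_pow_image_primitive:
  assumes Y: "X \<subseteq> Y" "finite Y" and g: "(lower X ^^ m) f = g"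
    "g \<in> subsets_of Y" "g \<in> level X i" "lower X g = 0"
    and i: "2 * i \<le> card X \<Longrightarrow> card X - 2 * i < m"
  shows "g = 0"
proof (cases "2 * i \<le> card X")
  case True
  have cnj: "(raise X ^^ q) (\<lambda>Z. cnj (h Z)) = (\<lambda>Z. cnj ((raise X ^^ q) h Z))" for q h
    by (induction q) (simp_all add: raise_def)
  have "(\<Sum>Z\<in>Pow Y. g Z * cnj (g Z)) = (\<Sum>Z\<in>Pow Y. f Z * (raise X ^^ m) (\<lambda>Z. cnj (g Z)) Z)"
    using lower_raise_pow_adjoint[OF Y, of m f] g(1) by simp
  also have "\<dots> = 0" unfolding cnj raise_pow_top[OF Y g(2,3,4) True i[OF True]] by simp
  finally show ?thesis by (rule sum_norm_zero[OF Y(2) g(2)])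
qed (use lower_kernel_above_middle[OF Y g(2,3,4)] in simp)

section \<open>Irreducibility from a unique fixed vector\<close>

definition perm_group :: "(nat \<Rightarrow> nat) set \<Rightarrow> bool"
  where "perm_group G \<longleftrightarrow> finite G \<and> id \<in> G \<and> (\<forall>\<pi>\<in>G. bij \<pi> \<and> inv_into UNIV \<pi> \<in> G) \<and>
    (\<forall>\<pi>\<in>G. \<forall>\<tau>\<in>G. \<pi> \<circ> \<tau> \<in> G)"

lemma linear_perm_act: "linear_on V (perm_act \<pi>)"
  by (simp add: linear_on_def perm_act_def fun_eq_iff)

lemma perm_act_comp: "perm_act \<pi> (perm_act \<tau> f) = perm_act (\<pi> \<circ> \<tau>) f"
  by (simp add: perm_act_def vimage_comp)

lemma vimage_inv:
  assumes "bij \<pi>"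
  shows "inv_into UNIV \<pi> -` (\<pi> -` Z) = Z" "\<pi> -` (inv_into UNIV \<pi> -` Z) = Z"
  using assms by (simp_all add: vimage_comp bij_is_inj bij_is_surj surj_iff[THEN iffD1])

lemma perm_groupD:
  assumes "perm_group G"
  shows "finite G" "id \<in> G" "\<And>\<pi>. \<pi> \<in> G \<Longrightarrow> bij \<pi>" "\<And>\<pi>. \<pi> \<in> G \<Longrightarrow> inv_into UNIV \<pi> \<in> G"
    "\<And>\<pi> \<tau>. \<pi> \<in> G \<Longrightarrow> \<tau> \<in> G \<Longrightarrow> \<pi> \<circ> \<tau> \<in> G"
  using assms unfolding perm_group_def by blast+

lemma sum_perm_group_right:
  assumes G: "perm_group G" and \<sigma>: "\<sigma> \<in> G"
  shows "(\<Sum>\<tau>\<in>G. F (\<tau> \<circ> \<sigma>)) = (\<Sum>\<tau>\<in>G. F \<tau>)"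
proof -
  have b: "\<sigma> \<circ> inv_into UNIV \<sigma> = id" "inv_into UNIV \<sigma> \<circ> \<sigma> = id"
    using perm_groupD(3)[OF G \<sigma>] by (simp_all add: bij_is_inj bij_is_surj surj_iff[THEN iffD1])
  show ?thesis
    by (rule sum.reindex_bij_witness[of _ "\<lambda>\<tau>. \<tau> \<circ> inv_into UNIV \<sigma>" "\<lambda>\<tau>. \<tau> \<circ> \<sigma>"])
      (simp_all add: comp_assoc b perm_groupD[OF G] \<sigma>)
qed

lemma sum_perm_group_left:
  assumes G: "perm_group G" and \<sigma>: "\<sigma> \<in> G"
  shows "(\<Sum>\<tau>\<in>G. F (\<sigma> \<circ> \<tau>)) = (\<Sum>\<tau>\<in>G. F \<tau>)"
proof -
  have b: "\<sigma> \<circ> inv_into UNIV \<sigma> = id" "inv_into UNIV \<sigma> \<circ> \<sigma> = id"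
    using perm_groupD(3)[OF G \<sigma>] by (simp_all add: bij_is_inj bij_is_surj surj_iff[THEN iffD1])
  show ?thesis
    by (rule sum.reindex_bij_witness[of _ "\<lambda>\<tau>. inv_into UNIV \<sigma> \<circ> \<tau>" "\<lambda>\<tau>. \<sigma> \<circ> \<tau>"])
      (simp_all add: comp_assoc[symmetric] b perm_groupD[OF G] \<sigma>)
qed

definition set_stabilizer :: "(nat \<Rightarrow> nat) set \<Rightarrow> nat set \<Rightarrow> (nat \<Rightarrow> nat) set"
  where "set_stabilizer G Z = {\<pi> \<in> G. \<pi> -` Z = Z}"

definition stabilizer_sum :: "(nat \<Rightarrow> nat) set \<Rightarrow> nat set \<Rightarrow> (nat set \<Rightarrow> complex) \<Rightarrow> (nat set \<Rightarrow> complex)"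
  where "stabilizer_sum G Z f = (\<Sum>\<pi>\<in>set_stabilizer G Z. perm_act \<pi> f)"

lemma perm_group_stabilizer:
  assumes G: "perm_group G"
  shows "perm_group (set_stabilizer G Z)"
proof -
  have "inv_into UNIV \<pi> -` Z = Z" if "\<pi> \<in> G" "\<pi> -` Z = Z" for \<pi>
    using vimage_inv(1)[OF perm_groupD(3)[OF G that(1)], of Z] that(2) by simp
  moreover have "(\<pi> \<circ> \<tau>) -` Z = Z" if "\<pi> -` Z = Z" "\<tau> -` Z = Z" for \<pi> \<tau> :: "nat \<Rightarrow> nat"
    using that by (simp add: vimage_comp[symmetric])
  moreover have "id -` Z = Z" by simp
  ultimately show ?thesis
    unfolding perm_group_def set_stabilizer_def using perm_groupD[OF G]
    by (intro conjI ballI) (auto simp del: vimage_id)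
qed

lemma perm_act_stabilizer_sum:
  assumes G: "perm_group G" and \<tau>: "\<tau> \<in> set_stabilizer G Z"
  shows "perm_act \<tau> (stabilizer_sum G Z f) = stabilizer_sum G Z f"
proof -
  have "perm_act \<tau> (stabilizer_sum G Z f) = (\<Sum>\<pi>\<in>set_stabilizer G Z. perm_act (\<tau> \<circ> \<pi>) f)"
    unfolding stabilizer_sum_def by (simp only: linear_on_UNIV_sum[OF linear_perm_act] perm_act_comp)
  also have "\<dots> = stabilizer_sum G Z f"
    unfolding stabilizer_sum_def by (rule sum_perm_group_left[OF perm_group_stabilizer[OF G] \<tau>])
  finally show ?thesis .
qed

lemma stabilizer_sum_apply: "stabilizer_sum G Z f Z = of_nat (card (set_stabilizer G Z)) * f Z"
proof -
  have "stabilizer_sum G Z f Z = (\<Sum>\<pi>\<in>set_stabilizer G Z. f Z)"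
    unfolding stabilizer_sum_def sum_cfun_apply
    by (rule sum.cong) (simp_all add: perm_act_def set_stabilizer_def)
  then show ?thesis by simp
qed

lemma stabilizer_sum_in_subrep:
  assumes "subrep G perm_act U" "u \<in> U"
  shows "stabilizer_sum G Z u \<in> U"
  unfolding stabilizer_sum_def using assms
  by (intro cfun.subspace_sum) (auto simp: subrep_def set_stabilizer_def)

lemma card_stabilizer_nonzero:
  assumes "perm_group G"
  shows "card (set_stabilizer G Z) \<noteq> 0"
  using perm_groupD(1,2)[OF perm_group_stabilizer[OF assms]] card_gt_0_iff by blast

lemma exists_fixed_vector:
  assumes G: "perm_group G" and U: "subrep G perm_act U" and u: "u \<in> U" "u Z \<noteq> 0"
  obtains s where "s \<in> U" "s Z = 1" "\<And>\<pi>. \<pi> \<in> set_stabilizer G Z \<Longrightarrow> perm_act \<pi> s = s"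
proof
  let ?c = "of_nat (card (set_stabilizer G Z)) * u Z"
  let ?s = "fscale (inverse ?c) (stabilizer_sum G Z u)"
  have U0: "cfun.subspace U" using U by (simp add: subrep_def)
  show "?s \<in> U" by (rule cfun.subspace_scale[OF U0 stabilizer_sum_in_subrep[OF U u(1)]])
  have "?c \<noteq> 0" using card_stabilizer_nonzero[OF G] u(2) by simp
  then show "?s Z = 1" unfolding fscale_apply stabilizer_sum_apply by (rule left_inverse)
  show "perm_act \<pi> ?s = ?s" if "\<pi> \<in> set_stabilizer G Z" for \<pi>
    unfolding linear_on_fscale[OF linear_perm_act] perm_act_stabilizer_sum[OF G that] ..
qed

text \<open>Summing the images of a member of a nonzero subrepresentation \<open>U\<close> under the stabilizer of
  \<open>Z\<close> produces, after scaling, a fixed vector \<open>s\<close> in \<open>U\<close> with value 1 at \<open>Z\<close>. By uniqueness the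
  same sum for any \<open>v\<close> in \<open>V\<close> is a multiple of \<open>s\<close>, so the invariant form against \<open>s\<close> evaluates
  \<open>v\<close> at \<open>Z\<close>, up to a positive constant. By transitivity the translates of \<open>s\<close> are a
  reproducing kernel of \<open>V\<close>; every \<open>v\<close> is thus a combination of translates of \<open>s\<close> and lies in
  \<open>U\<close>.\<close>

lemma irreducible_if_unique_fixed_vector:
  assumes G: "perm_group G" and V: "subrep G perm_act V" "V \<noteq> {0}"
    and orbit: "\<And>v W. v \<in> V \<Longrightarrow> v W \<noteq> 0 \<Longrightarrow> \<exists>\<pi>\<in>G. \<pi> -` Z = W"
    and unique: "\<And>v. v \<in> V \<Longrightarrow> (\<And>\<pi>. \<pi> \<in> set_stabilizer G Z \<Longrightarrow> perm_act \<pi> v = v) \<Longrightarrow> v Z = 0 \<Longrightarrow> v = 0"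
  shows "irreducible_rep G perm_act V"
  unfolding irreducible_rep_def
proof (intro conjI allI impI)
  fix U assume U': "subrep G perm_act U \<and> U \<subseteq> V"
  then have U: "subrep G perm_act U" "U \<subseteq> V" by auto
  have U0: "cfun.subspace U" and V0: "cfun.subspace V"
    and GU: "\<And>\<pi> u. \<pi> \<in> G \<Longrightarrow> u \<in> U \<Longrightarrow> perm_act \<pi> u \<in> U"
    and GV: "\<And>\<pi> u. \<pi> \<in> G \<Longrightarrow> u \<in> V \<Longrightarrow> perm_act \<pi> u \<in> V"
    using U(1) V(1) by (auto simp: subrep_def)
  note [simp] = perm_groupD[OF G]
  show "U = {0} \<or> U = V"
  proof (rule disjCI)
    assume "U \<noteq> V"
    show "U = {0}"
    proof (rule ccontr)
      assume "U \<noteq> {0}"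
      then obtain u where u: "u \<in> U" "u \<noteq> 0" using cfun.subspace_0[OF U0] by blast
      then obtain W where W: "u W \<noteq> 0" by (auto simp: fun_eq_iff)
      then obtain \<pi> where \<pi>: "\<pi> \<in> G" "\<pi> -` Z = W" using orbit u(1) U(2) by blast
      then have "perm_act \<pi> u \<in> U" "perm_act \<pi> u Z \<noteq> 0" using GU u(1) W by (simp_all add: perm_act_def)
      then obtain s where s: "s \<in> U" "s Z = 1" "\<And>\<pi>. \<pi> \<in> set_stabilizer G Z \<Longrightarrow> perm_act \<pi> s = s"
        using exists_fixed_vector[OF G U(1)] by blast
      have sV: "s \<in> V" using s(1) U(2) by blast
      define form where "form v = (\<Sum>\<tau>\<in>G. v (\<tau> -` Z) * cnj (s (\<tau> -` Z)))" for v
      define c where "c = form s"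
      have form_linear: "form (fscale a v) = a * form v" "form (\<Sum>x\<in>S. w x) = (\<Sum>x\<in>S. form (w x))"
        for a v and S :: "(nat \<Rightarrow> nat) set" and w
      proof -
        show "form (fscale a v) = a * form v" by (simp add: form_def sum_distrib_left mult.assoc)
        show "form (\<Sum>x\<in>S. w x) = (\<Sum>x\<in>S. form (w x))"
          unfolding form_def sum_cfun_apply sum_distrib_right by (rule sum.swap)
      qed

      \<comment> \<open>The form is invariant under the stabilizer, so \<open>v\<close> may be replaced by its stabilizer sum.\<close>
      have form: "form v = v Z * c" if v: "v \<in> V" for v
      proof -
        let ?n = "of_nat (card (set_stabilizer G Z)) :: complex"
        have "form (perm_act \<eta> v) = form v" if \<eta>: "\<eta> \<in> set_stabilizer G Z" for \<eta>
        proof -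
          have "form (perm_act \<eta> v) = (\<Sum>\<tau>\<in>G. perm_act \<eta> v (\<tau> -` Z) * cnj (perm_act \<eta> s (\<tau> -` Z)))"
            by (simp add: form_def s(3)[OF \<eta>])
          also have "\<dots> = (\<Sum>\<tau>\<in>G. v ((\<tau> \<circ> \<eta>) -` Z) * cnj (s ((\<tau> \<circ> \<eta>) -` Z)))"
            by (simp add: perm_act_def vimage_comp[symmetric])
          also have "\<dots> = form v" unfolding form_def
            by (rule sum_perm_group_right[OF G]) (use \<eta> in \<open>simp add: set_stabilizer_def\<close>)
          finally show ?thesis .
        qed
        then have "form (stabilizer_sum G Z v) = ?n * form v"
          unfolding stabilizer_sum_def form_linear by simp
        moreover have "stabilizer_sum G Z v = fscale (?n * v Z) s"
        proof -
          let ?w = "stabilizer_sum G Z v - fscale (?n * v Z) s"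
          have "?w \<in> V"
            by (intro cfun.subspace_diff[OF V0] stabilizer_sum_in_subrep[OF V(1) v] cfun.subspace_scale[OF V0] sV)
          moreover have "perm_act \<pi> ?w = ?w" if "\<pi> \<in> set_stabilizer G Z" for \<pi>
            unfolding linear_on_UNIV_diff[OF linear_perm_act] linear_on_fscale[OF linear_perm_act]
              perm_act_stabilizer_sum[OF G that] s(3)[OF that] ..
          moreover have "?w Z = 0" by (simp add: stabilizer_sum_apply s(2))
          ultimately have "?w = 0" by (rule unique)
          then show ?thesis by simp
        qed
        ultimately have "?n * form v = ?n * (v Z * c)"
          by (simp only: form_linear c_def mult.assoc)
        then show ?thesis using card_stabilizer_nonzero[OF G, of Z] by simp
      qed
      have c_real: "c = of_real (\<Sum>\<tau>\<in>G. (cmod (s (\<tau> -` Z)))\<^sup>2)"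
        unfolding c_def form_def complex_norm_square[symmetric] of_real_sum ..
      have c0: "c \<noteq> 0"
      proof -
        have "(\<Sum>\<tau>\<in>G. (cmod (s (\<tau> -` Z)))\<^sup>2) \<ge> (cmod (s (id -` Z)))\<^sup>2"
          by (rule member_le_sum) (rule perm_groupD(2)[OF G], simp_all)
        then show ?thesis unfolding c_real of_real_eq_0_iff using s(2) by simp
      qed
      \<comment> \<open>The kernel is Hermitian.\<close>
      have sym: "s (\<pi> -` Z) = cnj (s (inv_into UNIV \<pi> -` Z))" if \<pi>: "\<pi> \<in> G" for \<pi>
      proof -
        have bij: "bij \<pi>" and inv: "inv_into UNIV \<pi> \<in> G" using \<pi> by simp_all
        have "s (\<pi> -` Z) * c = form (perm_act \<pi> s)"
          using form[OF GV[OF \<pi> sV]] by (simp add: perm_act_def)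
        also have "\<dots> = (\<Sum>\<tau>\<in>G. perm_act \<pi> s ((\<tau> \<circ> inv_into UNIV \<pi>) -` Z) * cnj (s ((\<tau> \<circ> inv_into UNIV \<pi>) -` Z)))"
          unfolding form_def by (rule sum_perm_group_right[OF G inv, symmetric])
        also have "\<dots> = (\<Sum>\<tau>\<in>G. s (\<tau> -` Z) * cnj (perm_act (inv_into UNIV \<pi>) s (\<tau> -` Z)))"
          by (simp add: perm_act_def vimage_comp[symmetric] vimage_inv[OF bij])
        also have "\<dots> = cnj (form (perm_act (inv_into UNIV \<pi>) s))"
          by (simp add: form_def mult.commute)
        also have "\<dots> = cnj (s (inv_into UNIV \<pi> -` Z)) * cnj c"
          using form[OF GV[OF inv sV]] by (simp add: perm_act_def)
        also have "cnj c = c" unfolding c_real by simp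
        finally show ?thesis using c0 by simp
      qed
      have "v \<in> U" if v: "v \<in> V" for v
      proof -
        define v' where "v' = (\<Sum>\<pi>\<in>G. fscale (v (\<pi> -` Z)) (perm_act (inv_into UNIV \<pi>) s))"
        have v'U: "v' \<in> U" unfolding v'_def
          by (intro cfun.subspace_sum[OF U0] cfun.subspace_scale[OF U0] GU s(1)) simp
        have "v' W = (fscale c v) W" for W
        proof (cases "\<exists>\<sigma>\<in>G. \<sigma> -` Z = W")
          case True
          then obtain \<sigma> where \<sigma>: "\<sigma> \<in> G" "W = \<sigma> -` Z" by blast
          have "s (inv_into UNIV \<pi> -` (\<sigma> -` Z)) = cnj (s (inv_into UNIV \<sigma> -` (\<pi> -` Z)))" if \<pi>: "\<pi> \<in> G" for \<pi>
          proof -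
            have "inv_into UNIV (\<sigma> \<circ> inv_into UNIV \<pi>) = \<pi> \<circ> inv_into UNIV \<sigma>"
              using \<pi> \<sigma>(1) by (simp add: o_inv_distrib inv_inv_eq)
            then show ?thesis using sym[of "\<sigma> \<circ> inv_into UNIV \<pi>"] \<pi> \<sigma>(1) by (simp add: vimage_comp)
          qed
          then have "v' W = (\<Sum>\<pi>\<in>G. v (\<pi> -` Z) * cnj (s (inv_into UNIV \<sigma> -` (\<pi> -` Z))))"
            unfolding v'_def sum_cfun_apply \<sigma>(2) by (simp add: perm_act_def)
          also have "\<dots> = (\<Sum>\<tau>\<in>G. v ((\<tau> \<circ> \<sigma>) -` Z) * cnj (s (inv_into UNIV \<sigma> -` ((\<tau> \<circ> \<sigma>) -` Z))))"
            by (rule sum_perm_group_right[OF G \<sigma>(1), symmetric])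
          also have "\<dots> = form (perm_act \<sigma> v)"
            using \<sigma>(1) by (simp add: form_def perm_act_def vimage_comp[symmetric] vimage_inv)
          also have "\<dots> = (fscale c v) W"
            using form[OF GV[OF \<sigma>(1) v]] by (simp add: perm_act_def \<sigma>(2))
          finally show ?thesis .
        next
          case False
          then have "w W = 0" if "w \<in> V" for w using orbit that by blast
          then have "v' W = 0" "v W = 0" using v v'U U(2) by blast+
          then show ?thesis by simp
        qed
        then have "v' = fscale c v" ..
        then have "v = fscale (inverse c) v'" using c0 by (simp add: fun_eq_iff)
        then show "v \<in> U" using cfun.subspace_scale[OF U0 v'U] by simp
      qed
      then show False using \<open>U \<noteq> V\<close> U(2) by blast
    qed
  qed
qed (use V in auto)

text \<open>Induction on the number of points of \<open>C\<close> missing in \<open>Z\<close>. If \<open>Z \<inter> X \<noteq> C\<close>, pick \<open>x\<close> in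
  \<open>Z \<inter> X\<close> outside \<open>C\<close> and evaluate \<open>lower X f = 0\<close> at \<open>E = Z - {x}\<close>. Adding a point of \<open>C\<close> to
  \<open>E\<close> gives a set that misses fewer points of \<open>C\<close>, where \<open>f\<close> is zero; adding any other point
  gives the value \<open>f Z\<close> by symmetry. So a positive multiple of \<open>f Z\<close> is zero.\<close>

lemma lower_fixed_vanish:
  assumes X: "finite X" and f: "f \<in> level X p" "lower X f = 0" and C: "C \<subseteq> X" "card C \<le> p"
    and swap: "\<And>x y E. x \<in> X - C \<Longrightarrow> y \<in> X - C \<Longrightarrow> x \<notin> E \<Longrightarrow> y \<notin> E \<Longrightarrow> f (insert x E) = f (insert y E)"
    and base: "\<And>Z. Z \<inter> X = C \<Longrightarrow> f Z = 0"
  shows "f Z = 0"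
proof (induction "card (C - Z)" arbitrary: Z rule: less_induct)
  case less
  have finC: "finite C" using X C(1) finite_subset by blast
  show ?case
  proof (rule ccontr)
    assume nz: "f Z \<noteq> 0"
    then have card: "card (Z \<inter> X) = p" and ne: "Z \<inter> X \<noteq> C" using f(1) base by (auto simp: level_def)
    have "\<not> Z \<inter> X \<subseteq> C" using card_seteq[OF finC] card C(2) ne by blast
    then obtain x where x: "x \<in> Z" "x \<in> X" "x \<notin> C" by blast
    define E where "E = Z - {x}"
    have Z: "Z = insert x E" "x \<notin> E" using x by (auto simp: E_def)
    have fin: "finite (X - E)" using X by simp
    have "0 = lower X f E" using f(2) by simp
    also have "\<dots> = (\<Sum>y\<in>X - E. if y \<in> C then 0 else f Z)"
      unfolding lower_def
    proof (rule sum.cong)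
      fix y assume y: "y \<in> X - E"
      show "f (insert y E) = (if y \<in> C then 0 else f Z)"
      proof (cases "y \<in> C")
        case True
        have "C - insert y E = (C - Z) - {y}" "y \<in> C - Z" using x(3) y True Z by auto
        then have "card (C - insert y E) < card (C - Z)" using finC by (metis card_Diff1_less finite_Diff)
        then show ?thesis using less True by simp
      next
        case False
        then show ?thesis using swap[of y x E] x y Z by simp
      qed
    qed simp
    also have "\<dots> = of_nat (card ((X - E) - C)) * f Z"
      using fin by (simp add: sum.If_cases Diff_eq)
    finally have "card ((X - E) - C) = 0" using nz by simp
    then show False using x Z fin by auto
  qed
qed

section \<open>Products of Specht modules\<close>

text \<open>Defined by equations; \<open>S_tensor_eq_bispecht\<close> identifies this space with the span of the
  products of members of the two Specht modules.\<close>

definition bispecht :: "nat set \<Rightarrow> nat set \<Rightarrow> nat \<Rightarrow> nat \<Rightarrow> (nat set \<Rightarrow> complex) set"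
  where "bispecht A B i j =
    {f \<in> subsets_of (A \<union> B) \<inter> level A i \<inter> level B j. lower A f = 0 \<and> lower B f = 0}"

definition part_group :: "nat set \<Rightarrow> nat set \<Rightarrow> (nat \<Rightarrow> nat) set"
  where "part_group A B = {\<pi>. \<pi> permutes (A \<union> B) \<and> \<pi> ` A = A}"

lemma lower_perm_act:
  assumes "bij \<pi>" "\<pi> ` X = X"
  shows "lower X (perm_act \<pi> f) = perm_act \<pi> (lower X f)"
proof
  fix E
  have inj: "\<pi> x = \<pi> y \<longleftrightarrow> x = y" for x y using assms(1) by (simp add: bij_is_inj inj_eq)
  have img: "\<pi> ` (X - \<pi> -` E) = X - E" 
    using assms by (simp add: image_set_diff bij_is_inj bij_is_surj surj_image_vimage_eq)
  have "lower X (perm_act \<pi> f) E = (\<Sum>y\<in>\<pi> ` (X - \<pi> -` E). f (\<pi> -` insert y E))"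
    unfolding lower_def perm_act_def img ..
  also have "\<dots> = (\<Sum>z\<in>X - \<pi> -` E. f (\<pi> -` insert (\<pi> z) E))"
    by (subst sum.reindex) (use inj in \<open>auto simp: inj_on_def\<close>)
  also have "\<dots> = perm_act \<pi> (lower X f) E"
  proof -
    have "\<pi> -` insert (\<pi> z) E = insert z (\<pi> -` E)" for z using inj by auto
    then show ?thesis by (simp add: lower_def perm_act_def)
  qed
  finally show "lower X (perm_act \<pi> f) E = perm_act \<pi> (lower X f) E" .
qed

lemma raise_perm_act:
  assumes "bij \<pi>" "\<pi> ` X = X"
  shows "raise X (perm_act \<pi> f) = perm_act \<pi> (raise X f)"
proof
  fix D
  have inj: "\<pi> x = \<pi> y \<longleftrightarrow> x = y" for x y using assms(1) by (simp add: bij_is_inj inj_eq)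
  have img: "\<pi> ` (\<pi> -` D \<inter> X) = D \<inter> X" 
    using assms by (simp add: image_Int bij_is_inj bij_is_surj surj_image_vimage_eq)
  have "raise X (perm_act \<pi> f) D = (\<Sum>y\<in>\<pi> ` (\<pi> -` D \<inter> X). f (\<pi> -` (D - {y})))"
    unfolding raise_def perm_act_def img ..
  also have "\<dots> = (\<Sum>z\<in>\<pi> -` D \<inter> X. f (\<pi> -` (D - {\<pi> z})))"
    by (subst sum.reindex) (use inj in \<open>auto simp: inj_on_def\<close>)
  also have "\<dots> = perm_act \<pi> (raise X f) D"
  proof -
    have "\<pi> -` (D - {\<pi> z}) = \<pi> -` D - {z}" for z using inj by auto
    then show ?thesis by (simp add: raise_def perm_act_def)
  qed
  finally show "raise X (perm_act \<pi> f) D = perm_act \<pi> (raise X f) D" .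
qed

lemma perm_act_level:
  assumes "bij \<pi>" "\<pi> -` X = X" "f \<in> level X i"
  shows "perm_act \<pi> f \<in> level X i"
proof -
  have "card (\<pi> -` Z \<inter> X) = card (Z \<inter> X)" for Z
    using assms(1,2) card_vimage_inj[of \<pi> "Z \<inter> X"] by (simp add: bij_is_inj bij_is_surj)
  moreover have "card (\<pi> -` Z \<inter> X) = i" if "perm_act \<pi> f Z \<noteq> 0" for Z
    using assms(3) that unfolding level_def perm_act_def by blast
  ultimately show ?thesis by (simp add: level_def)
qed

lemma perm_act_subsets_of:
  assumes "bij \<pi>" "\<pi> -` Y = Y" "f \<in> subsets_of Y"
  shows "perm_act \<pi> f \<in> subsets_of Y"
proof -
  have "\<pi> -` Z \<subseteq> Y \<longleftrightarrow> Z \<subseteq> Y" for Z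
    using assms(1,2) by (metis bij_is_surj image_mono surj_image_vimage_eq vimage_mono)
  moreover have "\<pi> -` Z \<subseteq> Y" if "perm_act \<pi> f Z \<noteq> 0" for Z
    using assms(3) that unfolding subsets_of_def perm_act_def by blast
  ultimately show ?thesis by (simp add: subsets_of_def)
qed

lemma exists_perm_image:
  assumes "finite A" "C \<subseteq> A" "D \<subseteq> A" "card C = card D"
  obtains \<pi> where "\<pi> permutes A" "\<pi> ` C = D"
proof -
  have fin: "finite C" "finite D" using assms finite_subset by blast+
  obtain f where f: "bij_betw f C D" using finite_same_card_bij[OF fin assms(4)] by blast
  have "card (A - C) = card (A - D)" using assms fin by (simp add: card_Diff_subset)
  then obtain g where g: "bij_betw g (A - C) (A - D)"
    using finite_same_card_bij[of "A - C" "A - D"] assms(1) by auto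
  define \<pi> where "\<pi> x = (if x \<in> C then f x else if x \<in> A then g x else x)" for x
  have "bij_betw \<pi> C D" using f by (rule bij_betw_cong[THEN iffD1, rotated]) (simp add: \<pi>_def)
  moreover have "bij_betw \<pi> (A - C) (A - D)"
    using g by (rule bij_betw_cong[THEN iffD1, rotated]) (simp add: \<pi>_def)
  ultimately have "bij_betw \<pi> (C \<union> (A - C)) (D \<union> (A - D))" by (rule bij_betw_combine) auto
  then have "bij_betw \<pi> A A" using assms(2,3) by (simp add: Un_absorb1)
  then have "\<pi> permutes A" by (rule bij_imp_permutes) (use assms(2) in \<open>auto simp: \<pi>_def\<close>)
  moreover have "\<pi> ` C = D" using \<open>bij_betw \<pi> C D\<close> by (simp add: bij_betw_def)
  ultimately show ?thesis by (rule that)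
qed

locale two_parts =
  fixes A B :: "nat set"
  assumes finA: "finite A" and finB: "finite B" and disj: "A \<inter> B = {}"
begin

lemma swapped: "two_parts B A"
  using finA finB disj by unfold_locales auto

lemma part_groupD:
  assumes "\<pi> \<in> part_group A B"
  shows "\<pi> permutes (A \<union> B)" "bij \<pi>" "\<pi> ` A = A" "\<pi> ` B = B"
proof -
  show 1: "\<pi> permutes (A \<union> B)" "\<pi> ` A = A" using assms by (auto simp: part_group_def)
  show 2: "bij \<pi>" using 1 permutes_bij by blast
  have "\<pi> ` (A \<union> B - A) = (A \<union> B) - A"
    using permutes_image[OF 1(1)] 1(2) image_set_diff[OF bij_is_inj[OF 2]] by metis
  moreover have "A \<union> B - A = B" using disj by auto
  ultimately show "\<pi> ` B = B" by simp
qed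

lemma part_group_swapped: "part_group B A = part_group A B"
proof -
  have "\<pi> \<in> part_group B A" if "\<pi> \<in> part_group A B" for \<pi>
    using part_groupD[OF that] unfolding part_group_def by (simp add: Un_commute)
  moreover have "\<pi> \<in> part_group A B" if "\<pi> \<in> part_group B A" for \<pi>
    using two_parts.part_groupD[OF swapped that] unfolding part_group_def by (simp add: Un_commute)
  ultimately show ?thesis by blast
qed

lemma part_group_vimage:
  assumes "\<pi> \<in> part_group A B"
  shows "\<pi> -` A = A" "\<pi> -` B = B"
  using part_groupD[OF assms] by (metis bij_is_inj inj_vimage_image_eq)+

lemma perm_group_part_group: "perm_group (part_group A B)"
  unfolding perm_group_def
proof (intro conjI ballI)
  have "finite {\<pi>. \<pi> permutes (A \<union> B)}" using finA finB by (simp add: finite_permutations)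
  then show "finite (part_group A B)" by (rule finite_subset[rotated]) (auto simp: part_group_def)
  show "id \<in> part_group A B" by (simp add: part_group_def permutes_id)
  fix \<pi> assume \<pi>: "\<pi> \<in> part_group A B"
  note D = part_groupD[OF \<pi>]
  show "bij \<pi>" by fact
  have "inv_into UNIV \<pi> ` A = A" using D(2,3) by (metis bij_is_inj image_inv_f_f)
  then show "inv_into UNIV \<pi> \<in> part_group A B" using permutes_inv[OF D(1)] by (simp add: part_group_def)
  fix \<tau> assume "\<tau> \<in> part_group A B"
  note E = part_groupD[OF this]
  have "(\<pi> \<circ> \<tau>) ` A = A" by (simp only: image_comp[symmetric] D(3) E(3))
  then show "\<pi> \<circ> \<tau> \<in> part_group A B"
    using permutes_compose[OF E(1) D(1)] by (simp add: part_group_def)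
qed

lemma subrep_bispecht: "subrep (part_group A B) perm_act (bispecht A B i j)"
  unfolding subrep_def
proof (intro conjI ballI)
  have "cfun.subspace {f. lower X f = 0}" for X
    unfolding cfun.subspace_def
    by (simp add: linear_on_UNIV_zero[OF linear_lower] linear_on_add[OF linear_lower]
        linear_on_fscale[OF linear_lower])
  moreover have "bispecht A B i j = subsets_of (A \<union> B) \<inter> level A i \<inter> level B j
      \<inter> {f. lower A f = 0} \<inter> {f. lower B f = 0}"
    by (auto simp: bispecht_def)
  ultimately show "cfun.subspace (bispecht A B i j)"
    by (simp add: cfun.subspace_inter subspace_level subspace_subsets_of)
next
  fix \<pi> f assume \<pi>: "\<pi> \<in> part_group A B" and "f \<in> bispecht A B i j"
  then have f: "f \<in> subsets_of (A \<union> B)" "f \<in> level A i" "f \<in> level B j" "lower A f = 0" "lower B f = 0"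
    by (auto simp: bispecht_def)
  note D = part_groupD[OF \<pi>] part_group_vimage[OF \<pi>]
  have "\<pi> -` (A \<union> B) = A \<union> B" using D by auto
  moreover have "perm_act \<pi> 0 = 0" by (rule linear_on_UNIV_zero[OF linear_perm_act])
  ultimately show "perm_act \<pi> f \<in> bispecht A B i j"
    unfolding bispecht_def using f D
    by (simp add: perm_act_level perm_act_subsets_of lower_perm_act)
qed

lemma bispecht_swapped: "bispecht B A j i = bispecht A B i j"
  by (auto simp: bispecht_def Un_commute)

lemma transpose_in_stabilizer:
  assumes "x \<in> A - Z" "y \<in> A - Z"
  shows "transpose x y \<in> set_stabilizer (part_group A B) Z"
proof -
  have "transpose x y -` Z = Z" using assms by (auto simp: transpose_def split: if_splits)
  moreover have "transpose x y permutes (A \<union> B)" using assms by (auto intro: permutes_swap_id)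
  moreover have "transpose x y ` A = A" using assms by (simp add: transpose_image_eq)
  ultimately show ?thesis by (simp add: set_stabilizer_def part_group_def)
qed

lemma fixed_swap:
  assumes fixed: "\<And>\<pi>. \<pi> \<in> set_stabilizer (part_group A B) Z \<Longrightarrow> perm_act \<pi> f = f"
    and "x \<in> A - Z" "y \<in> A - Z" "x \<notin> E" "y \<notin> E"
  shows "f (insert x E) = f (insert y E)"
proof -
  have "transpose x y -` insert x E = insert y E"
    using assms(4,5) by (auto simp: transpose_def split: if_splits)
  then show ?thesis
    using fun_cong[OF fixed[OF transpose_in_stabilizer[OF assms(2,3)]], of "insert x E"]
    by (simp add: perm_act_def)
qed

lemma fixed_vanish_left:
  assumes f: "f \<in> bispecht A B i j" and Z: "card (Z \<inter> A) < i"
    and fixed: "\<And>\<pi>. \<pi> \<in> set_stabilizer (part_group A B) Z \<Longrightarrow> perm_act \<pi> f = f"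
  shows "f = 0"
proof
  fix W
  have f': "f \<in> level A i" "lower A f = 0" using f by (auto simp: bispecht_def)
  show "f W = 0 W"
    unfolding zero_fun_apply
  proof (rule lower_fixed_vanish[OF finA f', of "Z \<inter> A"])
    fix x y E assume "x \<in> A - Z \<inter> A" "y \<in> A - Z \<inter> A" "x \<notin> E" "y \<notin> E"
    then show "f (insert x E) = f (insert y E)" by (intro fixed_swap[of Z f x y E] fixed) auto
  next
    fix W assume "W \<inter> A = Z \<inter> A"
    then show "f W = 0" using Z f'(1) by (auto simp: level_def)
  qed (use Z in auto)
qed

text \<open>Applied to \<open>A\<close>, \<open>lower_fixed_vanish\<close> reduces the claim to the sets that agree with \<open>Z\<close> on
  \<open>A\<close>; among these it is applied to \<open>B\<close>.\<close>

lemma fixed_vanish: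
  assumes f: "f \<in> bispecht A B i j" and Z: "Z \<subseteq> A \<union> B" "card (Z \<inter> A) = i" "card (Z \<inter> B) = j"
    and fixed: "\<And>\<pi>. \<pi> \<in> set_stabilizer (part_group A B) Z \<Longrightarrow> perm_act \<pi> f = f"
    and fZ: "f Z = 0"
  shows "f = 0"
proof
  fix W
  have f': "f \<in> level A i" "lower A f = 0" "f \<in> level B j" "lower B f = 0" "f \<in> subsets_of (A \<union> B)"
    using f by (auto simp: bispecht_def)
  have fixed': "perm_act \<pi> f = f" if "\<pi> \<in> set_stabilizer (part_group B A) Z" for \<pi>
    using fixed that unfolding part_group_swapped .
  show "f W = 0 W"
    unfolding zero_fun_apply
  proof (rule lower_fixed_vanish[OF finA f'(1,2), of "Z \<inter> A"])
    fix x y E assume "x \<in> A - Z \<inter> A" "y \<in> A - Z \<inter> A" "x \<notin> E" "y \<notin> E"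
    then show "f (insert x E) = f (insert y E)" by (intro fixed_swap[of Z f x y E] fixed) auto
  next
    fix W assume W: "W \<inter> A = Z \<inter> A"
    define h where "h V = (if V \<inter> A = Z \<inter> A then f V else 0)" for V
    have ins: "insert y E \<inter> A = E \<inter> A" if "y \<in> B" for y E using that disj by auto
    have "h W = 0"
    proof (rule lower_fixed_vanish[OF finB, of h j "Z \<inter> B"])
      show "h \<in> level B j" using f'(3) by (auto simp: level_def h_def)
      have "lower B h E = (if E \<inter> A = Z \<inter> A then lower B f E else 0)" for E
        unfolding lower_def h_def by (auto simp: ins intro: sum.cong)
      then show "lower B h = 0" by (simp add: fun_eq_iff f'(4))
    next
      fix x y E assume xy: "x \<in> B - Z \<inter> B" "y \<in> B - Z \<inter> B" "x \<notin> E" "y \<notin> E"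
      have "f (insert x E) = f (insert y E)"
        by (rule two_parts.fixed_swap[OF swapped, of Z]) (use fixed' xy in auto)
      then show "h (insert x E) = h (insert y E)" using xy by (simp add: h_def ins)
    next
      fix V assume V: "V \<inter> B = Z \<inter> B"
      show "h V = 0"
      proof (cases "V \<inter> A = Z \<inter> A \<and> f V \<noteq> 0")
        case True
        then have "V \<subseteq> A \<union> B" using f'(5) by (auto simp: subsets_of_def)
        then have "V = Z" using V True Z(1) by blast
        then show ?thesis using fZ True by simp
      qed (auto simp: h_def)
    qed (use Z in auto)
    then show "f W = 0" using W by (simp add: h_def)
  qed (use Z in auto)
qed

text \<open>Permutations of \<open>A\<close> and of \<open>B\<close> can be prescribed independently.\<close>

lemma part_group_transitive:
  assumes Z: "Z \<subseteq> A \<union> B" "W \<subseteq> A \<union> B"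
    and card: "card (Z \<inter> A) = card (W \<inter> A)" "card (Z \<inter> B) = card (W \<inter> B)"
  shows "\<exists>\<pi>\<in>part_group A B. \<pi> -` Z = W"
proof -
  obtain \<alpha> where \<alpha>: "\<alpha> permutes A" "\<alpha> ` (W \<inter> A) = Z \<inter> A"
    using exists_perm_image[OF finA, of "W \<inter> A" "Z \<inter> A"] card by auto
  obtain \<beta> where \<beta>: "\<beta> permutes B" "\<beta> ` (W \<inter> B) = Z \<inter> B"
    using exists_perm_image[OF finB, of "W \<inter> B" "Z \<inter> B"] card by auto
  have \<alpha>id: "\<alpha> x = x" if "x \<in> B" for x using \<alpha>(1) that disj by (metis disjoint_iff permutes_not_in)
  have \<beta>id: "\<beta> x = x" if "x \<in> A" for x using \<beta>(1) that disj by (metis disjoint_iff permutes_not_in)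
  have img: "(\<alpha> \<circ> \<beta>) ` S = \<alpha> ` S" if "S \<subseteq> A" for S
    using \<beta>id that by (auto simp: image_iff subset_iff)
  have imgB: "(\<alpha> \<circ> \<beta>) ` S = \<beta> ` S" if "S \<subseteq> B" for S
  proof -
    have "\<alpha> (\<beta> x) = \<beta> x" if "x \<in> S" for x
      using \<alpha>id permutes_in_image[OF \<beta>(1)] that \<open>S \<subseteq> B\<close> by auto
    then show ?thesis by (auto simp: image_iff)
  qed
  have "(\<alpha> \<circ> \<beta>) permutes (A \<union> B)"
    using \<alpha>(1) \<beta>(1) by (intro permutes_compose) (auto intro: permutes_subset)
  moreover have "(\<alpha> \<circ> \<beta>) ` A = A" using img[of A] permutes_image[OF \<alpha>(1)] by simp
  ultimately have G: "\<alpha> \<circ> \<beta> \<in> part_group A B" by (simp add: part_group_def)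
  have W: "W = (W \<inter> A) \<union> (W \<inter> B)" using Z by auto
  have "(\<alpha> \<circ> \<beta>) ` W = (Z \<inter> A) \<union> (Z \<inter> B)"
    by (subst W, subst image_Un) (use img[of "W \<inter> A"] imgB[of "W \<inter> B"] \<alpha>(2) \<beta>(2) in auto)
  also have "\<dots> = Z" using Z by auto
  finally have "(\<alpha> \<circ> \<beta>) -` Z = W"
    using part_groupD(2)[OF G] by (metis bij_is_inj inj_vimage_image_eq)
  then show ?thesis using G by blast
qed

lemma irreducible_bispecht:
  assumes "bispecht A B i j \<noteq> {0}"
  shows "irreducible_rep (part_group A B) perm_act (bispecht A B i j)"
proof -
  have "0 \<in> bispecht A B i j" using subrep_bispecht[of i j] by (simp add: subrep_def cfun.subspace_0)
  then obtain u where u: "u \<in> bispecht A B i j" "u \<noteq> 0" using assms by blast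
  then obtain Z where "u Z \<noteq> 0" by (auto simp: fun_eq_iff)
  have supp: "W \<subseteq> A \<union> B" "card (W \<inter> A) = i" "card (W \<inter> B) = j"
    if "v \<in> bispecht A B i j" "v W \<noteq> 0" for v W
    using that by (auto simp: bispecht_def subsets_of_def level_def)
  note Z = supp[OF u(1) \<open>u Z \<noteq> 0\<close>]
  show ?thesis
  proof (rule irreducible_if_unique_fixed_vector[OF perm_group_part_group subrep_bispecht assms, of Z])
    show "\<exists>\<pi>\<in>part_group A B. \<pi> -` Z = W" if "v \<in> bispecht A B i j" "v W \<noteq> 0" for v W
      using part_group_transitive Z supp[OF that] by simp
    show "v = 0" if "v \<in> bispecht A B i j" "v Z = 0"
      "\<And>\<pi>. \<pi> \<in> set_stabilizer (part_group A B) Z \<Longrightarrow> perm_act \<pi> v = v" for v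
      using fixed_vanish[OF that(1) Z that(3,2)] .
  qed
qed

text \<open>\<open>T\<close> would map a nonzero fixed vector of the stabilizer of a set with \<open>i\<close> points in \<open>A\<close> to
  a fixed vector in a space whose functions live on sets with \<open>i' > i\<close> points in \<open>A\<close>, and the
  latter is zero.\<close>

lemma no_embedding_left:
  assumes T: "linear_on (bispecht A B i j) T" "inj_on T (bispecht A B i j)"
    "equivariant_on (part_group A B) perm_act (bispecht A B i j) perm_act T"
    "T ` bispecht A B i j \<subseteq> bispecht A B i' j'"
    and ne: "bispecht A B i j \<noteq> {0}"
  shows "i' \<le> i"
proof (rule ccontr)
  assume "\<not> i' \<le> i"
  have K0: "cfun.subspace (bispecht A B i j)" using subrep_bispecht by (simp add: subrep_def)
  then obtain u where u: "u \<in> bispecht A B i j" "u \<noteq> 0" using ne cfun.subspace_0 by blast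
  then obtain Z where uZ: "u Z \<noteq> 0" by (auto simp: fun_eq_iff)
  then have "card (Z \<inter> A) = i" using u(1) by (auto simp: bispecht_def level_def)
  then have Z: "card (Z \<inter> A) < i'" using \<open>\<not> i' \<le> i\<close> by simp
  obtain s where s: "s \<in> bispecht A B i j" "s Z = 1"
    "\<And>\<pi>. \<pi> \<in> set_stabilizer (part_group A B) Z \<Longrightarrow> perm_act \<pi> s = s"
    using exists_fixed_vector[OF perm_group_part_group subrep_bispecht u(1) uZ] by blast
  have "T s = 0"
  proof (rule fixed_vanish_left[OF _ Z])
    show "T s \<in> bispecht A B i' j'" using T(4) s(1) by blast
    fix \<pi> assume \<pi>: "\<pi> \<in> set_stabilizer (part_group A B) Z"
    then have "perm_act \<pi> (T s) = T (perm_act \<pi> s)"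
      using T(3) s(1) by (simp add: equivariant_on_def set_stabilizer_def)
    then show "perm_act \<pi> (T s) = T s" using s(3)[OF \<pi>] by simp
  qed
  then have "s = 0" using T(2) s(1) inj_on_linear_iff[OF K0 T(1)] by blast
  then show False using s(2) by simp
qed

lemma bispecht_iso_imp_eq:
  assumes iso: "rep_iso (part_group A B) perm_act (bispecht A B i j) perm_act (bispecht A B i' j')"
    and ne: "bispecht A B i j \<noteq> {0}"
  shows "i = i' \<and> j = j'"
proof -
  have le: "i' \<le> i \<and> j' \<le> j"
    if iso0: "rep_iso (part_group A B) perm_act (bispecht A B i j) perm_act (bispecht A B i' j')"
      and ne0: "bispecht A B i j \<noteq> {0}" for i j i' j'
  proof -
    obtain T where T: "linear_on (bispecht A B i j) T"
      "equivariant_on (part_group A B) perm_act (bispecht A B i j) perm_act T"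
      "bij_betw T (bispecht A B i j) (bispecht A B i' j')"
      using iso0 unfolding rep_iso_def by blast
    then have T': "inj_on T (bispecht A B i j)" "T ` bispecht A B i j \<subseteq> bispecht A B i' j'"
      by (auto simp: bij_betw_def)
    show ?thesis
      using no_embedding_left[OF T(1) T'(1) T(2) T'(2) ne0]
        two_parts.no_embedding_left[OF swapped, unfolded part_group_swapped bispecht_swapped,
          OF T(1) T'(1) T(2) T'(2) ne0]
      by blast
  qed
  have iso': "rep_iso (part_group A B) perm_act (bispecht A B i' j') perm_act (bispecht A B i j)"
    by (rule rep_iso_sym[OF iso subrep_bispecht])
  have "bispecht A B i' j' \<noteq> {0}"
    using rep_iso_irreducible[OF iso' irreducible_bispecht[OF ne] subrep_bispecht]
    by (simp add: irreducible_rep_def)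
  from le[OF iso ne] le[OF iso' this] show ?thesis by simp
qed

end

section \<open>Specht modules and tensor products\<close>

lemma Mspace_eq: "Mspace X j = subsets_of X \<inter> level X j"
  unfolding Mspace_def subsets_of_def level_def by (auto simp: Int_absorb2)

lemma d_map_eq_lower:
  assumes X: "finite X" and f: "f \<in> subsets_of X"
  shows "d_map X f = lower X f"
proof
  fix E
  have "d_map X f E = (\<Sum>C\<in>Pow X. \<Sum>x\<in>X. if x \<in> C \<and> E = C - {x} then f C else 0)"
    unfolding d_map_def sum_cfun_apply fscale_apply
  proof (rule sum.cong)
    fix C assume C: "C \<in> Pow X"
    have "f C * (\<Sum>x\<in>C. dirac (C - {x}) E) = (\<Sum>x\<in>C. if E = C - {x} then f C else 0)"
      unfolding sum_distrib_left by (rule sum.cong) (auto simp: dirac_def)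
    also have "\<dots> = (\<Sum>x\<in>X. if x \<in> C \<and> E = C - {x} then f C else 0)"
      by (rule sum.mono_neutral_cong_left) (use C X in auto)
    finally show "f C * (\<Sum>x\<in>C. dirac (C - {x}) E)
        = (\<Sum>x\<in>X. if x \<in> C \<and> E = C - {x} then f C else 0)" .
  qed simp
  also have "\<dots> = (\<Sum>x\<in>X. \<Sum>C\<in>Pow X. if x \<in> C \<and> E = C - {x} then f C else 0)"
    by (rule sum.swap)
  also have "\<dots> = (\<Sum>x\<in>X. if x \<notin> E then f (insert x E) else 0)"
  proof (rule sum.cong)
    fix x assume x: "x \<in> X"
    have "(\<Sum>C\<in>Pow X. if x \<in> C \<and> E = C - {x} then f C else 0)
        = (\<Sum>C\<in>Pow X. if C = insert x E then (if x \<notin> E then f (insert x E) else 0) else 0)"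
      by (rule sum.cong) auto
    also have "\<dots> = (if x \<notin> E then f (insert x E) else 0)"
      using X f x by (auto simp: subsets_of_def)
    finally show "(\<Sum>C\<in>Pow X. if x \<in> C \<and> E = C - {x} then f C else 0)
        = (if x \<notin> E then f (insert x E) else 0)" .
  qed simp
  also have "\<dots> = lower X f E"
    unfolding lower_def by (rule sum.mono_neutral_cong_right) (use X in auto)
  finally show "d_map X f E = lower X f E" .
qed

lemma Sspace_eq:
  assumes "finite X"
  shows "Sspace X j = {f \<in> subsets_of X \<inter> level X j. lower X f = 0}"
  unfolding Sspace_def Mspace_eq using d_map_eq_lower[OF assms] by auto

lemma R_map_apply:
  assumes X: "finite X"
  shows "R_map X q f D
    = (if D \<subseteq> X then \<Sum>C\<in>Pow X. if C \<subseteq> D \<and> card D = card C + q then f C else 0 else 0)"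
proof -
  have "(\<Sum>D\<in>{D. C \<subseteq> D \<and> D \<subseteq> X \<and> card D = card C + q}. dirac D D') =
      (if C \<subseteq> D' \<and> D' \<subseteq> X \<and> card D' = card C + q then 1 else 0)" for C D'
  proof -
    have "finite {D. C \<subseteq> D \<and> D \<subseteq> X \<and> card D = card C + q}"
      by (rule finite_subset[of _ "Pow X"]) (use X in auto)
    then show ?thesis by (simp add: dirac_def)
  qed
  then show ?thesis
    unfolding R_map_def sum_cfun_apply fscale_apply by (auto intro!: sum.cong sum.neutral)
qed

text \<open>Every \<open>C \<subseteq> D\<close> with \<open>card (D - C) = q + 1\<close> is counted once for each of the \<open>q + 1\<close> points
  \<open>y\<close> of \<open>D - C\<close>.\<close>

lemma raise_R_map:
  assumes X: "finite X"
  shows "raise X (R_map X q f) = fscale (of_nat (Suc q)) (R_map X (Suc q) f)"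
proof
  fix D
  show "raise X (R_map X q f) D = fscale (of_nat (Suc q)) (R_map X (Suc q) f) D"
  proof (cases "D \<subseteq> X")
    case True
    then have finD: "finite D" and DX: "D \<inter> X = D" using X finite_subset by auto
    have "raise X (R_map X q f) D
        = (\<Sum>y\<in>D. \<Sum>C\<in>Pow X. if C \<subseteq> D - {y} \<and> card (D - {y}) = card C + q then f C else 0)"
      unfolding raise_def DX R_map_apply[OF X] by (rule sum.cong) (use True in auto)
    also have "\<dots> = (\<Sum>C\<in>Pow X. \<Sum>y\<in>D. if C \<subseteq> D - {y} \<and> card (D - {y}) = card C + q then f C else 0)"
      by (rule sum.swap)
    also have "\<dots> = (\<Sum>C\<in>Pow X. of_nat (Suc q) * (if C \<subseteq> D \<and> card D = card C + Suc q then f C else 0))"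
    proof (rule sum.cong)
      fix C assume "C \<in> Pow X"
      then have finC: "finite C" using X finite_subset by auto
      have "(\<Sum>y\<in>D. if C \<subseteq> D - {y} \<and> card (D - {y}) = card C + q then f C else 0)
          = (\<Sum>y\<in>D - C. if C \<subseteq> D \<and> card D = card C + Suc q then f C else 0)"
      proof (rule sum.mono_neutral_cong_right)
        fix y assume "y \<in> D - C"
        moreover from this have "card D = Suc (card (D - {y}))" using finD by (metis DiffD1 card_Suc_Diff1)
        ultimately show "(if C \<subseteq> D - {y} \<and> card (D - {y}) = card C + q then f C else 0)
            = (if C \<subseteq> D \<and> card D = card C + Suc q then f C else 0)" by auto
      qed (use finD in auto)
      also have "\<dots> = of_nat (Suc q) * (if C \<subseteq> D \<and> card D = card C + Suc q then f C else 0)"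
        using card_Diff_subset[OF finC, of D] by simp
      finally show "(\<Sum>y\<in>D. if C \<subseteq> D - {y} \<and> card (D - {y}) = card C + q then f C else 0)
          = of_nat (Suc q) * (if C \<subseteq> D \<and> card D = card C + Suc q then f C else 0)" .
    qed simp
    finally show ?thesis using True by (simp add: R_map_apply[OF X] sum_distrib_left)
  next
    case False
    have "R_map X q f (D - {y}) = 0" if "y \<in> D \<inter> X" for y
    proof -
      have "\<not> D - {y} \<subseteq> X" using False that by auto
      then show ?thesis by (simp add: R_map_apply[OF X])
    qed
    then show ?thesis using False by (simp add: raise_def R_map_apply[OF X])
  qed
qed

lemma raise_pow_eq_R_map:
  assumes X: "finite X" and f: "f \<in> subsets_of X"
  shows "(raise X ^^ q) f = fscale (fact q) (R_map X q f)"
proof (induction q)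
  case 0
  have "R_map X 0 f D = f D" for D
  proof (cases "D \<subseteq> X")
    case True
    then have finD: "finite D" using X finite_subset by auto
    have "R_map X 0 f D = (\<Sum>C\<in>Pow X. if C = D then f C else 0)"
      unfolding R_map_apply[OF X] using True
      using card_subset_eq[OF finD] by (auto intro!: sum.cong)
    also have "\<dots> = f D" using True X by simp
    finally show ?thesis .
  next
    case False
    then show ?thesis using f by (auto simp: R_map_apply[OF X] subsets_of_def)
  qed
  then show ?case by (simp add: fun_eq_iff)
next
  case (Suc q)
  have "(raise X ^^ Suc q) f = fscale (fact q) (raise X (R_map X q f))"
    unfolding funpow.simps comp_apply Suc by (rule linear_on_fscale[OF linear_raise])
  then show ?case unfolding raise_R_map[OF X] by (simp add: fun_eq_iff)
qed

text \<open>The product without the size conditions of \<open>tensor\<close>, which the levels of the factors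
  already enforce. In this form the operators of \<open>A\<close> and of \<open>B\<close> act on one factor each.\<close>

definition fun_product ::
  "nat set \<Rightarrow> nat set \<Rightarrow> (nat set \<Rightarrow> complex) \<Rightarrow> (nat set \<Rightarrow> complex) \<Rightarrow> (nat set \<Rightarrow> complex)"
  where "fun_product A B F G = (\<lambda>Z. if Z \<subseteq> A \<union> B then F (Z \<inter> A) * G (Z \<inter> B) else 0)"

lemma fun_product_commute: "fun_product A B F G = fun_product B A G F"
  by (auto simp: fun_product_def fun_eq_iff Un_commute)

lemma R_map_Mspace:
  assumes X: "finite X" and f: "f \<in> subsets_of X" "f \<in> level X i"
  shows "R_map X q f \<in> subsets_of X" "R_map X q f \<in> level X (i + q)"
proof -
  have "R_map X q f = fscale (inverse (fact q)) ((raise X ^^ q) f)"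
    unfolding raise_pow_eq_R_map[OF X f(1)] by (simp add: fun_eq_iff)
  then show "R_map X q f \<in> subsets_of X" "R_map X q f \<in> level X (i + q)"
    using cfun.subspace_scale[OF subspace_subsets_of raise_pow_subsets_of[OF subset_refl f(1)]]
      cfun.subspace_scale[OF subspace_level raise_pow_level[OF X f(2)]] by simp_all
qed

context two_parts
begin

lemma card_Int_Un: "card (Z \<inter> (A \<union> B)) = card (Z \<inter> A) + card (Z \<inter> B)"
  unfolding Int_Un_distrib by (rule card_Un_disjoint) (use finA finB disj in auto)

lemma level_Un:
  assumes "f \<in> level A i" "f \<in> level B j"
  shows "f \<in> level (A \<union> B) (i + j)"
  using assms by (simp add: level_def card_Int_Un)

lemma tensor_eq_fun_product:
  assumes "F \<in> level A p" "G \<in> level B q"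
  shows "tensor A p B q F G = fun_product A B F G"
proof
  fix Z
  show "tensor A p B q F G Z = fun_product A B F G Z"
  proof (cases "Z \<subseteq> A \<union> B \<and> F (Z \<inter> A) \<noteq> 0 \<and> G (Z \<inter> B) \<noteq> 0")
    case True
    have "card (Z \<inter> A \<inter> A) = p" "card (Z \<inter> B \<inter> B) = q" using assms True by (auto simp: level_def simp del: Int_assoc)
    then have c: "card (Z \<inter> A) = p" "card (Z \<inter> B) = q" by (simp_all add: Int_assoc)
    have "card Z = card (Z \<inter> A) + card (Z \<inter> B)"
      using card_Int_Un[of Z] True by (simp add: Int_absorb2)
    then show ?thesis using c by (simp add: tensor_def fun_product_def)
  qed (auto simp: tensor_def fun_product_def)
qed

lemma lower_fun_product_left: "lower A (fun_product A B F G) = fun_product A B (lower A F) G"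
proof
  fix E
  have i: "insert y E \<inter> A = insert y (E \<inter> A)" "insert y E \<inter> B = E \<inter> B"
    "insert y E \<subseteq> A \<union> B \<longleftrightarrow> E \<subseteq> A \<union> B" if "y \<in> A" for y
    using that disj by auto
  have "A - E \<inter> A = A - E" by auto
  then show "lower A (fun_product A B F G) E = fun_product A B (lower A F) G E"
    by (simp add: lower_def fun_product_def i sum_distrib_right)
qed

lemma raise_fun_product_left: "raise A (fun_product A B F G) = fun_product A B (raise A F) G"
proof
  fix D
  have i: "(D - {y}) \<inter> A = (D \<inter> A) - {y}" "(D - {y}) \<inter> B = D \<inter> B"
    "D - {y} \<subseteq> A \<union> B \<longleftrightarrow> D \<subseteq> A \<union> B" if "y \<in> D \<inter> A" for y
    using that disj by auto
  have "D \<inter> A \<inter> A = D \<inter> A" by auto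
  then show "raise A (fun_product A B F G) D = fun_product A B (raise A F) G D"
    by (simp add: raise_def fun_product_def i sum_distrib_right)
qed

lemma lower_fun_product_right: "lower B (fun_product A B F G) = fun_product A B F (lower B G)"
  using two_parts.lower_fun_product_left[OF swapped, of G F] by (simp add: fun_product_commute)

lemma raise_fun_product_right: "raise B (fun_product A B F G) = fun_product A B F (raise B G)"
  using two_parts.raise_fun_product_left[OF swapped, of G F] by (simp add: fun_product_commute)

lemma raise_pow_fun_product:
  "(raise A ^^ p) ((raise B ^^ q) (fun_product A B F G)) = fun_product A B ((raise A ^^ p) F) ((raise B ^^ q) G)"
proof -
  have "(raise B ^^ q) (fun_product A B F G) = fun_product A B F ((raise B ^^ q) G)" for F
    by (induction q) (simp_all add: raise_fun_product_right)
  moreover have "(raise A ^^ p) (fun_product A B F G) = fun_product A B ((raise A ^^ p) F) G" for G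
    by (induction p) (simp_all add: raise_fun_product_left)
  ultimately show ?thesis by simp
qed

lemma fun_product_subsets_of: "fun_product A B F G \<in> subsets_of (A \<union> B)"
  by (auto simp: subsets_of_def fun_product_def)

lemma fun_product_level:
  assumes "F \<in> level A i"
  shows "fun_product A B F G \<in> level A i"
  unfolding level_def
proof (intro CollectI allI impI)
  fix Z assume "fun_product A B F G Z \<noteq> 0"
  then have "F (Z \<inter> A) \<noteq> 0" by (auto simp: fun_product_def split: if_splits)
  then have "card (Z \<inter> A \<inter> A) = i" using assms unfolding level_def by blast
  then show "card (Z \<inter> A) = i" by (simp add: Int_assoc)
qed

lemma fun_product_zero: "fun_product A B 0 G = 0" "fun_product A B F 0 = 0"
  by (simp_all add: fun_product_def fun_eq_iff)

lemma fun_product_bispecht: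
  assumes "\<phi> \<in> Sspace A i" "\<psi> \<in> Sspace B j"
  shows "fun_product A B \<phi> \<psi> \<in> bispecht A B i j"
  using assms fun_product_level[of \<phi> i \<psi>] two_parts.fun_product_level[OF swapped, of \<psi> j \<phi>]
  unfolding bispecht_def Sspace_eq[OF finA] Sspace_eq[OF finB]
  by (simp add: fun_product_subsets_of lower_fun_product_left lower_fun_product_right fun_product_zero
      fun_product_commute[of B A])

lemma fun_product_nonzero:
  assumes "\<phi> \<in> subsets_of A" "\<psi> \<in> subsets_of B" "\<phi> \<noteq> 0" "\<psi> \<noteq> 0"
  shows "fun_product A B \<phi> \<psi> \<noteq> 0"
proof -
  obtain C D where CD: "\<phi> C \<noteq> 0" "\<psi> D \<noteq> 0" using assms(3,4) by (auto simp: fun_eq_iff)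
  then have "C \<subseteq> A" "D \<subseteq> B" using assms(1,2) by (auto simp: subsets_of_def)
  then have "(C \<union> D) \<inter> A = C" "(C \<union> D) \<inter> B = D" "C \<union> D \<subseteq> A \<union> B" using disj by auto
  then have "fun_product A B \<phi> \<psi> (C \<union> D) \<noteq> 0" using CD by (simp add: fun_product_def)
  then show ?thesis by auto
qed

end

text \<open>The product of the functions \<open>dirac {x} - dirac {y}\<close> over \<open>i\<close> disjoint pairs of points,
  built up one pair at a time.\<close>

lemma Sspace_nonzero:
  assumes "finite X" "2 * i \<le> card X"
  shows "\<exists>\<phi>\<in>Sspace X i. \<phi> \<noteq> 0"
  using assms
proof (induction i arbitrary: X)
  case 0
  have "dirac {} \<in> Sspace X 0"
    unfolding Sspace_eq[OF 0(1)] by (auto simp: subsets_of_def level_def dirac_def lower_def fun_eq_iff)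
  moreover have "dirac {} \<noteq> 0" by (auto simp: dirac_def fun_eq_iff)
  ultimately show ?case by blast
next
  case (Suc i)
  obtain P where P: "P \<subseteq> X" "card P = 2" using obtain_subset_with_card_n[of 2 X] Suc.prems by auto
  then obtain x y where xy: "P = {x, y}" "x \<noteq> y" by (auto simp: card_2_iff)
  define Y where "Y = X - P"
  have finY: "finite Y" "finite P" and X: "X = Y \<union> P" "Y \<inter> P = {}" using Suc.prems P xy by (auto simp: Y_def)
  have "card Y = card X - 2" using P finY by (simp add: Y_def card_Diff_subset)
  then have "2 * i \<le> card Y" using Suc.prems by simp
  then obtain \<phi> where \<phi>: "\<phi> \<in> Sspace Y i" "\<phi> \<noteq> 0" using Suc.IH[OF finY(1)] by blast
  define \<psi> where "\<psi> = dirac {x} - dirac {y}"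
  have \<psi>S: "\<psi> \<in> Sspace P 1"
  proof -
    have "lower P \<psi> E = 0" for E
    proof (cases "E = {}")
      case True
      then show ?thesis using xy by (auto simp: lower_def \<psi>_def dirac_def)
    next
      case False
      have "\<psi> (insert z E) = 0" if "z \<in> P - E" for z
        using that False by (auto simp: \<psi>_def dirac_def)
      then show ?thesis by (simp add: lower_def)
    qed
    then show ?thesis unfolding Sspace_eq[OF finY(2)] using xy
      by (auto simp: subsets_of_def level_def \<psi>_def dirac_def fun_eq_iff split: if_splits)
  qed
  have "\<psi> {x} \<noteq> 0" using xy by (simp add: \<psi>_def dirac_def)
  then have \<psi>0: "\<psi> \<noteq> 0" by auto
  interpret two_parts Y P using finY X by unfold_locales
  let ?f = "fun_product Y P \<phi> \<psi>"
  have f: "?f \<in> bispecht Y P i 1" by (rule fun_product_bispecht[OF \<phi>(1) \<psi>S])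
  have "lower X ?f = 0"
    using f unfolding X(1) lower_Un[OF finY X(2)] by (simp add: bispecht_def)
  moreover have "?f \<in> level X (Suc i)"
    using level_Un[of ?f i 1] f unfolding X(1) by (simp add: bispecht_def)
  ultimately have "?f \<in> Sspace X (Suc i)"
    unfolding Sspace_eq[OF Suc.prems(1)] using f X(1) by (simp add: bispecht_def)
  moreover have "?f \<noteq> 0"
    using fun_product_nonzero \<phi> \<psi>S \<psi>0 unfolding Sspace_eq[OF finY(1)] Sspace_eq[OF finY(2)] by blast
  ultimately show ?case by blast
qed

context two_parts
begin

lemma bispecht_nonzero:
  assumes "2 * i \<le> card A" "2 * j \<le> card B"
  shows "bispecht A B i j \<noteq> {0}"
proof -
  obtain \<phi> \<psi> where "\<phi> \<in> Sspace A i" "\<phi> \<noteq> 0" "\<psi> \<in> Sspace B j" "\<psi> \<noteq> 0"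
    using Sspace_nonzero[OF finA assms(1)] Sspace_nonzero[OF finB assms(2)] by blast
  then have "fun_product A B \<phi> \<psi> \<in> bispecht A B i j" "fun_product A B \<phi> \<psi> \<noteq> 0"
    using fun_product_bispecht fun_product_nonzero by (auto simp: Sspace_eq finA finB)
  then show ?thesis by blast
qed

lemma perm_act_Sspace:
  assumes "\<pi> \<in> part_group A B" "\<phi> \<in> Sspace A i"
  shows "perm_act \<pi> \<phi> \<in> Sspace A i"
  using assms(2) part_groupD[OF assms(1)] part_group_vimage[OF assms(1)]
  unfolding Sspace_eq[OF finA]
  by (simp add: perm_act_level perm_act_subsets_of lower_perm_act linear_on_UNIV_zero[OF linear_perm_act])

text \<open>\<open>S_tensor A i B j\<close> is a nonzero subrepresentation of the irreducible \<open>bispecht A B i j\<close>.\<close>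

lemma S_tensor_eq_bispecht:
  assumes "2 * i \<le> card A" "2 * j \<le> card B"
  shows "S_tensor A i B j = bispecht A B i j"
proof -
  let ?gens = "{tensor A i B j \<phi> \<psi> | \<phi> \<psi>. \<phi> \<in> Sspace A i \<and> \<psi> \<in> Sspace B j}"
  have tens: "tensor A i B j \<phi> \<psi> = fun_product A B \<phi> \<psi>" if "\<phi> \<in> Sspace A i" "\<psi> \<in> Sspace B j" for \<phi> \<psi>
    using tensor_eq_fun_product that by (simp add: Sspace_eq finA finB)
  have K: "subrep (part_group A B) perm_act (bispecht A B i j)" by (rule subrep_bispecht)
  have sub: "S_tensor A i B j \<subseteq> bispecht A B i j"
    unfolding S_tensor_def
    by (rule cfun.span_minimal) (use K tens fun_product_bispecht in \<open>auto simp: subrep_def\<close>)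
  have "subrep (part_group A B) perm_act (S_tensor A i B j)"
    unfolding subrep_def
  proof (intro conjI ballI)
    show "cfun.subspace (S_tensor A i B j)" unfolding S_tensor_def by (rule cfun.subspace_span)
    fix \<pi> v assume \<pi>: "\<pi> \<in> part_group A B" and v: "v \<in> S_tensor A i B j"
    have "cfun.subspace {v. perm_act \<pi> v \<in> S_tensor A i B j}"
      unfolding cfun.subspace_def S_tensor_def
      by (simp add: linear_on_UNIV_zero[OF linear_perm_act] linear_on_add[OF linear_perm_act]
          linear_on_fscale[OF linear_perm_act] cfun.span_zero cfun.span_add cfun.span_scale)
    moreover have "?gens \<subseteq> {v. perm_act \<pi> v \<in> S_tensor A i B j}"
    proof
      fix g assume "g \<in> ?gens"
      then obtain \<phi> \<psi> where g: "g = tensor A i B j \<phi> \<psi>" "\<phi> \<in> Sspace A i" "\<psi> \<in> Sspace B j" by blast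
      have "perm_act \<pi> g = tensor A i B j (perm_act \<pi> \<phi>) (perm_act \<pi> \<psi>)"
        unfolding g(1) using part_groupD[OF \<pi>] by (intro perm_act_tensor)
      moreover have "perm_act \<pi> \<phi> \<in> Sspace A i" "perm_act \<pi> \<psi> \<in> Sspace B j"
        using perm_act_Sspace[OF \<pi> g(2)] two_parts.perm_act_Sspace[OF swapped _ g(3), of \<pi>] \<pi>
        by (simp_all add: part_group_swapped)
      ultimately have "perm_act \<pi> g \<in> ?gens" by blast
      then show "g \<in> {v. perm_act \<pi> v \<in> S_tensor A i B j}"
        unfolding S_tensor_def by (simp add: cfun.span_base)
    qed
    ultimately have "S_tensor A i B j \<subseteq> {v. perm_act \<pi> v \<in> S_tensor A i B j}"
      unfolding S_tensor_def by (intro cfun.span_minimal)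
    then show "perm_act \<pi> v \<in> S_tensor A i B j" using v by blast
  qed
  moreover have "S_tensor A i B j \<noteq> {0}"
  proof -
    obtain \<phi> \<psi> where S: "\<phi> \<in> Sspace A i" "\<phi> \<noteq> 0" "\<psi> \<in> Sspace B j" "\<psi> \<noteq> 0"
      using Sspace_nonzero[OF finA assms(1)] Sspace_nonzero[OF finB assms(2)] by blast
    have "tensor A i B j \<phi> \<psi> \<in> S_tensor A i B j"
      unfolding S_tensor_def by (rule cfun.span_base) (use S in blast)
    moreover have "\<phi> \<in> subsets_of A" "\<psi> \<in> subsets_of B"
      using S by (auto simp: Sspace_eq finA finB)
    then have "tensor A i B j \<phi> \<psi> \<noteq> 0"
      unfolding tens[OF S(1,3)] using fun_product_nonzero S(2,4) by blast
    ultimately show ?thesis by blast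
  qed
  ultimately show ?thesis
    using irreducible_bispecht[OF bispecht_nonzero[OF assms]] sub unfolding irreducible_rep_def by blast
qed

end

section \<open>Embedding products of Specht modules\<close>

text \<open>For \<open>c = m\<close> the range of summation is the single value \<open>r = x\<close>, and two of the four
  rising factorials become signed factorials.\<close>

lemma hahn_E_top:
  assumes "x \<le> m"
  shows "hahn_E (int m) a b (int m) (int x)
    = (-1) ^ (m - x) * fact m * pochhammer (b - int m + 1) x * pochhammer (a - int m + 1) (m - x)"
proof -
  have set: "{max 0 (int x - int m + int m)..min (int m) (int x)} = {int x}" using assms by auto
  have p1: "pochhammer (- int x) x = (-1) ^ x * fact x" by (rule pochhammer_same)
  have p2: "pochhammer (int x - int m) (m - x) = (-1) ^ (m - x) * fact (m - x)"
    using pochhammer_same[of "m - x", where 'a = int] assms by (simp add: of_nat_diff)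
  have n: "nat (int m - int x) = m - x" by simp
  have "fact x * fact (m - x) * int (m choose x) = int (fact x * fact (m - x) * (m choose x))"
    by (simp only: of_nat_mult of_nat_fact)
  also have "\<dots> = fact m" by (simp only: binomial_fact_lemma[OF assms] of_nat_fact)
  finally have f: "fact x * fact (m - x) * int (m choose x) = fact m" .
  have s: "(-1 :: int) ^ x * (-1) ^ x = 1" by (simp flip: power_mult_distrib)
  have "hahn_E (int m) a b (int m) (int x)
    = ((-1) ^ x * (-1) ^ x) * (-1) ^ (m - x) * (fact x * fact (m - x) * int (m choose x))
      * pochhammer (b - int m + 1) x * pochhammer (a - int m + 1) (m - x)"
    unfolding hahn_E_def set by (simp add: n p1 p2)
  then show ?thesis unfolding s f by simp
qed

text \<open>This is the condition for the terms produced by \<open>lower A\<close> and \<open>lower B\<close> to cancel in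
  \<open>hahn_map_Sspace\<close>.\<close>

lemma hahn_E_top_recurrence:
  assumes "x < m"
  shows "hahn_E (int m) a b (int m) (int x) * (b - int m + int x + 1)
    + hahn_E (int m) a b (int m) (int (Suc x)) * (a - int x) = 0"
proof -
  obtain d where m: "m = Suc (x + d)" using assms less_iff_Suc_add by blast
  have "pochhammer (b - int m + 1) (Suc x) = pochhammer (b - int m + 1) x * (b - int m + int x + 1)"
    by (simp add: pochhammer_Suc)
  moreover have "pochhammer (a - int m + 1) (m - x) = pochhammer (a - int m + 1) (m - Suc x) * (a - int x)"
    unfolding m by (simp add: pochhammer_Suc)
  moreover have "(-1 :: int) ^ (m - x) = - ((-1) ^ (m - Suc x))" unfolding m by simp
  ultimately show ?thesis
    using hahn_E_top[of x m a b] hahn_E_top[of "Suc x" m a b] assms by (simp del: of_nat_Suc)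
qed

context two_parts
begin

definition raise_sum :: "nat \<Rightarrow> (nat \<Rightarrow> complex) \<Rightarrow> (nat set \<Rightarrow> complex) \<Rightarrow> (nat set \<Rightarrow> complex)"
  where "raise_sum m c f = (\<Sum>x<Suc m. fscale (c x) ((raise A ^^ (m - x)) ((raise B ^^ x) f)))"

lemma bispechtD:
  assumes "w \<in> bispecht A B i j"
  shows "w \<in> subsets_of (A \<union> B)" "w \<in> level A i" "w \<in> level B j" "lower A w = 0" "lower B w = 0"
  using assms by (auto simp: bispecht_def)

lemma raise_B_pow_primitive:
  assumes "w \<in> bispecht A B i j"
  shows "(raise B ^^ x) w \<in> level A i" "lower A ((raise B ^^ x) w) = 0"
proof -
  note w = bispechtD[OF assms]
  have "B \<inter> A = {}" using disj by auto
  then show "(raise B ^^ x) w \<in> level A i" by (rule raise_pow_level_disjoint[OF _ w(2)])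
  have "lower A ((raise B ^^ x) w) = (raise B ^^ x) (lower A w)"
    using funpow_commute[of "lower A" "raise B" 1 x w] lower_raise_disjoint[OF disj] by simp
  then show "lower A ((raise B ^^ x) w) = 0"
    unfolding w(4) linear_on_UNIV_zero[OF linear_on_pow[OF linear_raise]] .
qed

text \<open>Lowering in \<open>A\<close> the summand with index \<open>x\<close> and lowering in \<open>B\<close> the one with index \<open>Suc x\<close>
  give multiples of the same function, and the recurrence says that they cancel.\<close>

lemma lower_raise_sum:
  assumes w: "w \<in> bispecht A B i j"
    and rec: "\<And>x. x < m \<Longrightarrow>
      c x * (of_nat (m - x) * (of_nat (card A) - 2 * of_nat i - of_nat (m - Suc x)))
      + c (Suc x) * (of_nat (Suc x) * (of_nat (card B) - 2 * of_nat j - of_nat x)) = 0"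
  shows "lower (A \<union> B) (raise_sum m c w) = 0"
proof -
  let ?r = "\<lambda>x. (raise A ^^ (m - Suc x)) ((raise B ^^ x) w)"
  note W = bispechtD[OF w]
  have A: "lower A (raise_sum m c w)
    = (\<Sum>x<m. fscale (c x * (of_nat (m - x) * (of_nat (card A) - 2 * of_nat i - of_nat (m - Suc x)))) (?r x))"
  proof -
    have "lower A (raise_sum m c w)
        = (\<Sum>x<Suc m. fscale (c x) (lower A ((raise A ^^ (m - x)) ((raise B ^^ x) w))))"
      unfolding raise_sum_def by (simp only: linear_on_UNIV_sum[OF linear_lower] linear_on_fscale[OF linear_lower])
    also have "\<dots> = (\<Sum>x<m. fscale (c x) (lower A ((raise A ^^ (m - x)) ((raise B ^^ x) w))))"
      using raise_B_pow_primitive(2)[OF w, of m] by (simp add: fun_eq_iff)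
    also have "\<dots> = (\<Sum>x<m. fscale (c x * (of_nat (m - x) * (of_nat (card A) - 2 * of_nat i - of_nat (m - Suc x)))) (?r x))"
    proof (rule sum.cong)
      fix x assume "x \<in> {..<m}"
      then have mx: "m - x = Suc (m - Suc x)" by auto
      show "fscale (c x) (lower A ((raise A ^^ (m - x)) ((raise B ^^ x) w)))
        = fscale (c x * (of_nat (m - x) * (of_nat (card A) - 2 * of_nat i - of_nat (m - Suc x)))) (?r x)"
        unfolding mx lower_raise_pow[OF finA raise_B_pow_primitive[OF w]]
        by (simp only: fun_eq_iff fscale_apply mult.assoc simp_thms)
    qed simp
    finally show ?thesis .
  qed
  have B: "lower B (raise_sum m c w)
    = (\<Sum>x<m. fscale (c (Suc x) * (of_nat (Suc x) * (of_nat (card B) - 2 * of_nat j - of_nat x))) (?r x))"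
  proof -
    have disj': "B \<inter> A = {}" using disj by auto
    have comm: "lower B ((raise A ^^ p) f) = (raise A ^^ p) (lower B f)" for p f
      using funpow_commute[of "lower B" "raise A" 1 p f] lower_raise_disjoint[OF disj'] by simp
    have "lower B (raise_sum m c w)
        = (\<Sum>x<Suc m. fscale (c x) ((raise A ^^ (m - x)) (lower B ((raise B ^^ x) w))))"
      unfolding raise_sum_def
      by (simp only: linear_on_UNIV_sum[OF linear_lower] linear_on_fscale[OF linear_lower] comm)
    also have "\<dots> = (\<Sum>x<m. fscale (c (Suc x)) ((raise A ^^ (m - Suc x)) (lower B ((raise B ^^ Suc x) w))))"
    proof -
      have "fscale (c 0) ((raise A ^^ (m - 0)) (lower B ((raise B ^^ 0) w))) = 0"
        unfolding funpow_0 W(5) linear_on_UNIV_zero[OF linear_on_pow[OF linear_raise]]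
        by (simp add: fun_eq_iff)
      then show ?thesis unfolding sum.lessThan_Suc_shift by simp
    qed
    also have "\<dots> = (\<Sum>x<m. fscale (c (Suc x) * (of_nat (Suc x) * (of_nat (card B) - 2 * of_nat j - of_nat x))) (?r x))"
      unfolding lower_raise_pow[OF finB W(3,5)] linear_on_fscale[OF linear_on_pow[OF linear_raise]]
      by (intro sum.cong refl) (simp only: fun_eq_iff fscale_apply mult.assoc simp_thms)
    finally show ?thesis .
  qed
  have "lower (A \<union> B) (raise_sum m c w) Z = 0" for Z
    unfolding lower_Un[OF finA finB disj] A B sum.distrib[symmetric] sum_cfun_apply
  proof (rule sum.neutral, rule ballI)
    fix x assume "x \<in> {..<m}"
    from rec[of x] this
    have "(c x * (of_nat (m - x) * (of_nat (card A) - 2 * of_nat i - of_nat (m - Suc x)))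
      + c (Suc x) * (of_nat (Suc x) * (of_nat (card B) - 2 * of_nat j - of_nat x))) * ?r x Z = 0" by simp
    then show "(fscale (c x * (of_nat (m - x) * (of_nat (card A) - 2 * of_nat i - of_nat (m - Suc x)))) (?r x)
      + fscale (c (Suc x) * (of_nat (Suc x) * (of_nat (card B) - 2 * of_nat j - of_nat x))) (?r x)) Z = 0"
      by (simp only: plus_fun_apply fscale_apply distrib_right)
  qed
  then show ?thesis by (simp add: fun_eq_iff)
qed

text \<open>The summand with index \<open>x\<close> has been raised only \<open>m - x\<close> times in \<open>A\<close>, so \<open>m\<close> lowerings
  kill it unless \<open>x = 0\<close>.\<close>

lemma lower_pow_raise_sum:
  assumes w: "w \<in> bispecht A B i j"
  shows "(lower A ^^ m) (raise_sum m c w)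
    = fscale (c 0 * (\<Prod>r<m. of_nat (Suc r) * (of_nat (card A) - 2 * of_nat i - of_nat r))) w"
proof -
  note W = bispechtD[OF w]
  have "(lower A ^^ m) (raise_sum m c w)
      = (\<Sum>x<Suc m. fscale (c x) ((lower A ^^ m) ((raise A ^^ (m - x)) ((raise B ^^ x) w))))"
    unfolding raise_sum_def
    by (simp only: linear_on_UNIV_sum[OF linear_on_pow[OF linear_lower]]
        linear_on_fscale[OF linear_on_pow[OF linear_lower]])
  also have "\<dots> = fscale (c 0) ((lower A ^^ m) ((raise A ^^ m) w))"
  proof -
    have "(lower A ^^ m) ((raise A ^^ (m - Suc x)) ((raise B ^^ Suc x) w)) = 0" if "x < m" for x
      by (rule lower_pow_raise_pow_zero[OF finA raise_B_pow_primitive[OF w]]) (use that in simp)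
    then have "(\<Sum>x<m. fscale (c (Suc x)) ((lower A ^^ m) ((raise A ^^ (m - Suc x)) ((raise B ^^ Suc x) w)))) = 0"
      by (intro sum.neutral) (simp add: fun_eq_iff)
    then show ?thesis unfolding sum.lessThan_Suc_shift by simp
  qed
  also have "\<dots> = fscale (c 0 * (\<Prod>r<m. of_nat (Suc r) * (of_nat (card A) - 2 * of_nat i - of_nat r))) w"
    unfolding lower_pow_raise_pow[OF finA W(2,4)] by (simp only: fun_eq_iff fscale_apply mult.assoc simp_thms)
  finally show ?thesis .
qed

lemma linear_raise_sum: "linear_on UNIV (raise_sum m c)"
  unfolding linear_on_def raise_sum_def
  by (simp add: linear_on_add[OF linear_on_pow[OF linear_raise]]
      linear_on_fscale[OF linear_on_pow[OF linear_raise]] fun_eq_iff sum_cfun_apply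
      algebra_simps sum.distrib sum_distrib_left)

lemma raise_sum_perm_act:
  assumes "\<pi> \<in> part_group A B"
  shows "raise_sum m c (perm_act \<pi> f) = perm_act \<pi> (raise_sum m c f)"
proof -
  note D = part_groupD[OF assms]
  have "(raise A ^^ q) (perm_act \<pi> f) = perm_act \<pi> ((raise A ^^ q) f)" for q f
    using funpow_commute[of "perm_act \<pi>" "raise A" 1 q f] raise_perm_act[OF D(2,3)] by simp
  moreover have "(raise B ^^ q) (perm_act \<pi> f) = perm_act \<pi> ((raise B ^^ q) f)" for q f
    using funpow_commute[of "perm_act \<pi>" "raise B" 1 q f] raise_perm_act[OF D(2,4)] by simp
  ultimately show ?thesis
    unfolding raise_sum_def
    by (simp only: linear_on_UNIV_sum[OF linear_perm_act] linear_on_fscale[OF linear_perm_act])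
qed

lemma raise_sum_level:
  assumes w: "w \<in> bispecht A B i j"
  shows "raise_sum m c w \<in> subsets_of (A \<union> B) \<inter> level (A \<union> B) (i + j + m)"
proof -
  note W = bispechtD[OF w]
  have disj': "B \<inter> A = {}" using disj by auto
  have S: "cfun.subspace (subsets_of (A \<union> B) \<inter> level (A \<union> B) (i + j + m))"
    by (intro cfun.subspace_inter subspace_subsets_of subspace_level)
  show ?thesis
    unfolding raise_sum_def
  proof (intro cfun.subspace_sum[OF S] cfun.subspace_scale[OF S] IntI)
    fix x assume x: "x \<in> {..<Suc m}"
    show "(raise A ^^ (m - x)) ((raise B ^^ x) w) \<in> subsets_of (A \<union> B)"
      by (intro raise_pow_subsets_of W) auto
    have "(raise A ^^ (m - x)) ((raise B ^^ x) w) \<in> level (A \<union> B) ((i + (m - x)) + (j + x))"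
      by (intro level_Un raise_pow_level[OF finA] raise_pow_level_disjoint[OF disj]
          raise_pow_level[OF finB] raise_pow_level_disjoint[OF disj'] W)
    moreover have "(i + (m - x)) + (j + x) = i + j + m" using x by auto
    ultimately show "(raise A ^^ (m - x)) ((raise B ^^ x) w) \<in> level (A \<union> B) (i + j + m)" by (simp only:)
  qed
qed

text \<open>The branching conditions in terms of strings: \<open>k - i - j\<close> points have to be added, which
  is possible inside a single part only up to the length \<open>card A - 2 * i\<close> or \<open>card B - 2 * j\<close>
  of the string of that part. The subtractions are exact by the conditions before them.\<close>

definition branch_set :: "nat \<Rightarrow> (nat \<times> nat) set"
  where "branch_set k = {(i, j). 2 * i \<le> card A \<and> 2 * j \<le> card B \<and> i + j \<le> k
    \<and> k - i - j \<le> card A - 2 * i \<and> k - i - j \<le> card B - 2 * j}"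

text \<open>The map of the statement, extended to all functions. The factorials turn powers of
  \<open>raise\<close> into the maps \<open>R_map\<close>.\<close>

definition hahn_map :: "nat \<Rightarrow> nat \<times> nat \<Rightarrow> (nat set \<Rightarrow> complex) \<Rightarrow> (nat set \<Rightarrow> complex)"
  where "hahn_map k = (\<lambda>(i, j). raise_sum (k - i - j) (\<lambda>x.
    of_int (hahn_E (int (k - i - j)) (int (card B) - 2 * int j) (int (card A) - 2 * int i)
      (int (k - i - j)) (int x)) / (fact (k - i - j - x) * fact x)))"

lemma linear_hahn_map: "linear_on UNIV (hahn_map k p)"
  by (simp add: hahn_map_def split: prod.split) (intro allI impI linear_raise_sum)

lemma hahn_map_perm_act:
  "\<pi> \<in> part_group A B \<Longrightarrow> hahn_map k p (perm_act \<pi> f) = perm_act \<pi> (hahn_map k p f)"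
  by (simp add: hahn_map_def raise_sum_perm_act split: prod.split)

lemma hahn_map_Sspace:
  assumes p: "(i, j) \<in> branch_set k" and w: "w \<in> bispecht A B i j"
  shows "hahn_map k (i, j) w \<in> Sspace (A \<union> B) k"
proof -
  define m where "m = k - i - j"
  define E where "E x = hahn_E (int m) (int (card B) - 2 * int j) (int (card A) - 2 * int i) (int m) (int x)" for x
  let ?c = "\<lambda>x. of_int (E x) / (fact (m - x) * fact x) :: complex"
  have T: "hahn_map k (i, j) w = raise_sum m ?c w" by (simp add: hahn_map_def m_def E_def)
  have k: "i + j + m = k" using p by (auto simp: branch_set_def m_def)
  have "lower (A \<union> B) (raise_sum m ?c w) = 0"
  proof (rule lower_raise_sum[OF w])
    fix x assume x: "x < m"
    have mx: "m - x = Suc (m - Suc x)" using x by simp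
    have i1: "int (card A) - 2 * int i - int (m - Suc x) = int (card A) - 2 * int i - int m + int x + 1"
      using x by (simp add: of_nat_diff)
    have "E x * (int (card A) - 2 * int i - int (m - Suc x)) + E (Suc x) * (int (card B) - 2 * int j - int x) = 0"
      unfolding i1 E_def using hahn_E_top_recurrence[OF x] by simp
    then have "of_int (E x * (int (card A) - 2 * int i - int (m - Suc x))
        + E (Suc x) * (int (card B) - 2 * int j - int x)) = (0 :: complex)" by (simp only: of_int_0)
    then have rec: "of_int (E x) * (of_nat (card A) - 2 * of_nat i - of_nat (m - Suc x))
        + of_int (E (Suc x)) * (of_nat (card B) - 2 * of_nat j - of_nat x) = (0 :: complex)"
      by (simp only: of_int_add of_int_mult of_int_diff of_int_of_nat_eq of_int_numeral)
    let ?d = "fact (m - Suc x) * fact x :: complex"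
    have 1: "?c x * of_nat (m - x) = of_int (E x) / ?d"
      unfolding mx by (simp add: field_simps del: of_nat_Suc)
    have 2: "?c (Suc x) * of_nat (Suc x) = of_int (E (Suc x)) / ?d"
      by (simp add: field_simps del: of_nat_Suc)
    have "?c x * (of_nat (m - x) * (of_nat (card A) - 2 * of_nat i - of_nat (m - Suc x)))
      + ?c (Suc x) * (of_nat (Suc x) * (of_nat (card B) - 2 * of_nat j - of_nat x))
      = (of_int (E x) * (of_nat (card A) - 2 * of_nat i - of_nat (m - Suc x))
        + of_int (E (Suc x)) * (of_nat (card B) - 2 * of_nat j - of_nat x)) / ?d"
      unfolding mult.assoc[symmetric] 1 2 by (simp add: add_divide_distrib)
    then show "?c x * (of_nat (m - x) * (of_nat (card A) - 2 * of_nat i - of_nat (m - Suc x)))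
      + ?c (Suc x) * (of_nat (Suc x) * (of_nat (card B) - 2 * of_nat j - of_nat x)) = 0"
      unfolding rec by simp
  qed
  then show ?thesis
    using raise_sum_level[OF w, of m ?c] finA finB unfolding T k by (simp add: Sspace_eq)
qed

text \<open>The leading coefficient and the factors of the string action are nonzero because
  \<open>k - i - j\<close> does not exceed the two string lengths.\<close>

lemma lower_pow_hahn_map:
  assumes p: "(i, j) \<in> branch_set k"
  obtains c where "c \<noteq> 0" "\<And>w. w \<in> bispecht A B i j \<Longrightarrow> (lower A ^^ (k - i - j)) (hahn_map k (i, j) w) = fscale c w"
proof -
  define m where "m = k - i - j"
  let ?E = "hahn_E (int m) (int (card B) - 2 * int j) (int (card A) - 2 * int i) (int m) (int 0)"
  let ?c = "of_int ?E / (fact (m - 0) * fact 0) * (\<Prod>r<m. of_nat (Suc r) * (of_nat (card A) - 2 * of_nat i - of_nat r)) :: complex"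
  have "pochhammer (int (card B) - 2 * int j - int m + 1) m > 0"
    by (rule pochhammer_pos) (use p in \<open>auto simp: branch_set_def m_def\<close>)
  then have "?E \<noteq> 0" unfolding hahn_E_top[OF le0] by simp
  moreover have "of_nat (card A) - 2 * of_nat i - of_nat r \<noteq> (0 :: complex)" if "r < m" for r
  proof -
    have "int (card A) - 2 * int i - int r \<noteq> 0" using p that by (auto simp: branch_set_def m_def)
    then have "of_int (int (card A) - 2 * int i - int r) \<noteq> (0 :: complex)" by (simp only: of_int_eq_0_iff simp_thms)
    then show ?thesis by (simp only: of_int_diff of_int_mult of_int_of_nat_eq of_int_numeral simp_thms)
  qed
  ultimately have "?c \<noteq> 0" by (simp del: of_nat_Suc)
  moreover have "(lower A ^^ (k - i - j)) (hahn_map k (i, j) w) = fscale ?c w" if "w \<in> bispecht A B i j" for w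
    unfolding hahn_map_def prod.case m_def[symmetric] by (rule lower_pow_raise_sum[OF that])
  ultimately show ?thesis by (rule that)
qed

end

section \<open>The branching rule\<close>

lemma subspace_dsum:
  assumes "\<And>p. p \<in> I \<Longrightarrow> cfun.subspace (W p)"
  shows "cfun.subspace (dsum I W)"
  unfolding cfun.subspace_def
proof (intro conjI ballI allI)
  have "(\<lambda>x. 0 :: complex) \<in> W p" if "p \<in> I" for p
    using cfun.subspace_0[OF assms[OF that]] by (simp add: zero_fun_def)
  then show "0 \<in> dsum I W" by (simp add: dsum_def)
next
  fix F G assume FG: "F \<in> dsum I W" "G \<in> dsum I W"
  have "(\<lambda>x. F (p, x) + G (p, x)) \<in> W p" if "p \<in> I" for p
    using cfun.subspace_add[OF assms[OF that], of "\<lambda>x. F (p, x)" "\<lambda>x. G (p, x)"] FG that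
    by (simp add: dsum_def plus_fun_def)
  then show "F + G \<in> dsum I W" using FG by (simp add: dsum_def)
next
  fix c F assume F: "F \<in> dsum I W"
  have "(\<lambda>x. c * F (p, x)) \<in> W p" if "p \<in> I" for p
    using cfun.subspace_scale[OF assms[OF that], of "\<lambda>x. F (p, x)" c] F that
    by (simp add: dsum_def fscale_def)
  then show "fscale c F \<in> dsum I W" using F by (simp add: dsum_def)
qed

lemma subrep_dsum:
  assumes W: "\<And>p. p \<in> I \<Longrightarrow> subrep G \<rho> (W p)"
    and lin: "\<And>g. g \<in> G \<Longrightarrow> linear_on UNIV (\<rho> g)"
  shows "subrep G (dsum_act \<rho>) (dsum I W)"
  unfolding subrep_def
proof (intro conjI ballI)
  show "cfun.subspace (dsum I W)" by (rule subspace_dsum) (use W in \<open>simp add: subrep_def\<close>)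
  fix g F assume g: "g \<in> G" and F: "F \<in> dsum I W"
  have "\<rho> g (\<lambda>y. F (p, y)) \<in> W p" if "p \<in> I" for p
    using W[OF that] g F that by (simp add: subrep_def dsum_def)
  moreover have "\<rho> g (\<lambda>y. F (p, y)) = 0" if "p \<notin> I" for p
  proof -
    have "(\<lambda>y. F (p, y)) = 0" using F that by (simp add: dsum_def fun_eq_iff)
    then show ?thesis using linear_on_UNIV_zero[OF lin[OF g]] by simp
  qed
  ultimately show "dsum_act \<rho> g F \<in> dsum I W" by (simp add: dsum_def dsum_act_def)
qed

definition restrict_level :: "nat set \<Rightarrow> nat \<Rightarrow> (nat set \<Rightarrow> complex) \<Rightarrow> (nat set \<Rightarrow> complex)"
  where "restrict_level X j f = (\<lambda>Z. if card (Z \<inter> X) = j then f Z else 0)"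

lemma restrict_level_in_level: "restrict_level X j f \<in> level X j"
  by (simp add: restrict_level_def level_def)

lemma lower_restrict_level_disjoint:
  assumes "A \<inter> B = {}"
  shows "lower A (restrict_level B j f) = restrict_level B j (lower A f)"
proof
  fix E
  have "insert y E \<inter> B = E \<inter> B" if "y \<in> A" for y using assms that by auto
  then show "lower A (restrict_level B j f) E = restrict_level B j (lower A f) E"
    by (simp add: lower_def restrict_level_def)
qed

lemma lower_restrict_level:
  assumes "finite B" "lower B f = 0"
  shows "lower B (restrict_level B j f) = 0"
proof -
  have "lower B (restrict_level B j f) E = (if Suc (card (E \<inter> B)) = j then lower B f E else 0)" for E
  proof -
    have "card (insert y E \<inter> B) = Suc (card (E \<inter> B))" if "y \<in> B - E" for y
    proof -
      have "insert y E \<inter> B = insert y (E \<inter> B)" "y \<notin> E \<inter> B" using that by auto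
      then show ?thesis using assms(1) by simp
    qed
    then show ?thesis by (simp add: lower_def restrict_level_def)
  qed
  then show ?thesis by (simp add: assms(2) fun_eq_iff)
qed

context two_parts
begin

lemma lower_pow_level_Un:
  assumes f: "f \<in> level (A \<union> B) k" and nz: "(lower A ^^ m) f Z \<noteq> 0"
  shows "card (Z \<inter> A) + card (Z \<inter> B) + m = k"
  using nz
proof (induction m arbitrary: Z)
  case 0
  then show ?case using f by (auto simp: level_def card_Int_Un)
next
  case (Suc m)
  from Suc.prems have "lower A ((lower A ^^ m) f) Z \<noteq> 0" by simp
  then obtain y where y: "y \<in> A - Z" "(lower A ^^ m) f (insert y Z) \<noteq> 0" by (rule lower_nonzeroE)
  have "insert y Z \<inter> A = insert y (Z \<inter> A)" "insert y Z \<inter> B = Z \<inter> B" "y \<notin> Z \<inter> A"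
    using y(1) disj by auto
  then show ?case using Suc.IH[OF y(2)] finA by simp
qed

text \<open>Since \<open>lower B f = - lower A f\<close>, the function \<open>g\<close> is also killed by \<open>lower B\<close>, and it
  equals the \<open>m\<close>-fold lowering of \<open>f\<close> in \<open>B\<close> up to sign. Outside the branching range the string
  of \<open>(i, j)\<close> in \<open>A\<close> or in \<open>B\<close> is shorter than \<open>m\<close>, or the level is above the middle, so
  \<open>lower_pow_image_primitive\<close> applies to that part.\<close>

lemma lower_pow_part_bispecht:
  assumes f: "f \<in> Sspace (A \<union> B) k" and g: "g = (lower A ^^ m) f" "lower A g = 0"
    and ij: "i + j + m = k"
  shows "restrict_level B j g \<in> bispecht A B i j"
    and "(i, j) \<notin> branch_set k \<Longrightarrow> restrict_level B j g = 0"
proof -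
  let ?Y = "A \<union> B"
  have f': "f \<in> subsets_of ?Y" "f \<in> level ?Y k" "lower ?Y f = 0"
    using f finA finB by (auto simp: Sspace_eq)
  have disj': "B \<inter> A = {}" using disj by auto
  have lAB: "lower A f + lower B f = 0" using f'(3) lower_Un[OF finA finB disj] by simp
  have comm: "lower B ((lower A ^^ q) h) = (lower A ^^ q) (lower B h)" for q h
    using funpow_commute[of "lower B" "lower A" 1 q h] lower_lower_disjoint[OF disj'] by simp
  have gB: "lower B g = 0"
  proof -
    have "lower A g + lower B g = (lower A ^^ m) (lower A f + lower B f)"
      unfolding g(1) comm linear_on_add[OF linear_on_pow[OF linear_lower]]
      by (simp add: funpow_swap1)
    then show ?thesis
      unfolding lAB g(2) linear_on_UNIV_zero[OF linear_on_pow[OF linear_lower]] by simp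
  qed
  have gY: "g \<in> subsets_of ?Y" unfolding g(1) by (rule lower_pow_subsets_of[OF f'(1)])
  have gl: "card (Z \<inter> A) + card (Z \<inter> B) + m = k" if "g Z \<noteq> 0" for Z
    using lower_pow_level_Un[OF f'(2)] that unfolding g(1) .
  let ?w = "restrict_level B j g"
  have "card (Z \<inter> A) = i" if "?w Z \<noteq> 0" for Z
    using gl[of Z] that ij by (simp add: restrict_level_def split: if_splits)
  then have wA: "?w \<in> level A i" by (simp add: level_def)
  have wY: "?w \<in> subsets_of ?Y" using gY by (auto simp: subsets_of_def restrict_level_def)
  have "lower A ?w = 0"
    unfolding lower_restrict_level_disjoint[OF disj] g(2) by (simp add: restrict_level_def fun_eq_iff)
  then show w: "?w \<in> bispecht A B i j"
    using wA wY lower_restrict_level[OF finB gB] by (simp add: bispecht_def restrict_level_in_level)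
  note w' = bispechtD[OF w]
  assume "(i, j) \<notin> branch_set k"
  then consider "2 * i \<le> card A \<Longrightarrow> card A - 2 * i < m" | "2 * j \<le> card B \<Longrightarrow> card B - 2 * j < m"
    unfolding branch_set_def using ij by fastforce
  then show "?w = 0"
  proof cases
    case 1
    have "(lower A ^^ q) (restrict_level B j f) = restrict_level B j ((lower A ^^ q) f)" for q
      by (induction q) (simp_all add: lower_restrict_level_disjoint[OF disj])
    then have "(lower A ^^ m) (restrict_level B j f) = ?w" by (simp add: g(1))
    from lower_pow_image_primitive[OF _ _ this w'(1,2,4) 1] show ?thesis using finA finB by simp
  next
    case 2
    have "(lower B ^^ q) (restrict_level A i f) = restrict_level A i ((lower B ^^ q) f)" for q
      by (induction q) (simp_all add: lower_restrict_level_disjoint[OF disj'])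
    moreover have "(lower B ^^ q) f = fscale ((-1) ^ q) ((lower A ^^ q) f)" for q
    proof (induction q)
      case (Suc q)
      have B: "lower B f = fscale (-1) (lower A f)"
        using lAB by (simp add: fun_eq_iff add_eq_0_iff)
      have "(lower B ^^ Suc q) f = fscale ((-1) ^ q) (lower B ((lower A ^^ q) f))"
        unfolding funpow.simps comp_apply Suc by (rule linear_on_fscale[OF linear_lower])
      also have "lower B ((lower A ^^ q) f) = fscale (-1) ((lower A ^^ Suc q) f)"
        unfolding comm B linear_on_fscale[OF linear_on_pow[OF linear_lower]] by (simp add: funpow_swap1)
      finally show ?case by (simp add: fun_eq_iff)
    qed (simp add: fun_eq_iff)
    ultimately have "(lower B ^^ m) (restrict_level A i f) = restrict_level A i (fscale ((-1) ^ m) g)"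
      by (simp add: g(1))
    also have "\<dots> = fscale ((-1) ^ m) ?w"
    proof
      fix Z
      show "restrict_level A i (fscale ((-1) ^ m) g) Z = fscale ((-1) ^ m) ?w Z"
        using gl[of Z] ij by (cases "g Z = 0") (auto simp: restrict_level_def)
    qed
    finally have "(lower B ^^ m) (fscale ((-1) ^ m) (restrict_level A i f)) = fscale ((-1) ^ m) (fscale ((-1) ^ m) ?w)"
      by (simp only: linear_on_fscale[OF linear_on_pow[OF linear_lower]])
    also have "\<dots> = ?w" by (simp add: fun_eq_iff flip: mult.assoc power_mult_distrib)
    finally have "(lower B ^^ m) (fscale ((-1) ^ m) (restrict_level A i f)) = ?w" .
    from lower_pow_image_primitive[OF _ _ this w'(1,3,5) 2] show ?thesis using finA finB by simp
  qed
qed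

lemma finite_branch_set: "finite (branch_set k)"
  by (rule finite_subset[of _ "{..k} \<times> {..k}"]) (auto simp: branch_set_def)

definition hahn_sum :: "nat \<Rightarrow> ((nat \<times> nat) \<times> nat set \<Rightarrow> complex) \<Rightarrow> (nat set \<Rightarrow> complex)"
  where "hahn_sum k F = (\<Sum>p\<in>branch_set k. hahn_map k p (\<lambda>x. F (p, x)))"

abbreviation bispecht_family :: "nat \<times> nat \<Rightarrow> (nat set \<Rightarrow> complex) set"
  where "bispecht_family \<equiv> (\<lambda>(i, j). bispecht A B i j)"

lemma subspace_dsum_bispecht: "cfun.subspace (dsum I bispecht_family)"
  by (rule subspace_dsum) (use subrep_bispecht in \<open>auto simp: subrep_def\<close>)

lemma linear_hahn_sum: "linear_on V (hahn_sum k)"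
proof -
  have "hahn_sum k (F + G) = hahn_sum k F + hahn_sum k G" for F G
  proof -
    have "(\<lambda>x. (F + G) (p, x)) = (\<lambda>x. F (p, x)) + (\<lambda>x. G (p, x))" for p by (simp add: fun_eq_iff)
    then show ?thesis unfolding hahn_sum_def
      by (simp only: linear_on_add[OF linear_hahn_map] sum.distrib)
  qed
  moreover have "hahn_sum k (fscale c F) = fscale c (hahn_sum k F)" for c F
  proof -
    have "(\<lambda>x. fscale c F (p, x)) = fscale c (\<lambda>x. F (p, x))" for p by (simp add: fun_eq_iff)
    then show ?thesis unfolding hahn_sum_def
      by (simp only: linear_on_fscale[OF linear_hahn_map] cfun.scale_sum_right)
  qed
  ultimately show ?thesis unfolding linear_on_def by blast
qed

lemma hahn_sum_equivariant:
  "equivariant_on (part_group A B) (dsum_act perm_act) V perm_act (hahn_sum k)"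
  unfolding equivariant_on_def
proof (intro ballI)
  fix \<pi> and F :: "(nat \<times> nat) \<times> nat set \<Rightarrow> complex"
  assume \<pi>: "\<pi> \<in> part_group A B"
  have "(\<lambda>x. dsum_act perm_act \<pi> F (p, x)) = perm_act \<pi> (\<lambda>x. F (p, x))" for p
    by (simp add: dsum_act_def)
  then show "hahn_sum k (dsum_act perm_act \<pi> F) = perm_act \<pi> (hahn_sum k F)"
    unfolding hahn_sum_def
    by (simp only: hahn_map_perm_act[OF \<pi>] linear_on_UNIV_sum[OF linear_perm_act])
qed

lemma dsum_component:
  assumes "F \<in> dsum (branch_set k) bispecht_family" "(i, j) \<in> branch_set k"
  shows "(\<lambda>x. F ((i, j), x)) \<in> bispecht A B i j"
  using assms unfolding dsum_def by blast

lemma subspace_Sspace: "cfun.subspace (Sspace (A \<union> B) k)"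
proof -
  have "cfun.subspace {f. lower X f = 0}" for X
    unfolding cfun.subspace_def
    by (simp add: linear_on_UNIV_zero[OF linear_lower] linear_on_add[OF linear_lower]
        linear_on_fscale[OF linear_lower])
  moreover have "Sspace (A \<union> B) k = subsets_of (A \<union> B) \<inter> level (A \<union> B) k \<inter> {f. lower (A \<union> B) f = 0}"
    using finA finB by (auto simp: Sspace_eq)
  ultimately show ?thesis by (simp add: cfun.subspace_inter subspace_level subspace_subsets_of)
qed

lemma hahn_sum_Sspace:
  assumes F: "F \<in> dsum (branch_set k) bispecht_family"
  shows "hahn_sum k F \<in> Sspace (A \<union> B) k"
  unfolding hahn_sum_def
proof (rule cfun.subspace_sum[OF subspace_Sspace])
  fix p assume "p \<in> branch_set k"
  then show "hahn_map k p (\<lambda>x. F (p, x)) \<in> Sspace (A \<union> B) k"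
    using hahn_map_Sspace dsum_component[OF F] by (cases p) blast
qed

lemma lower_pow_hahn_map_le:
  obtains c where "\<And>p. p \<in> branch_set k \<Longrightarrow> c p \<noteq> (0::complex)"
    and "\<And>i j w m. (i, j) \<in> branch_set k \<Longrightarrow> w \<in> bispecht A B i j \<Longrightarrow> k - i - j \<le> m \<Longrightarrow>
      (lower A ^^ m) (hahn_map k (i, j) w) = (if m = k - i - j then fscale (c (i, j)) w else 0)"
proof -
  have "\<exists>c. \<forall>p\<in>branch_set k. c p \<noteq> (0::complex) \<and> (\<forall>w\<in>bispecht_family p.
      (lower A ^^ (k - fst p - snd p)) (hahn_map k p w) = fscale (c p) w)"
  proof (rule bchoice, rule ballI)
    fix p assume p: "p \<in> branch_set k"
    obtain i j where ij: "p = (i, j)" by (cases p)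
    obtain c where "c \<noteq> 0" "\<And>w. w \<in> bispecht A B i j \<Longrightarrow> (lower A ^^ (k - i - j)) (hahn_map k (i, j) w) = fscale c w"
      using lower_pow_hahn_map[OF p[unfolded ij]] by metis
    then show "\<exists>c. c \<noteq> 0 \<and> (\<forall>w\<in>bispecht_family p. (lower A ^^ (k - fst p - snd p)) (hahn_map k p w) = fscale c w)"
      unfolding ij by auto
  qed
  then obtain c where c: "\<And>p. p \<in> branch_set k \<Longrightarrow> c p \<noteq> (0::complex)"
    "\<And>p w. p \<in> branch_set k \<Longrightarrow> w \<in> bispecht_family p \<Longrightarrow>
      (lower A ^^ (k - fst p - snd p)) (hahn_map k p w) = fscale (c p) w" by blast
  show ?thesis
  proof (rule that[of c, OF c(1)])
    fix i j w m
    assume p: "(i, j) \<in> branch_set k" and w: "w \<in> bispecht A B i j" and m: "k - i - j \<le> m"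
    have eq: "(lower A ^^ (k - i - j)) (hahn_map k (i, j) w) = fscale (c (i, j)) w"
      using c(2)[OF p] w by simp
    show "(lower A ^^ m) (hahn_map k (i, j) w) = (if m = k - i - j then fscale (c (i, j)) w else 0)"
    proof (cases "m = k - i - j")
      case True
      then show ?thesis using eq by simp
    next
      case False
      then have "m = (m - Suc (k - i - j)) + Suc (k - i - j)" using m by simp
      then obtain d where d: "m = d + Suc (k - i - j)" ..
      have "(lower A ^^ m) (hahn_map k (i, j) w) = (lower A ^^ d) (lower A ((lower A ^^ (k - i - j)) (hahn_map k (i, j) w)))"
        unfolding d by (simp only: funpow_add comp_apply funpow.simps)
      also have "\<dots> = (lower A ^^ d) 0"
        unfolding eq linear_on_fscale[OF linear_lower] bispechtD(4)[OF w] by simp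
      also have "\<dots> = 0" by (rule linear_on_UNIV_zero[OF linear_on_pow[OF linear_lower]])
      finally show ?thesis using False by simp
    qed
  qed
qed

lemma bispecht_apply_eq_0:
  assumes "w \<in> bispecht A B i j" "(card (Z \<inter> A), card (Z \<inter> B)) \<noteq> (i, j)"
  shows "w Z = 0"
  using bispechtD(2,3)[OF assms(1)] assms(2) unfolding level_def by blast

text \<open>Lower \<open>m\<close> times in \<open>A\<close>, where \<open>m\<close> is the largest value of \<open>k - i - j\<close> among the nonzero
  components. Exactly the components with this value survive, as nonzero multiples of
  themselves, and they have disjoint supports.\<close>

lemma inj_on_hahn_sum: "inj_on (hahn_sum k) (dsum (branch_set k) bispecht_family)"
proof -
  obtain c where c: "\<And>p. p \<in> branch_set k \<Longrightarrow> c p \<noteq> (0::complex)"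
    "\<And>i j w m. (i, j) \<in> branch_set k \<Longrightarrow> w \<in> bispecht A B i j \<Longrightarrow> k - i - j \<le> m \<Longrightarrow>
      (lower A ^^ m) (hahn_map k (i, j) w) = (if m = k - i - j then fscale (c (i, j)) w else 0)"
    using lower_pow_hahn_map_le by blast
  have "F = 0" if F: "F \<in> dsum (branch_set k) bispecht_family" and F0: "hahn_sum k F = 0" for F
  proof (rule ccontr)
    assume "F \<noteq> 0"
    let ?w = "\<lambda>p x. F (p, x)"
    \<comment> \<open>\<open>p\<close> is a nonzero component with the largest \<open>k - i - j\<close>.\<close>
    define m where "m p = k - fst p - snd p" for p :: "nat \<times> nat"
    define P where "P = {p \<in> branch_set k. ?w p \<noteq> 0}"
    obtain p0 x0 where "F (p0, x0) \<noteq> 0" using \<open>F \<noteq> 0\<close> by (auto simp: fun_eq_iff)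
    then have "p0 \<in> P" using F by (cases p0) (auto simp: P_def dsum_def fun_eq_iff)
    moreover have finP: "finite P" unfolding P_def using finite_branch_set by simp
    ultimately have "Max (m ` P) \<in> m ` P" by (intro Max_in) auto
    then obtain p where p: "p \<in> P" "m p = Max (m ` P)" by auto
    have max: "m q \<le> m p" if "q \<in> P" for q unfolding p(2) using finP that by simp
    obtain i j where ij: "p = (i, j)" by (cases p)
    have pI: "(i, j) \<in> branch_set k" "?w (i, j) \<noteq> 0" using p(1) by (auto simp: P_def ij)
    then obtain Z where Z: "F ((i, j), Z) \<noteq> 0" by (auto simp: fun_eq_iff)
    have "(lower A ^^ m p) (hahn_map k q (?w q)) Z = (if q = p then c p * F (p, Z) else 0)"
      if q: "q \<in> branch_set k" for q
    proof (cases "q \<in> P")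
      case True
      obtain i' j' where ij': "q = (i', j')" by (cases q)
      have w: "?w q \<in> bispecht A B i' j'" using dsum_component[OF F] q ij' by simp
      have "k - i' - j' \<le> m p" using max[OF True] by (simp add: m_def ij')
      from c(2)[OF q[unfolded ij'] w this] have
        "(lower A ^^ m p) (hahn_map k q (?w q)) Z = (if m p = m q then c q * F (q, Z) else 0)"
        by (simp add: ij' m_def)
      moreover have "F (q, Z) = 0" if "q \<noteq> p"
      proof -
        have "(card (Z \<inter> A), card (Z \<inter> B)) = (i, j)"
          using bispecht_apply_eq_0[OF dsum_component[OF F pI(1)], of Z] Z by blast
        then have "(card (Z \<inter> A), card (Z \<inter> B)) \<noteq> (i', j')" using that ij ij' by metis
        then show ?thesis by (rule bispecht_apply_eq_0[OF w])
      qed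
      ultimately show ?thesis by auto
    next
      case False
      then have "?w q = 0" "q \<noteq> p" using q p(1) by (auto simp: P_def)
      then show ?thesis
        by (simp add: linear_on_UNIV_zero[OF linear_hahn_map]
            linear_on_UNIV_zero[OF linear_on_pow[OF linear_lower]])
    qed
    then have "(lower A ^^ m p) (hahn_sum k F) Z = (\<Sum>q\<in>branch_set k. if q = p then c p * F (p, Z) else 0)"
      unfolding hahn_sum_def linear_on_UNIV_sum[OF linear_on_pow[OF linear_lower]] sum_cfun_apply
      by (intro sum.cong) auto
    also have "\<dots> = c p * F (p, Z)" using finite_branch_set pI(1) ij by simp
    finally show False
      using F0 Z c(1)[OF pI(1)] ij by (simp add: linear_on_UNIV_zero[OF linear_on_pow[OF linear_lower]])
  qed
  then show ?thesis
    using inj_on_linear_iff[OF subspace_dsum_bispecht linear_hahn_sum] by blast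
qed

text \<open>Induction on \<open>m\<close> for the functions killed by \<open>lower A ^^ m\<close>: the components of
  \<open>(lower A ^^ m) f\<close> are matched by images of Hahn maps, whose subtraction leaves a function
  killed by a lower power. It is used with \<open>m = k + 1\<close>, as a \<open>k\<close>-set contains at most \<open>k\<close>
  points of \<open>A\<close>.\<close>

lemma hahn_sum_surj: "Sspace (A \<union> B) k \<subseteq> hahn_sum k ` dsum (branch_set k) bispecht_family"
proof
  obtain c where c: "\<And>p. p \<in> branch_set k \<Longrightarrow> c p \<noteq> (0::complex)"
    "\<And>i j w m. (i, j) \<in> branch_set k \<Longrightarrow> w \<in> bispecht A B i j \<Longrightarrow> k - i - j \<le> m \<Longrightarrow>
      (lower A ^^ m) (hahn_map k (i, j) w) = (if m = k - i - j then fscale (c (i, j)) w else 0)"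
    using lower_pow_hahn_map_le by blast
  let ?D = "dsum (branch_set k) bispecht_family"
  have image: "cfun.subspace (hahn_sum k ` ?D)"
    by (rule subspace_linear_image[OF subspace_dsum_bispecht linear_hahn_sum])
  have main: "f \<in> hahn_sum k ` ?D" if "f \<in> Sspace (A \<union> B) k" "(lower A ^^ m) f = 0" for f m
    using that
  proof (induction m arbitrary: f)
    case 0
    from 0(2) have "f = 0" by (simp only: funpow_0)
    then show ?case using cfun.subspace_0[OF image] by (simp only:)
  next
    case (Suc m)
    define g where "g = (lower A ^^ m) f"
    have gA: "lower A g = 0" using Suc.prems(2) by (simp only: g_def funpow.simps comp_apply)
    note part = lower_pow_part_bispecht[OF Suc.prems(1) g_def gA]
    have fl: "f \<in> level (A \<union> B) k" using Suc.prems(1) finA finB by (simp add: Sspace_eq)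
    define sel where "sel p \<longleftrightarrow> fst p + snd p + m = k" for p :: "nat \<times> nat"
    define F where "F = (\<lambda>(p, x). if p \<in> branch_set k \<and> sel p
      then inverse (c p) * restrict_level B (snd p) g x else 0)"
    have comp: "(\<lambda>x. F ((i, j), x)) = (if sel (i, j) then fscale (inverse (c (i, j))) (restrict_level B j g) else 0)"
      if "(i, j) \<in> branch_set k" for i j using that by (auto simp: F_def fun_eq_iff)
    have K0: "cfun.subspace (bispecht A B i j)" for i j using subrep_bispecht by (simp add: subrep_def)
    have compK: "(\<lambda>x. F ((i, j), x)) \<in> bispecht A B i j" if "(i, j) \<in> branch_set k" for i j
      unfolding comp[OF that] using part(1) cfun.subspace_scale[OF K0] cfun.subspace_0[OF K0]
      by (simp add: sel_def)
    have F: "F \<in> ?D" using compK by (auto simp: dsum_def F_def)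
    have "(lower A ^^ m) (hahn_map k p (\<lambda>x. F (p, x))) Z = (if sel p then restrict_level B (snd p) g Z else 0)"
      if p: "p \<in> branch_set k" for p Z
    proof (cases "sel p")
      case True
      obtain i j where ij: "p = (i, j)" by (cases p)
      have m: "m = k - i - j" using True by (simp add: sel_def ij)
      have "(lower A ^^ m) (hahn_map k (i, j) (\<lambda>x. F ((i, j), x))) = fscale (c (i, j)) (\<lambda>x. F ((i, j), x))"
        using c(2)[OF p[unfolded ij] compK[OF p[unfolded ij]], of m] m by simp
      then show ?thesis using True p c(1)[OF p] unfolding ij by (simp add: F_def)
    next
      case False
      then have "(\<lambda>x. F (p, x)) = 0" by (auto simp: F_def fun_eq_iff)
      then show ?thesis using False
        by (simp add: linear_on_UNIV_zero[OF linear_hahn_map]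
            linear_on_UNIV_zero[OF linear_on_pow[OF linear_lower]])
    qed
    then have low: "(lower A ^^ m) (hahn_sum k F) Z
        = (\<Sum>p\<in>branch_set k. if sel p then restrict_level B (snd p) g Z else 0)" for Z
      unfolding hahn_sum_def linear_on_UNIV_sum[OF linear_on_pow[OF linear_lower]] sum_cfun_apply
      by (intro sum.cong) auto
    have "(lower A ^^ m) (hahn_sum k F) Z = g Z" for Z
    proof (cases "g Z = 0")
      case True
      then show ?thesis unfolding low by (intro sum.neutral[THEN trans]) (auto simp: restrict_level_def)
    next
      case False
      let ?p = "(card (Z \<inter> A), card (Z \<inter> B))"
      have s: "card (Z \<inter> A) + card (Z \<inter> B) + m = k"
        using lower_pow_level_Un[OF fl] False unfolding g_def .
      have pI: "?p \<in> branch_set k"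
      proof (rule ccontr)
        assume "?p \<notin> branch_set k"
        then have "restrict_level B (card (Z \<inter> B)) g Z = 0" using part(2)[OF s] by simp
        then show False using False by (simp add: restrict_level_def)
      qed
      have "(if sel p then restrict_level B (snd p) g Z else 0) = (if p = ?p then g Z else 0)" for p
        using s by (cases p) (auto simp: sel_def restrict_level_def)
      then show ?thesis unfolding low using pI finite_branch_set by simp
    qed
    then have "(lower A ^^ m) (hahn_sum k F) = g" ..
    then have "(lower A ^^ m) (f - hahn_sum k F) = 0"
      unfolding linear_on_UNIV_diff[OF linear_on_pow[OF linear_lower]] by (simp add: g_def)
    moreover have "f - hahn_sum k F \<in> Sspace (A \<union> B) k"
      by (rule cfun.subspace_diff[OF subspace_Sspace Suc.prems(1) hahn_sum_Sspace[OF F]])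
    ultimately have "f - hahn_sum k F \<in> hahn_sum k ` ?D" by (intro Suc.IH)
    from cfun.subspace_add[OF image this imageI[OF F]] show ?case by simp
  qed
  fix f assume f: "f \<in> Sspace (A \<union> B) k"
  have "(lower A ^^ Suc k) f Z = 0" for Z
  proof (rule ccontr)
    assume "(lower A ^^ Suc k) f Z \<noteq> 0"
    moreover have "f \<in> level (A \<union> B) k" using f finA finB by (simp add: Sspace_eq)
    ultimately show False using lower_pow_level_Un by fastforce
  qed
  then have "(lower A ^^ Suc k) f = 0" by (intro ext) (simp only: zero_fun_apply)
  then show "f \<in> hahn_sum k ` ?D" by (rule main[OF f])
qed

lemma subrep_Sspace: "subrep (part_group A B) perm_act (Sspace (A \<union> B) k)"
  unfolding subrep_def
proof (intro conjI ballI subspace_Sspace)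
  fix \<pi> f assume \<pi>: "\<pi> \<in> part_group A B" and f: "f \<in> Sspace (A \<union> B) k"
  note D = part_groupD[OF \<pi>] part_group_vimage[OF \<pi>]
  have Y: "\<pi> ` (A \<union> B) = A \<union> B" "\<pi> -` (A \<union> B) = A \<union> B" using D by auto
  show "perm_act \<pi> f \<in> Sspace (A \<union> B) k"
    using f D(2) Y finA finB
    by (simp add: Sspace_eq perm_act_level perm_act_subsets_of lower_perm_act
        linear_on_UNIV_zero[OF linear_perm_act])
qed

lemma Sspace_iso_dsum:
  "rep_iso (part_group A B) perm_act (Sspace (A \<union> B) k)
    (dsum_act perm_act) (dsum (branch_set k) bispecht_family)"
proof (rule rep_iso_sym)
  have "bij_betw (hahn_sum k) (dsum (branch_set k) bispecht_family) (Sspace (A \<union> B) k)"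
    unfolding bij_betw_def using inj_on_hahn_sum hahn_sum_surj hahn_sum_Sspace by blast
  then show "rep_iso (part_group A B) (dsum_act perm_act) (dsum (branch_set k) bispecht_family)
      perm_act (Sspace (A \<union> B) k)"
    unfolding rep_iso_def using linear_hahn_sum hahn_sum_equivariant by blast
  show "subrep (part_group A B) (dsum_act perm_act) (dsum (branch_set k) bispecht_family)"
    by (rule subrep_dsum) (auto simp: subrep_bispecht linear_perm_act)
qed

lemma inj_on_hahn_map:
  assumes p: "(i, j) \<in> branch_set k"
  shows "inj_on (hahn_map k (i, j)) (bispecht A B i j)"
proof -
  have K0: "cfun.subspace (bispecht A B i j)" using subrep_bispecht by (simp add: subrep_def)
  obtain c where c: "c \<noteq> 0" "\<And>w. w \<in> bispecht A B i j \<Longrightarrow> (lower A ^^ (k - i - j)) (hahn_map k (i, j) w) = fscale c w"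
    using lower_pow_hahn_map[OF p] by metis
  have "w = 0" if w: "w \<in> bispecht A B i j" "hahn_map k (i, j) w = 0" for w
  proof -
    have "fscale c w = 0"
      using c(2)[OF w(1)] unfolding w(2) linear_on_UNIV_zero[OF linear_on_pow[OF linear_lower]] by simp
    then show ?thesis using c(1) by (simp add: fun_eq_iff)
  qed
  then show ?thesis
    using inj_on_linear_iff[OF K0 linear_on_subset[OF linear_hahn_map subset_UNIV]] by blast
qed

lemma multiplicity_free_bispecht:
  "multiplicity_free_family (part_group A B) perm_act (branch_set k) bispecht_family"
  unfolding multiplicity_free_family_def
proof (intro conjI ballI impI)
  fix p assume p: "p \<in> branch_set k"
  have ne: "bispecht A B (fst p) (snd p) \<noteq> {0}"
    by (rule bispecht_nonzero) (use p in \<open>auto simp: branch_set_def\<close>)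
  show "irreducible_rep (part_group A B) perm_act (bispecht_family p)"
    using irreducible_bispecht[OF ne] by (simp add: case_prod_beta)
  fix q assume "q \<in> branch_set k" "p \<noteq> q"
  then show "\<not> rep_iso (part_group A B) perm_act (bispecht_family p) perm_act (bispecht_family q)"
    using bispecht_iso_imp_eq[of "fst p" "snd p" "fst q" "snd q"] ne
    by (auto simp: case_prod_beta prod_eq_iff)
qed

lemma rep_multiplicity_bispecht:
  assumes "2 * i \<le> card A" "2 * j \<le> card B"
  shows "rep_multiplicity (part_group A B) perm_act (bispecht A B i j) perm_act (Sspace (A \<union> B) k)
    = (if (i, j) \<in> branch_set k then 1 else 0)"
proof -
  let ?G = "part_group A B"
  have ne: "bispecht A B i' j' \<noteq> {0}" if "(i', j') \<in> branch_set k" for i' j'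
    by (rule bispecht_nonzero) (use that in \<open>auto simp: branch_set_def\<close>)
  have refl: "rep_iso ?G perm_act (bispecht A B i j) perm_act (bispecht A B i j)"
    unfolding rep_iso_def
    by (rule exI[of _ id]) (simp add: linear_on_def equivariant_on_def)
  have iff: "rep_iso ?G perm_act (bispecht A B i' j') perm_act (bispecht A B i j) \<longleftrightarrow> i' = i \<and> j' = j"
    if "(i', j') \<in> branch_set k" for i' j'
    using bispecht_iso_imp_eq[OF _ ne[OF that]] refl by blast
  have "{p \<in> branch_set k. rep_iso ?G perm_act (bispecht_family p) perm_act (bispecht A B i j)}
      = (if (i, j) \<in> branch_set k then {(i, j)} else {})"
    by (auto simp: iff)
  moreover have "rep_multiplicity ?G perm_act (bispecht A B i j) perm_act (Sspace (A \<union> B) k)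
      = card {p \<in> branch_set k. rep_iso ?G perm_act (bispecht_family p) perm_act (bispecht A B i j)}"
    by (rule rep_multiplicity_multiplicity_free[OF subrep_Sspace finite_branch_set linear_perm_act
          linear_perm_act multiplicity_free_bispecht Sspace_iso_dsum])
  ultimately show ?thesis by simp
qed

lemma hahn_map_tensor:
  assumes p: "(i, j) \<in> branch_set k" and \<phi>: "\<phi> \<in> Sspace A i" and \<psi>: "\<psi> \<in> Sspace B j"
  shows "hahn_map k (i, j) (tensor A i B j \<phi> \<psi>) =
    (\<Sum>l = j..k - i. fscale (of_int (hahn_E (int k - int i - int j) (int (card B) - 2 * int j)
        (int (card A) - 2 * int i) (int k - int i - int j) (int l - int j)))
      (tensor A (k - l) B l (R_map A (k - l - i) \<phi>) (R_map B (l - j) \<psi>)))"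
proof -
  define m where "m = k - i - j"
  have k: "k = i + j + m" using p by (simp add: branch_set_def m_def)
  have m: "int k - int i - int j = int m" by (simp add: k)
  define E :: "int \<Rightarrow> complex"
    where "E x = of_int (hahn_E (int m) (int (card B) - 2 * int j) (int (card A) - 2 * int i) (int m) x)" for x
  have \<phi>': "\<phi> \<in> subsets_of A" "\<phi> \<in> level A i" and \<psi>': "\<psi> \<in> subsets_of B" "\<psi> \<in> level B j"
    using \<phi> \<psi> by (auto simp: Sspace_eq finA finB)
  have "hahn_map k (i, j) (tensor A i B j \<phi> \<psi>) =
      (\<Sum>x<Suc m. fscale (E (int x) / (fact (m - x) * fact x))
        (fun_product A B ((raise A ^^ (m - x)) \<phi>) ((raise B ^^ x) \<psi>)))"
    unfolding tensor_eq_fun_product[OF \<phi>'(2) \<psi>'(2)] hahn_map_def prod.case m_def[symmetric]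
      raise_sum_def raise_pow_fun_product E_def ..
  also have "\<dots> = (\<Sum>x<Suc m. fscale (E (int x))
      (tensor A (i + (m - x)) B (j + x) (R_map A (m - x) \<phi>) (R_map B x \<psi>)))"
  proof (rule sum.cong)
    fix x
    have "fun_product A B ((raise A ^^ (m - x)) \<phi>) ((raise B ^^ x) \<psi>)
        = fscale (fact (m - x) * fact x) (fun_product A B (R_map A (m - x) \<phi>) (R_map B x \<psi>))"
      unfolding raise_pow_eq_R_map[OF finA \<phi>'(1)] raise_pow_eq_R_map[OF finB \<psi>'(1)]
      by (simp add: fun_product_def fun_eq_iff)
    then show "fscale (E (int x) / (fact (m - x) * fact x))
        (fun_product A B ((raise A ^^ (m - x)) \<phi>) ((raise B ^^ x) \<psi>))
      = fscale (E (int x)) (tensor A (i + (m - x)) B (j + x) (R_map A (m - x) \<phi>) (R_map B x \<psi>))"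
      unfolding tensor_eq_fun_product[OF R_map_Mspace(2)[OF finA \<phi>'] R_map_Mspace(2)[OF finB \<psi>']]
      by (simp add: fun_eq_iff)
  qed simp
  also have "\<dots> = (\<Sum>l = j..k - i. fscale (E (int l - int j))
      (tensor A (k - l) B l (R_map A (k - l - i) \<phi>) (R_map B (l - j) \<psi>)))"
    by (rule sum.reindex_bij_witness[of _ "\<lambda>l. l - j" "\<lambda>x. j + x"])
      (auto simp: k algebra_simps)
  finally show ?thesis unfolding m E_def .
qed

end

lemma stab_group_eq:
  assumes "h \<le> n"
  shows "stab_group n h = part_group {1..h} {h + 1..n}"
proof -
  have "{1..h} \<union> {h + 1..n} = {1..n}" using assms by auto
  then show ?thesis by (auto simp: stab_group_def stabilizer_def sym_group_def part_group_def)
qed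

theorem corollary2p4:
  fixes n h k :: nat
  assumes "h \<le> n" and "2 * k \<le> n"
  shows
    "(\<forall>i j. 2 * i \<le> h \<and> 2 * j \<le> n - h \<longrightarrow>
        rep_multiplicity (stab_group n h) perm_act (S_tensor {1..h} i {h+1..n} j)
          perm_act (Sspace {1..n} k)
        = (if int k - int h \<le> int j - int i \<and> int j - int i \<le> int n - int h - int k \<and> i + j \<le> k
           then 1 else 0))
     \<and> rep_iso (stab_group n h) perm_act (Sspace {1..n} k)
          (dsum_act perm_act)
          (dsum (branching_pairs n h k) (\<lambda>(i, j). S_tensor {1..h} i {h+1..n} j))
     \<and> multiplicity_free_family (stab_group n h) perm_act
          (branching_pairs n h k) (\<lambda>(i, j). S_tensor {1..h} i {h+1..n} j)
     \<and> (\<forall>(i, j) \<in> branching_pairs n h k. \<exists>T.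
          (\<forall>\<phi> \<in> Sspace {1..h} i. \<forall>\<psi> \<in> Sspace {h+1..n} j.
             T (tensor {1..h} i {h+1..n} j \<phi> \<psi>) =
               (\<Sum>l = j..k - i.
                  fscale (of_int (hahn_E (int k - int i - int j) (int n - int h - 2 * int j)
                                    (int h - 2 * int i) (int k - int i - int j) (int l - int j)))
                    (tensor {1..h} (k - l) {h+1..n} l
                       (R_map {1..h} (k - l - i) \<phi>) (R_map {h+1..n} (l - j) \<psi>))))
          \<and> linear_on (S_tensor {1..h} i {h+1..n} j) T
          \<and> equivariant_on (stab_group n h) perm_act (S_tensor {1..h} i {h+1..n} j) perm_act T
          \<and> inj_on T (S_tensor {1..h} i {h+1..n} j)
          \<and> T ` S_tensor {1..h} i {h+1..n} j \<subseteq> Sspace {1..n} k)"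
proof -
  let ?A = "{1..h}" and ?B = "{h + 1..n}"
  interpret two_parts ?A ?B by unfold_locales auto
  have cards: "card ?A = h" "card ?B = n - h" by simp_all
  have AB: "?A \<union> ?B = {1..n}" using assms by auto
  have I: "branching_pairs n h k = branch_set k"
    unfolding branching_pairs_def branch_set_def cards using assms(1) by auto
  have nh: "int n - int h = int (n - h)" using assms(1) by simp
  have S: "S_tensor ?A i ?B j = bispecht ?A ?B i j" if "2 * i \<le> h" "2 * j \<le> n - h" for i j
    using S_tensor_eq_bispecht[of i j] that unfolding cards by blast
  have SI: "S_tensor ?A i ?B j = bispecht ?A ?B i j" if "(i, j) \<in> branch_set k" for i j
    by (rule S) (use that in \<open>unfold branch_set_def cards, auto\<close>)
  have SI': "(case p of (i, j) \<Rightarrow> S_tensor ?A i ?B j) = bispecht_family p" if "p \<in> branch_set k" for p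
    using SI that by (cases p) (simp only: prod.case)
  have dsum: "dsum (branch_set k) (\<lambda>(i, j). S_tensor ?A i ?B j) = dsum (branch_set k) bispecht_family"
    unfolding dsum_def by (simp only: SI' cong: ball_cong)
  have mff: "multiplicity_free_family G \<rho> (branch_set k) (\<lambda>(i, j). S_tensor ?A i ?B j)
      = multiplicity_free_family G \<rho> (branch_set k) bispecht_family" for G \<rho>
    unfolding multiplicity_free_family_def by (simp only: SI' cong: ball_cong)
  have G: "stab_group n h = part_group ?A ?B" by (rule stab_group_eq[OF assms(1)])
  show ?thesis
  proof (intro conjI)
    show "\<forall>i j. 2 * i \<le> h \<and> 2 * j \<le> n - h \<longrightarrow>
        rep_multiplicity (stab_group n h) perm_act (S_tensor ?A i ?B j) perm_act (Sspace {1..n} k)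
        = (if int k - int h \<le> int j - int i \<and> int j - int i \<le> int n - int h - int k \<and> i + j \<le> k
           then 1 else 0)"
    proof (intro allI impI)
      fix i j assume ij: "2 * i \<le> h \<and> 2 * j \<le> n - h"
      then have iff: "(i, j) \<in> branch_set k \<longleftrightarrow>
          int k - int h \<le> int j - int i \<and> int j - int i \<le> int n - int h - int k \<and> i + j \<le> k"
        unfolding I[symmetric] branching_pairs_def by simp
      note eq = rep_multiplicity_bispecht[of i j k, unfolded cards AB, OF conjunct1[OF ij] conjunct2[OF ij]]
      show "rep_multiplicity (stab_group n h) perm_act (S_tensor ?A i ?B j) perm_act (Sspace {1..n} k)
        = (if int k - int h \<le> int j - int i \<and> int j - int i \<le> int n - int h - int k \<and> i + j \<le> k
           then 1 else 0)"
        unfolding S[OF conjunct1[OF ij] conjunct2[OF ij]] G eq iff ..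
    qed
    show "rep_iso (stab_group n h) perm_act (Sspace {1..n} k) (dsum_act perm_act)
        (dsum (branching_pairs n h k) (\<lambda>(i, j). S_tensor ?A i ?B j))"
      using Sspace_iso_dsum[of k] unfolding I dsum G AB .
    show "multiplicity_free_family (stab_group n h) perm_act (branching_pairs n h k)
        (\<lambda>(i, j). S_tensor ?A i ?B j)"
      using multiplicity_free_bispecht[of k] unfolding I mff G .
    show "\<forall>(i, j) \<in> branching_pairs n h k. \<exists>T.
          (\<forall>\<phi> \<in> Sspace ?A i. \<forall>\<psi> \<in> Sspace ?B j.
             T (tensor ?A i ?B j \<phi> \<psi>) =
               (\<Sum>l = j..k - i.
                  fscale (of_int (hahn_E (int k - int i - int j) (int n - int h - 2 * int j)
                                    (int h - 2 * int i) (int k - int i - int j) (int l - int j)))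
                    (tensor ?A (k - l) ?B l (R_map ?A (k - l - i) \<phi>) (R_map ?B (l - j) \<psi>))))
          \<and> linear_on (S_tensor ?A i ?B j) T
          \<and> equivariant_on (stab_group n h) perm_act (S_tensor ?A i ?B j) perm_act T
          \<and> inj_on T (S_tensor ?A i ?B j)
          \<and> T ` S_tensor ?A i ?B j \<subseteq> Sspace {1..n} k"
      unfolding I
    proof (intro ballI, clarify)
      fix i j assume p: "(i, j) \<in> branch_set k"
      have "equivariant_on (stab_group n h) perm_act (S_tensor ?A i ?B j) perm_act (hahn_map k (i, j))"
        unfolding equivariant_on_def G using hahn_map_perm_act by blast
      moreover have "linear_on (S_tensor ?A i ?B j) (hahn_map k (i, j))"
        by (rule linear_on_subset[OF linear_hahn_map subset_UNIV])
      moreover have "inj_on (hahn_map k (i, j)) (S_tensor ?A i ?B j)"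
        unfolding SI[OF p] by (rule inj_on_hahn_map[OF p])
      moreover have "hahn_map k (i, j) ` S_tensor ?A i ?B j \<subseteq> Sspace {1..n} k"
        unfolding SI[OF p] using hahn_map_Sspace[OF p] unfolding AB by blast
      moreover note hahn_map_tensor[OF p, unfolded cards nh[symmetric]]
      ultimately show "\<exists>T. (\<forall>\<phi> \<in> Sspace ?A i. \<forall>\<psi> \<in> Sspace ?B j.
             T (tensor ?A i ?B j \<phi> \<psi>) =
               (\<Sum>l = j..k - i.
                  fscale (of_int (hahn_E (int k - int i - int j) (int n - int h - 2 * int j)
                                    (int h - 2 * int i) (int k - int i - int j) (int l - int j)))
                    (tensor ?A (k - l) ?B l (R_map ?A (k - l - i) \<phi>) (R_map ?B (l - j) \<psi>))))
          \<and> linear_on (S_tensor ?A i ?B j) T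
          \<and> equivariant_on (stab_group n h) perm_act (S_tensor ?A i ?B j) perm_act T
          \<and> inj_on T (S_tensor ?A i ?B j)
          \<and> T ` S_tensor ?A i ?B j \<subseteq> Sspace {1..n} k"
        by (intro exI[of _ "hahn_map k (i, j)"] conjI ballI)
    qed
  qed
qed

end
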